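(* Let $B_1\subset\mathbb R^5$ be the open unit ball centered at the origin. For every real number $0\le s\le5$, there exist a function $u\in C^{1,1}(B_1)$ and a uniformly elliptic operator $F:\operatorname{Sym}(5)\to\mathbb R$ such that $F(D^2u)=0$ in $B_1$ in the viscosity sense and $$\dim_{\mathcal H}\operatorname{Sing}(u)=s.$$ Moreover, when $s>0$, the set $\operatorname{Sing}(u)$ may be chosen to have either zero or positive finite $s$-dimensional Hausdorff measure: that is, for each $s\in(0,5]$ there is such a pair $(u,F)$ with $\mathcal H^s(\operatorname{Sing}(u))=0$, and there is also such a pair with $0<\mathcal H^s(\operatorname{Sing}(u))<\infty$.
   Context: $\operatorname{Sym}(n)$ is the space of real symmetric $n\times n$ matrices. An operator $F:\operatorname{Sym}(n)\to\mathbb R$ is uniformly elliptic if there are constants $\Lambda\ge\lambda>0$ with $\lambda\operatorname{tr}N\le F(M+N)-F(M)\le\Lambda\operatorname{tr}N$ for every $M\in\operatorname{Sym}(n)$ and every $N\ge0$. A continuous $u$ satisfies $F(D^2u)=0$ in $B_1$ in the viscosity sense if, whenever $\phi$ is $C^2$ near $x_0\in B_1$ and touches $u$ from above (resp. below) at $x_0$, i.e. $\phi(x_0)=u(x_0)$ and $\phi\ge u$ (resp. $\phi\le u$) near $x_0$, then $F(D^2\phi(x_0))\ge0$ (resp. $\le0$). $\operatorname{Sing}(u)$ is the set of $x\in B_1$ for which there is no neighborhood $U\subset B_1$ of $x$ with $u\in C^2(U)$. $C^{1,1}(B_1)$ means that $u$ is $C^1$ with Lipschitz gradient on $B_1$.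 $\dim_{\mathcal H}$ and $\mathcal H^s$ denote Hausdorff dimension and $s$-dimensional Hausdorff measure. *)

theory Defs
  imports "HOL-Analysis.Analysis"
begin

subsection \<open>Regularity classes\<close>

definition grad :: "(real ^ 'n \<Rightarrow> real) \<Rightarrow> real ^ 'n \<Rightarrow> real ^ 'n" where
  "grad f x = (\<chi> i. frechet_derivative f (at x) (axis i 1))"

definition hessian :: "(real ^ 'n \<Rightarrow> real) \<Rightarrow> real ^ 'n \<Rightarrow> real ^ 'n ^ 'n" where
  "hessian f x = matrix (frechet_derivative (grad f) (at x))"

(* Intended for open U, where "differentiable_on" is pointwise (Frechet) differentiability and
   the derivatives in grad and hessian are uniquely determined. *)
definition C2_on :: "(real ^ 'n) set \<Rightarrow> (real ^ 'n \<Rightarrow> real) \<Rightarrow> bool" where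
  "C2_on U f \<longleftrightarrow>
     f differentiable_on U \<and> grad f differentiable_on U \<and> continuous_on U (hessian f)"

(* A Lipschitz gradient is continuous, so f is C^1. *)
definition C11_on :: "(real ^ 'n) set \<Rightarrow> (real ^ 'n \<Rightarrow> real) \<Rightarrow> bool" where
  "C11_on U f \<longleftrightarrow> f differentiable_on U \<and> (\<exists>L. L-lipschitz_on U (grad f))"

subsection \<open>Uniformly elliptic operators and viscosity solutions\<close>

definition Sym :: "(real ^ 'n ^ 'n) set" where
  "Sym = {M. transpose M = M}"

definition nonneg_matrix :: "real ^ 'n ^ 'n \<Rightarrow> bool" where
  "nonneg_matrix N \<longleftrightarrow> N \<in> Sym \<and> (\<forall>x. 0 \<le> x \<bullet> (N *v x))"

(* An operator on Sym is given by a function on all matrices whose values outside Sym are never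
   constrained; they do not matter below, since Hessians of C^2 functions are symmetric. *)
definition uniformly_elliptic :: "(real ^ 'n ^ 'n \<Rightarrow> real) \<Rightarrow> bool" where
  "uniformly_elliptic F \<longleftrightarrow>
     (\<exists>l L. 0 < l \<and> l \<le> L \<and>
        (\<forall>M\<in>Sym. \<forall>N. nonneg_matrix N \<longrightarrow>
           l * trace N \<le> F (M + N) - F M \<and> F (M + N) - F M \<le> L * trace N))"

definition C2_near :: "real ^ 'n \<Rightarrow> (real ^ 'n \<Rightarrow> real) \<Rightarrow> bool" where
  "C2_near x \<phi> \<longleftrightarrow> (\<exists>U. open U \<and> x \<in> U \<and> C2_on U \<phi>)"

definition touches_above :: "(real ^ 'n \<Rightarrow> real) \<Rightarrow> (real ^ 'n \<Rightarrow> real) \<Rightarrow> real ^ 'n \<Rightarrow> bool" where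
  "touches_above \<phi> u x \<longleftrightarrow> \<phi> x = u x \<and> (\<forall>\<^sub>F y in nhds x. u y \<le> \<phi> y)"

definition touches_below :: "(real ^ 'n \<Rightarrow> real) \<Rightarrow> (real ^ 'n \<Rightarrow> real) \<Rightarrow> real ^ 'n \<Rightarrow> bool" where
  "touches_below \<phi> u x \<longleftrightarrow> \<phi> x = u x \<and> (\<forall>\<^sub>F y in nhds x. \<phi> y \<le> u y)"

(* F(D^2 u) = 0 in the open set B. *)
definition viscosity_solution ::
    "(real ^ 'n ^ 'n \<Rightarrow> real) \<Rightarrow> (real ^ 'n) set \<Rightarrow> (real ^ 'n \<Rightarrow> real) \<Rightarrow> bool" where
  "viscosity_solution F B u \<longleftrightarrow>
     continuous_on B u \<and>
     (\<forall>x\<in>B. \<forall>\<phi>. C2_near x \<phi> \<longrightarrow>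
        (touches_above \<phi> u x \<longrightarrow> 0 \<le> F (hessian \<phi> x)) \<and>
        (touches_below \<phi> u x \<longrightarrow> F (hessian \<phi> x) \<le> 0))"

definition Sing :: "(real ^ 'n) set \<Rightarrow> (real ^ 'n \<Rightarrow> real) \<Rightarrow> (real ^ 'n) set" where
  "Sing B u = {x \<in> B. \<not> (\<exists>U. open U \<and> x \<in> U \<and> U \<subseteq> B \<and> C2_on U u)}"

subsection \<open>Hausdorff measure and dimension\<close>

(* (diam U)^s with the conventions needed at s = 0 (where "0 powr 0 = 0" would be wrong):
   0 for the empty set and 1 for every nonempty set. *)
definition diam_pow :: "real \<Rightarrow> 'a::metric_space set \<Rightarrow> ennreal" where
  "diam_pow s U = (if U = {} then 0 else if s = 0 then 1 else ennreal (diameter U powr s))"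

(* Boundedness is required explicitly because "diameter" is only meaningful on bounded sets. *)
definition hausdorff_premeasure :: "real \<Rightarrow> real \<Rightarrow> 'a::metric_space set \<Rightarrow> ennreal" where
  "hausdorff_premeasure s \<delta> A =
     (INF U \<in> {U :: nat \<Rightarrow> 'a set. A \<subseteq> (\<Union>i. U i) \<and> (\<forall>i. bounded (U i) \<and> diameter (U i) \<le> \<delta>)}.
        \<Sum>i. diam_pow s (U i))"

(* No normalising constant is included; it would not affect whether a set has zero, positive or
   finite measure. *)
definition hausdorff_measure :: "real \<Rightarrow> 'a::metric_space set \<Rightarrow> ennreal" where
  "hausdorff_measure s A = (SUP \<delta> \<in> {0<..}. hausdorff_premeasure s \<delta> A)"

definition hausdorff_dim :: "'a::metric_space set \<Rightarrow> ennreal" where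
  "hausdorff_dim A = Inf {ennreal s | s. 0 \<le> s \<and> hausdorff_measure s A = 0}"

end

theory Submission
  imports Defs
begin

text \<open>
  For a traceless symmetric \<open>3 \<times> 3\<close> matrix \<open>x\<close> let \<open>P x = det x / 2\<close>, suitably normalised; this is the
  Cartan cubic on \<open>\<real>\<^sup>5\<close>. For every \<open>t \<ge> 0\<close> the function \<open>P + t P / |x|\<close> has the property that the
  difference of any two of its Hessians has a largest eigenvalue bounded below both by a multiple of
  the distance of the base points and by a multiple of minus its trace: either the
  middle eigenvalue of the Hessian, an explicit function of \<open>|x|\<close> and \<open>P (x / |x|)\<close>, detects this, or
  pairing with the positive semidefinite matrices \<open>D\<^sup>2P(\<phi>) / 6 + |\<phi>| I\<close> does. The bound by
  the distance leaves room for perturbations, so \<open>P\<close> may be modified by small multiples of truncations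
  of \<open>P / |x|\<close>, rescaled to disjoint balls of radius \<open>\<rho>\<close> and of height of order \<open>\<rho>\<^sup>3\<close>. If the centres
  of the balls accumulate exactly at a compact set \<open>K\<close> with empty interior, the resulting
  \<open>C\<^sup>1\<^sup>,\<^sup>1\<close> function \<open>u\<close> is singular exactly at \<open>K\<close> and at the countably many centres.
  The trace bound makes \<open>F M = sup\<^sub>x (\<lambda>\<^sub>m\<^sub>i\<^sub>n (M - D\<^sup>2u(x)) + \<epsilon> tr (M - D\<^sup>2u(x)))\<close> vanish at every
  \<open>D\<^sup>2u(x)\<close>. Choosing \<open>K\<close> as the fifth power of a Cantor set of suitable interval lengths prescribes
  the dimension and the measure of the singular set.
\<close>

subsection \<open>The Cartan cubic\<close>

text \<open>The function \<open>u\<close> has no Hessian at its singular points, yet test functions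
  must be handled there. What replaces the Hessian is the limit of symmetric second differences, a
  quadratic form \<open>sol_hess x\<close> that exists at every point. At a centre it exists because
  the bump is odd, so its contributions cancel. On \<open>K\<close> it exists because a bump
  reaching distance d from a point of \<open>K\<close> has radius at most d, hence height O(d^3).
  The height \<rho>^3 has a second purpose: the bump Hessian then has size t = \<delta> \<rho> and a
  homogeneous part t \<open>W\<close>. As the Hessian of the cubic is linear in the base point,
  moving the origin to a centre does not change differences of Hessians. Hence estimates for
  \<open>H t\<close> that are uniform in t \<ge> 0 serve every bubble at once. Two errors remain:
  the Taylor part of a truncated bump, and pairs of points not lying in a common ball. Both are
  bounded by a small multiple of the distance of the points, the second because the truncation makes
  the bump Hessian vanish linearly at the boundary of its ball. Centres are countably many, so they
  do not affect Hausdorff measures of positive order. Empty interior of \<open>K\<close> provides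
  room for them; for s = 5 this calls for a Cantor set of positive volume.\<close>

lemma exhaust_5:
  fixes x :: 5
  shows "x = 1 \<or> x = 2 \<or> x = 3 \<or> x = 4 \<or> x = 5"
proof (induct x)
  case (of_int z)
  then have "z = 0 \<or> z = 1 \<or> z = 2 \<or> z = 3 \<or> z = 4" by auto
  then show ?case by auto
qed

lemma forall_5: "(\<forall>i::5. P i) \<longleftrightarrow> P 1 \<and> P 2 \<and> P 3 \<and> P 4 \<and> P 5"
  by (metis exhaust_5)

lemma sum_5: "sum f (UNIV :: 5 set) = f 1 + f 2 + f 3 + f 4 + f 5"
proof -
  have *: "UNIV = {1, 2, 3, 4, 5 :: 5}"
    using exhaust_5 by auto
  show ?thesis
    unfolding * by (simp add: ac_simps)
qed

definition vec5 :: "real \<Rightarrow> real \<Rightarrow> real \<Rightarrow> real \<Rightarrow> real \<Rightarrow> real ^ 5" where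
  "vec5 a b c d e =
     (\<chi> i. if i = 1 then a else if i = 2 then b else if i = 3 then c else if i = 4 then d else e)"

lemma vec5_nth [simp]:
  "vec5 a b c d e $ 1 = a" "vec5 a b c d e $ 2 = b" "vec5 a b c d e $ 3 = c"
  "vec5 a b c d e $ 4 = d" "vec5 a b c d e $ 5 = e"
  by (simp_all add: vec5_def)

lemma inner_5: "(x :: real ^ 5) \<bullet> y = x$1 * y$1 + x$2 * y$2 + x$3 * y$3 + x$4 * y$4 + x$5 * y$5"
  by (simp add: inner_vec_def sum_5)

lemma inner_3: "(x :: real ^ 3) \<bullet> y = x$1 * y$1 + x$2 * y$2 + x$3 * y$3"
  by (simp add: inner_vec_def sum_3)

definition s3 :: real where "s3 = sqrt 3"

lemma s3_sq [simp]: "s3 * s3 = 3" "s3 * (s3 * a) = 3 * a" "s3\<^sup>2 = 3"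
  by (simp_all add: s3_def flip: mult.assoc)

(* A vector stands for the traceless symmetric 3x3 matrix applied by symm3; under this
   identification mul is the traceless part of the Jordan product (see symm3_mul). *)
definition mul :: "real ^ 5 \<Rightarrow> real ^ 5 \<Rightarrow> real ^ 5" where
  "mul x y = vec5
     (x$1 * y$2 + x$2 * y$1 + s3 / 2 * (x$4 * y$4 - x$5 * y$5))
     (x$1 * y$1 - x$2 * y$2 + x$3 * y$3 - 1 / 2 * (x$4 * y$4 + x$5 * y$5))
     (s3 / 2 * (x$4 * y$5 + x$5 * y$4) + x$2 * y$3 + x$3 * y$2)
     (s3 / 2 * (x$3 * y$5 + x$5 * y$3) - 1 / 2 * (x$2 * y$4 + x$4 * y$2)
        + s3 / 2 * (x$1 * y$4 + x$4 * y$1))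
     (s3 / 2 * (x$3 * y$4 + x$4 * y$3) - s3 / 2 * (x$1 * y$5 + x$5 * y$1)
        - 1 / 2 * (x$2 * y$5 + x$5 * y$2))"

text \<open>Scaled so that the square of this matrix has trace 6 |x|^2 and its determinant is
  \<open>2 * cubic x\<close>.\<close>

definition symm3 :: "real ^ 5 \<Rightarrow> real ^ 3 \<Rightarrow> real ^ 3" where
  "symm3 x n = vector
     [(s3 * x$1 + x$2) * n$1 + s3 * x$3 * n$2 + s3 * x$4 * n$3,
      s3 * x$3 * n$1 + (x$2 - s3 * x$1) * n$2 + s3 * x$5 * n$3,
      s3 * x$4 * n$1 + s3 * x$5 * n$2 - 2 * x$2 * n$3]"

(* The vector representing the functional x \<mapsto> m \<bullet> symm3 x n. *)
definition dyad :: "real ^ 3 \<Rightarrow> real ^ 3 \<Rightarrow> real ^ 5" where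
  "dyad m n = vec5 (s3 * (m$1 * n$1 - m$2 * n$2)) (m$1 * n$1 + m$2 * n$2 - 2 * m$3 * n$3)
     (s3 * (m$1 * n$2 + m$2 * n$1)) (s3 * (m$1 * n$3 + m$3 * n$1)) (s3 * (m$2 * n$3 + m$3 * n$2))"

definition cubic :: "real ^ 5 \<Rightarrow> real" where
  "cubic x = mul x x \<bullet> x"

lemma mul_commute: "mul x y = mul y x"
  by (simp add: mul_def algebra_simps)

lemma bilinear_mul: "bilinear mul"
  unfolding bilinear_def
  by (auto intro!: linearI simp: vec_eq_iff forall_5 mul_def algebra_simps add_divide_distrib)

lemma mul_inner: "mul x y \<bullet> z = y \<bullet> mul x z"
  by (simp add: mul_def inner_5 algebra_simps)

text \<open>This is Cayley-Hamilton: a traceless 3x3 matrix A whose square has trace 6 |x|^2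
  satisfies A^3 = 3 |x|^2 A + det A, and the traceless product discards multiples of the
  identity.\<close>

lemma mul_self: "mul x (mul x x) = (x \<bullet> x) *\<^sub>R x"
  by (simp add: vec_eq_iff forall_5 mul_def inner_5 field_simps power2_eq_square)

lemma mul_self_inner: "mul x x \<bullet> mul x x = (x \<bullet> x)\<^sup>2"
  by (metis inner_commute inner_scaleR_left mul_inner mul_self power2_eq_square)

lemma symm3_mul:
  "symm3 (mul x y) n = (1/2) *\<^sub>R (symm3 x (symm3 y n) + symm3 y (symm3 x n)) - (2 * (x \<bullet> y)) *\<^sub>R n"
  by (simp add: vec_eq_iff forall_3 symm3_def mul_def inner_5 field_simps power2_eq_square)

lemma dyad_inner: "dyad m n \<bullet> x = m \<bullet> symm3 x n"
  by (simp add: dyad_def symm3_def inner_5 inner_3 field_simps)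

lemma symm3_inner: "symm3 x m \<bullet> n = m \<bullet> symm3 x n"
  by (simp add: symm3_def inner_3 algebra_simps)

lemma dyad_inner_dyad:
  "dyad m n \<bullet> dyad m' n' = 3 * ((m \<bullet> m') * (n \<bullet> n') + (m \<bullet> n') * (n \<bullet> m')) - 2 * (m \<bullet> n) * (m' \<bullet> n')"
  by (simp add: dyad_def inner_5 inner_3 field_simps)

lemma cubic_mul: "x \<bullet> mul x x = cubic x"
  by (simp add: cubic_def inner_commute)

lemma cubic_le: "\<bar>cubic x\<bar> \<le> norm x ^ 3"
proof -
  have "norm (mul x x) = (norm x)\<^sup>2"
    by (simp add: norm_eq_sqrt_inner mul_self_inner)
  then show ?thesis
    using Cauchy_Schwarz_ineq2[of "mul x x" x]
    by (simp add: cubic_def power2_eq_square power3_eq_cube)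
qed

lemma norm_mul_self: "norm (mul x x) = (norm x)\<^sup>2"
  by (simp add: norm_eq_sqrt_inner mul_self_inner)

lemmas mul_algebra =
  bilinear_ladd[OF bilinear_mul] bilinear_radd[OF bilinear_mul]
  bilinear_lsub[OF bilinear_mul] bilinear_rsub[OF bilinear_mul]
  bilinear_lmul[OF bilinear_mul] bilinear_rmul[OF bilinear_mul]
  bilinear_lneg[OF bilinear_mul] bilinear_rneg[OF bilinear_mul]
  bilinear_lzero[OF bilinear_mul] bilinear_rzero[OF bilinear_mul]

lemma mul_form_le: "\<bar>mul x e \<bullet> e\<bar> \<le> norm x * (norm e)\<^sup>2"
proof -
  have "mul x e \<bullet> e = x \<bullet> mul e e"
    by (metis inner_commute mul_commute mul_inner)
  then show ?thesis
    using Cauchy_Schwarz_ineq2[of x "mul e e"] by (simp add: norm_mul_self)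
qed

lemma norm_mul_le: "norm (mul x y) \<le> norm x * norm y"
proof -
  have main: "\<bar>mul x u \<bullet> v\<bar> \<le> norm x" if "norm u = 1" "norm v = 1" for u v
  proof -
    have "4 * (mul x u \<bullet> v) = mul x (u + v) \<bullet> (u + v) - mul x (u - v) \<bullet> (u - v)"
      using mul_inner[of x v u]
      by (simp add: mul_algebra inner_simps inner_commute)
    then have "\<bar>4 * (mul x u \<bullet> v)\<bar> \<le> norm x * (norm (u + v))\<^sup>2 + norm x * (norm (u - v))\<^sup>2"
      using mul_form_le[of x "u + v"] mul_form_le[of x "u - v"] by linarith
    also have "\<dots> = norm x * ((norm (u + v))\<^sup>2 + (norm (u - v))\<^sup>2)"
      by (simp add: algebra_simps)
    also have "(norm (u + v))\<^sup>2 + (norm (u - v))\<^sup>2 = 4"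
      using that by (simp add: power2_norm_eq_inner inner_simps inner_commute norm_eq_1)
    finally show ?thesis by simp
  qed
  show ?thesis
  proof (cases "y = 0 \<or> mul x y = 0")
    case True
    then show ?thesis by (auto simp: mul_algebra)
  next
    case False
    define v where "v = mul x y"
    have "\<bar>mul x (sgn y) \<bullet> sgn v\<bar> \<le> norm x"
      using False by (intro main) (auto simp: norm_sgn v_def)
    also have "mul x (sgn y) \<bullet> sgn v = norm v / norm y"
      using False
      by (simp add: sgn_div_norm mul_algebra v_def dot_square_norm power2_eq_square field_simps)
    finally show ?thesis
      using False by (simp add: v_def field_simps)
  qed
qed

lemma bounded_bilinear_mul: "bounded_bilinear mul"
  using bilinear_mul bilinear_conv_bounded_bilinear by blast

section \<open>Eigenframes of traceless symmetric 3x3 matrices\<close>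

lemma orthonormal_columns:
  fixes n1 n2 n3 :: "real ^ 3"
  assumes "norm n1 = 1" "norm n2 = 1" "norm n3 = 1"
    and "n1 \<bullet> n2 = 0" "n1 \<bullet> n3 = 0" "n2 \<bullet> n3 = 0"
  shows "n1$a * n1$b + n2$a * n2$b + n3$a * n3$b = (if a = b then 1 else 0)"
proof -
  define A :: "real ^ 3 ^ 3" where "A = vector [n1, n2, n3]"
  have "A ** transpose A = mat 1"
    using assms
    by (simp add: vec_eq_iff forall_3 matrix_matrix_mult_def transpose_def mat_def A_def
        norm_eq_1 inner_3 sum_3 mult.commute)
  then have "transpose A ** A = mat 1"
    using matrix_left_right_inverse by blast
  then have "(transpose A ** A) $ a $ b = mat 1 $ a $ b" by simp
  then show ?thesis
    by (simp add: matrix_matrix_mult_def transpose_def mat_def A_def sum_3)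
qed

lemma orthonormal_expand:
  fixes n1 n2 n3 v :: "real ^ 3"
  assumes "norm n1 = 1" "norm n2 = 1" "norm n3 = 1"
    and "n1 \<bullet> n2 = 0" "n1 \<bullet> n3 = 0" "n2 \<bullet> n3 = 0"
  shows "v = (v \<bullet> n1) *\<^sub>R n1 + (v \<bullet> n2) *\<^sub>R n2 + (v \<bullet> n3) *\<^sub>R n3"
proof -
  have "v$b = (v \<bullet> n1) * n1$b + (v \<bullet> n2) * n2$b + (v \<bullet> n3) * n3$b" for b
  proof -
    have "(v \<bullet> n1) * n1$b + (v \<bullet> n2) * n2$b + (v \<bullet> n3) * n3$b
        = v$1 * (n1$1 * n1$b + n2$1 * n2$b + n3$1 * n3$b)
        + v$2 * (n1$2 * n1$b + n2$2 * n2$b + n3$2 * n3$b)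
        + v$3 * (n1$3 * n1$b + n2$3 * n2$b + n3$3 * n3$b)"
      by (simp add: inner_3 algebra_simps)
    also have "\<dots> = v$b"
      unfolding orthonormal_columns[OF assms] using exhaust_3[of b] by auto
    finally show ?thesis by simp
  qed
  then show ?thesis by (simp add: vec_eq_iff)
qed

lemma linear_symm3: "linear (symm3 x)"
  by (auto intro!: linearI simp: vec_eq_iff forall_3 symm3_def algebra_simps)

text \<open>First variation of the Rayleigh quotient: moving from \<open>m\<close> along the defect
  \<open>w\<close> changes the nonnegative quantity \<alpha> (n . n) - n . \<open>symm3 x n\<close>
  by 2 h (w . w) to first order, so a small negative h gives a contradiction unless w = 0.\<close>

lemma symm3_eigenvector:
  assumes le: "\<And>n. n \<bullet> symm3 x n \<le> \<alpha> * (n \<bullet> n)" and eq: "m \<bullet> symm3 x m = \<alpha> * (m \<bullet> m)"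
  shows "symm3 x m = \<alpha> *\<^sub>R m"
proof -
  define w where "w = \<alpha> *\<^sub>R m - symm3 x m"
  define B where "B = \<alpha> * (w \<bullet> w) - w \<bullet> symm3 x w"
  have nonneg: "0 \<le> 2 * h * (w \<bullet> w) + h\<^sup>2 * B" for h
  proof -
    define n where "n = m + h *\<^sub>R w"
    have "0 \<le> \<alpha> * (n \<bullet> n) - n \<bullet> symm3 x n"
      using le[of n] by simp
    also have "symm3 x n = symm3 x m + h *\<^sub>R symm3 x w"
      by (simp add: n_def linear_add[OF linear_symm3] linear_scale[OF linear_symm3])
    also have "\<alpha> * (n \<bullet> n) - n \<bullet> (symm3 x m + h *\<^sub>R symm3 x w)
        = (\<alpha> * (m \<bullet> m) - m \<bullet> symm3 x m) + 2 * h * (\<alpha> * (m \<bullet> w) - symm3 x m \<bullet> w) + h\<^sup>2 * B"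
      using symm3_inner[of x m w]
      by (simp add: n_def B_def inner_simps inner_commute algebra_simps power2_eq_square)
    also have "\<alpha> * (m \<bullet> w) - symm3 x m \<bullet> w = w \<bullet> w"
      by (simp add: w_def inner_simps inner_commute[of m "symm3 x m"] algebra_simps)
    finally show ?thesis using eq by simp
  qed
  have "w \<bullet> w = 0"
  proof (rule ccontr)
    assume "w \<bullet> w \<noteq> 0"
    then have pos: "0 < w \<bullet> w" by simp
    \<comment> \<open>With h = - (w . w) / k the quadratic term is at most half the size of the
      linear one; adding 1 keeps k positive when B = 0.\<close>
    define k where "k = \<bar>B\<bar> + 1"
    have "0 < k" by (simp add: k_def)
    define h where "h = - (w \<bullet> w) / k"
    have "h\<^sup>2 * B \<le> h\<^sup>2 * k"
      by (intro mult_left_mono) (auto simp: k_def)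
    also have "\<dots> = - h * (w \<bullet> w)"
      using \<open>0 < k\<close> by (simp add: h_def power2_eq_square)
    finally have "0 \<le> h * (w \<bullet> w)"
      using nonneg[of h] by simp
    moreover have "h < 0" using pos using \<open>0 < k\<close> by (simp add: h_def divide_neg_pos)
    ultimately show False
      using mult_neg_pos[OF _ pos, of h] by linarith
  qed
  then show ?thesis by (simp add: w_def)
qed

lemma symm3_max:
  obtains n \<alpha> where "norm n = 1" "symm3 x n = \<alpha> *\<^sub>R n" "\<And>m. m \<bullet> symm3 x m \<le> \<alpha> * (m \<bullet> m)"
proof -
  have "continuous_on (sphere 0 1) (\<lambda>n. n \<bullet> symm3 x n)"
    using linear_symm3 by (intro continuous_intros linear_continuous_on) (simp add:
      linear_conv_bounded_linear)
  then obtain n where n: "norm n = 1" and max: "\<And>m. norm m = 1 \<Longrightarrow> m \<bullet> symm3 x m \<le> n \<bullet> symm3 x n"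
    using continuous_attains_sup[of "sphere (0 :: real ^ 3) 1" "\<lambda>n. n \<bullet> symm3 x n"]
    by (auto simp: dist_norm)
  define \<alpha> where "\<alpha> = n \<bullet> symm3 x n"
  have le: "m \<bullet> symm3 x m \<le> \<alpha> * (m \<bullet> m)" for m
  proof (cases "m = 0")
    case False
    have "sgn m \<bullet> symm3 x (sgn m) \<le> \<alpha>"
      using False by (auto simp: \<alpha>_def norm_sgn intro: max)
    then show ?thesis
      using False by (simp add: sgn_div_norm linear_scale[OF linear_symm3] dot_square_norm field_simps
          power2_eq_square)
  qed auto
  have "symm3 x n = \<alpha> *\<^sub>R n"
    using n by (intro symm3_eigenvector le) (simp add: \<alpha>_def norm_eq_1)
  with n le that show ?thesis by blast
qed

lemma symm3_uminus: "symm3 (- x) n = - symm3 x n"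
  by (simp add: vec_eq_iff forall_3 symm3_def algebra_simps)

text \<open>Only the extreme eigenvectors are obtained by maximisation, for \<open>x\<close> and for
  \<open>- x\<close>. They are orthogonal because their eigenvalues differ: a traceless multiple of
  the identity would force x = 0. Their cross product is the third eigenvector, as its image is
  orthogonal to both.\<close>

lemma symm3_frame:
  assumes "x \<noteq> 0"
  obtains n1 n2 n3 \<alpha> \<beta> \<gamma> where
    "norm n1 = 1" "norm n2 = 1" "norm n3 = 1" "n1 \<bullet> n2 = 0" "n1 \<bullet> n3 = 0" "n2 \<bullet> n3 = 0"
    "symm3 x n1 = \<alpha> *\<^sub>R n1" "symm3 x n2 = \<beta> *\<^sub>R n2" "symm3 x n3 = \<gamma> *\<^sub>R n3"
    "\<beta> \<le> \<alpha>" "\<gamma> \<le> \<beta>"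
proof -
  obtain n1 \<alpha> where 1: "norm n1 = 1" "symm3 x n1 = \<alpha> *\<^sub>R n1" and le: "\<And>m. m \<bullet> symm3 x m \<le> \<alpha> * (m \<bullet> m)"
    using symm3_max[of x] by blast
  obtain n3 \<gamma>' where 3: "norm n3 = 1" "symm3 (- x) n3 = \<gamma>' *\<^sub>R n3"
    and ge': "\<And>m. m \<bullet> symm3 (- x) m \<le> \<gamma>' * (m \<bullet> m)"
    using symm3_max[of "- x"] by blast
  define \<gamma> where "\<gamma> = - \<gamma>'"
  have 3: "norm n3 = 1" "symm3 x n3 = \<gamma> *\<^sub>R n3"
    using 3 by (simp_all add: \<gamma>_def symm3_uminus neg_equal_iff_equal minus_equation_iff[of "symm3 x n3"])
  have ge: "m \<bullet> symm3 x m \<ge> \<gamma> * (m \<bullet> m)" for m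
    using ge'[of m] by (simp add: \<gamma>_def symm3_uminus)
  have "\<alpha> \<noteq> \<gamma>"
  proof
    assume "\<alpha> = \<gamma>"
    then have eq: "symm3 x m = \<alpha> *\<^sub>R m" for m
      using le ge by (intro symm3_eigenvector) (auto intro: antisym)
    have "symm3 x (axis 1 1) $ 1 = \<alpha>" "symm3 x (axis 2 1) $ 2 = \<alpha>" "symm3 x (axis 3 1) $ 3 = \<alpha>"
      "symm3 x (axis 1 1) $ 2 = 0" "symm3 x (axis 1 1) $ 3 = 0" "symm3 x (axis 2 1) $ 3 = 0"
      unfolding eq by (auto simp: axis_def)
    then have "x = 0"
      by (auto simp: symm3_def axis_def vec_eq_iff forall_5 s3_def)
    with assms show False by simp
  qed
  have "\<alpha> * (n1 \<bullet> n3) = \<gamma> * (n1 \<bullet> n3)"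
    using symm3_inner[of x n1 n3] by (simp add: 1 3)
  with \<open>\<alpha> \<noteq> \<gamma>\<close> have 13: "n1 \<bullet> n3 = 0" by simp
  define n2 where "n2 = cross3 n1 n3"
  have "norm n2 = 1"
    using 1 3 13 by (simp add: n2_def norm_eq_1 dot_cross inner_commute)
  moreover have "n1 \<bullet> n2 = 0" "n2 \<bullet> n3 = 0"
    by (simp_all add: n2_def dot_cross_self)
  moreover define \<beta> where "\<beta> = symm3 x n2 \<bullet> n2"
  have "symm3 x n2 \<bullet> n1 = 0" "symm3 x n2 \<bullet> n3 = 0"
    using calculation symm3_inner[of x n2 n1] symm3_inner[of x n2 n3] by (simp_all add: 1 3 inner_commute)
  then have "symm3 x n2 = \<beta> *\<^sub>R n2"
    using orthonormal_expand[of n1 n2 n3 "symm3 x n2"] calculation 1 3 13 by (simp add: \<beta>_def)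
  moreover have "\<beta> \<le> \<alpha>" "\<gamma> \<le> \<beta>"
    using le[of n2] ge[of n2] \<open>norm n2 = 1\<close> by (simp_all add: \<beta>_def norm_eq_1 inner_commute)
  ultimately show ?thesis
    using that 1 3 13 by blast
qed

text \<open>Paired with y, the Jordan product becomes the average of two compositions, each of which
  is scalar on eigenvectors. For orthogonal \<open>m\<close> and \<open>n\<close> the dyad is thus
  an eigenvector of \<open>mul x\<close>.\<close>

lemma mul_dyad:
  assumes "symm3 x m = a *\<^sub>R m" "symm3 x n = b *\<^sub>R n"
  shows "mul x (dyad m n) = ((a + b) / 2) *\<^sub>R dyad m n - (2 * (m \<bullet> n)) *\<^sub>R x"
proof -
  have "mul x (dyad m n) \<bullet> y = (((a + b) / 2) *\<^sub>R dyad m n - (2 * (m \<bullet> n)) *\<^sub>R x) \<bullet> y" for y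
  proof -
    have "mul x (dyad m n) \<bullet> y = m \<bullet> symm3 (mul x y) n"
      by (simp add: mul_inner dyad_inner)
    also have "\<dots> = (m \<bullet> symm3 x (symm3 y n) + m \<bullet> symm3 y (symm3 x n)) / 2 - 2 * (x \<bullet> y) * (m \<bullet> n)"
      by (simp add: symm3_mul inner_simps)
    also have "m \<bullet> symm3 x (symm3 y n) = a * (m \<bullet> symm3 y n)"
      by (metis assms(1) inner_scaleR_left symm3_inner)
    also have "m \<bullet> symm3 y (symm3 x n) = b * (m \<bullet> symm3 y n)"
      by (simp add: assms linear_scale[OF linear_symm3])
    finally show ?thesis
      by (simp add: inner_simps dyad_inner field_simps)
  qed
  then show ?thesis
    by (metis vector_eq_rdot)
qed

text \<open>After pairing with an arbitrary y, both claims compare a trace computed in the frame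
  with the trace in the standard basis. The factor 6 arises since \<open>symm3 y\<close> composed
  with \<open>symm3 x\<close> has trace 6 (x . y).\<close>

lemma frame_expand:
  assumes orth: "norm n1 = 1" "norm n2 = 1" "norm n3 = 1" "n1 \<bullet> n2 = 0" "n1 \<bullet> n3 = 0" "n2 \<bullet> n3 = 0"
    and eig: "symm3 x n1 = \<alpha> *\<^sub>R n1" "symm3 x n2 = \<beta> *\<^sub>R n2" "symm3 x n3 = \<gamma> *\<^sub>R n3"
  shows "6 *\<^sub>R x = \<alpha> *\<^sub>R dyad n1 n1 + \<beta> *\<^sub>R dyad n2 n2 + \<gamma> *\<^sub>R dyad n3 n3"
    and "dyad n1 n1 + dyad n2 n2 + dyad n3 n3 = 0"
proof -
  have tr: "n1 \<bullet> g n1 + n2 \<bullet> g n2 + n3 \<bullet> g n3 = (\<Sum>a\<in>UNIV. g (axis a 1) $ a)"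
    if "linear g" for g :: "real ^ 3 \<Rightarrow> real ^ 3"
  proof -
    have g: "g n $ a = matrix g $ a $ 1 * n$1 + matrix g $ a $ 2 * n$2 + matrix g $ a $ 3 * n$3" for n a
      using matrix_works[OF linear_matrix_vector_mul_eq[THEN iffD2, OF that], of n, symmetric]
      by (simp add: matrix_vector_mult_def sum_3)
    define G where "G = matrix g"
    have "n1 \<bullet> g n1 + n2 \<bullet> g n2 + n3 \<bullet> g n3 =
        (\<Sum>a\<in>UNIV. \<Sum>b\<in>UNIV. G $ a $ b * (n1$a * n1$b + n2$a * n2$b + n3$a * n3$b))"
      unfolding inner_3 g sum_3 G_def[symmetric] by (simp only: algebra_simps)
    also have "\<dots> = (\<Sum>a\<in>UNIV. G $ a $ a)"
      unfolding orthonormal_columns[OF orth] by (simp add: sum_3)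
    finally show ?thesis
      by (simp add: matrix_def G_def)
  qed
  have "(\<alpha> *\<^sub>R dyad n1 n1 + \<beta> *\<^sub>R dyad n2 n2 + \<gamma> *\<^sub>R dyad n3 n3) \<bullet> y = (6 *\<^sub>R x) \<bullet> y" for y
  proof -
    have "(\<alpha> *\<^sub>R dyad n1 n1 + \<beta> *\<^sub>R dyad n2 n2 + \<gamma> *\<^sub>R dyad n3 n3) \<bullet> y
        = n1 \<bullet> symm3 y (symm3 x n1) + n2 \<bullet> symm3 y (symm3 x n2) + n3 \<bullet> symm3 y (symm3 x n3)"
      by (simp add: inner_simps dyad_inner eig linear_scale[OF linear_symm3])
    also have "\<dots> = (\<Sum>a\<in>UNIV. symm3 y (symm3 x (axis a 1)) $ a)"
      using tr[of "symm3 y \<circ> symm3 x"] by (simp add: linear_compose linear_symm3)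
    also have "\<dots> = 6 * (x \<bullet> y)"
      by (simp add: sum_3 symm3_def inner_5 axis_def field_simps)
    finally show ?thesis by simp
  qed
  then show "6 *\<^sub>R x = \<alpha> *\<^sub>R dyad n1 n1 + \<beta> *\<^sub>R dyad n2 n2 + \<gamma> *\<^sub>R dyad n3 n3"
    by (metis vector_eq_rdot)
  have "(dyad n1 n1 + dyad n2 n2 + dyad n3 n3) \<bullet> y = 0 \<bullet> y" for y
    using tr[OF linear_symm3[of y]] by (simp add: inner_simps dyad_inner sum_3 symm3_def axis_def)
  then show "dyad n1 n1 + dyad n2 n2 + dyad n3 n3 = 0"
    by (metis vector_eq_rdot)
qed

text \<open>The expansions are paired with \<open>x\<close> and with \<open>mul x x\<close>. For the
  last claim, a vanishing sum makes the sum of cubes equal to 3 \<alpha> \<beta> \<gamma>.\<close>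

lemma frame_invariants:
  assumes orth: "norm n1 = 1" "norm n2 = 1" "norm n3 = 1" "n1 \<bullet> n2 = 0" "n1 \<bullet> n3 = 0" "n2 \<bullet> n3 = 0"
    and eig: "symm3 x n1 = \<alpha> *\<^sub>R n1" "symm3 x n2 = \<beta> *\<^sub>R n2" "symm3 x n3 = \<gamma> *\<^sub>R n3"
  shows "\<alpha> + \<beta> + \<gamma> = 0" and "\<alpha>\<^sup>2 + \<beta>\<^sup>2 + \<gamma>\<^sup>2 = 6 * (x \<bullet> x)" and "\<alpha> * \<beta> * \<gamma> = 2 * cubic x"
proof -
  note expand = frame_expand[OF orth eig]
  have dot: "dyad n1 n1 \<bullet> x = \<alpha>" "dyad n2 n2 \<bullet> x = \<beta>" "dyad n3 n3 \<bullet> x = \<gamma>"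
    using orth by (simp_all add: dyad_inner eig norm_eq_1)
  show sum0: "\<alpha> + \<beta> + \<gamma> = 0"
    using arg_cong[OF expand(2), of "\<lambda>v. v \<bullet> x"] by (simp add: inner_simps dot)
  show sq: "\<alpha>\<^sup>2 + \<beta>\<^sup>2 + \<gamma>\<^sup>2 = 6 * (x \<bullet> x)"
    using arg_cong[OF expand(1), of "\<lambda>v. v \<bullet> x"] by (simp add: inner_simps dot power2_eq_square)
  have dot2: "dyad n1 n1 \<bullet> mul x x = \<alpha>\<^sup>2 - 2 * (x \<bullet> x)" "dyad n2 n2 \<bullet> mul x x = \<beta>\<^sup>2 - 2 * (x \<bullet> x)"
    "dyad n3 n3 \<bullet> mul x x = \<gamma>\<^sup>2 - 2 * (x \<bullet> x)"
    using orth by (simp_all add: dyad_inner symm3_mul eig linear_scale[OF linear_symm3] inner_diff_right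
        norm_eq_1 power2_eq_square flip: scaleR_add_left)
  have "6 * cubic x = \<alpha> ^ 3 + \<beta> ^ 3 + \<gamma> ^ 3 - 2 * (x \<bullet> x) * (\<alpha> + \<beta> + \<gamma>)"
    using arg_cong[OF expand(1), of "\<lambda>v. v \<bullet> mul x x"]
    by (simp add: inner_simps dot2 cubic_mul power2_eq_square power3_eq_cube algebra_simps)
  moreover have "\<gamma> = - \<alpha> - \<beta>" using sum0 by simp
  ultimately show "\<alpha> * \<beta> * \<gamma> = 2 * cubic x"
    by algebra
qed

subsection \<open>Quadratic forms\<close>

abbreviation form :: "real ^ 'n ^ 'n \<Rightarrow> real ^ 'n \<Rightarrow> real" where
  "form M e \<equiv> e \<bullet> (M *v e)"

definition form_le :: "real ^ 'n ^ 'n \<Rightarrow> real \<Rightarrow> bool" where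
  "form_le M c \<longleftrightarrow> (\<forall>e. form M e \<le> c * (e \<bullet> e))"

definition outer :: "real ^ 'n \<Rightarrow> real ^ 'n \<Rightarrow> real ^ 'n ^ 'n" where
  "outer u v = (\<chi> i j. u $ i * v $ j)"

lemma outer_mult_vec: "outer u v *v e = (v \<bullet> e) *\<^sub>R u"
  by (simp add: outer_def vec_eq_iff matrix_vector_mult_def inner_vec_def sum_distrib_left
      sum_distrib_right mult_ac)

lemma trace_outer: "trace (outer u v) = u \<bullet> v"
  by (simp add: trace_def outer_def inner_vec_def)

lemma trace_mult_outer: "trace (A ** outer u v) = v \<bullet> (A *v u)"
  by (simp add: trace_def outer_def matrix_matrix_mult_def inner_vec_def matrix_vector_mult_def
      sum_distrib_left sum_distrib_right mult_ac)

lemma trace_scaleR: "trace (c *\<^sub>R A) = c * trace (A :: real ^ 'n ^ 'n)"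
  by (simp add: trace_def sum_distrib_left)

lemma matrix_add_mult: "(A + B) ** C = A ** C + B ** (C :: real ^ 'n ^ 'n)"
  by (simp add: matrix_matrix_mult_def vec_eq_iff sum.distrib algebra_simps)

lemma matrix_diff_mult: "(A - B) ** C = A ** C - B ** (C :: real ^ 'n ^ 'n)"
  by (simp add: matrix_matrix_mult_def vec_eq_iff sum_subtractf algebra_simps)

lemma matrix_mult_diff: "C ** (A - B) = C ** A - C ** (B :: real ^ 'n ^ 'n)"
  by (simp add: matrix_matrix_mult_def vec_eq_iff sum_subtractf algebra_simps)

lemma matrix_mult_scaleR: "(c *\<^sub>R A) ** B = c *\<^sub>R (A ** (B :: real ^ 'n ^ 'n))"
  "A ** (c *\<^sub>R B) = c *\<^sub>R (A ** B)"
  by (simp_all add: matrix_matrix_mult_def vec_eq_iff sum_distrib_left mult_ac)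

lemma form_axis: "form M (axis i 1) = M $ i $ i"
  by (simp add: inner_axis' matrix_vector_mult_basis column_def)

lemma form_symmetric:
  fixes Q :: "real ^ 'n ^ 'n"
  assumes "transpose Q = Q"
  shows "u \<bullet> (Q *v v) = v \<bullet> (Q *v u)"
proof -
  have "u \<bullet> (Q *v v) = (transpose Q *v u) \<bullet> v"
    unfolding transpose_matrix_vector by (simp add: dot_lmul_matrix)
  then show ?thesis
    by (simp add: assms inner_commute)
qed

text \<open>With a zero diagonal entry at i the form along
  \<open>axis j 1 + h *\<^sub>R axis i 1\<close> is affine in h, so nonnegativity forces slope zero;
  the h chosen below would give the value -1.\<close>

lemma psd_diagonal_zero:
  fixes Q :: "real ^ 'n ^ 'n"
  assumes sym: "transpose Q = Q" and psd: "\<And>e. 0 \<le> form Q e" and "Q $ i $ i = 0"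
  shows "Q $ j $ i = 0"
proof (rule ccontr)
  define b where "b = Q $ j $ i"
  assume "Q $ j $ i \<noteq> 0"
  then have "b \<noteq> 0" by (simp add: b_def)
  define h where "h = - (Q $ j $ j + 1) / (2 * b)"
  have ij: "axis j 1 \<bullet> (Q *v axis i 1) = b"
    by (simp add: b_def inner_axis' matrix_vector_mult_basis column_def)
  have "form Q (axis j 1 + h *\<^sub>R axis i 1) = Q $ j $ j + 2 * h * b + h\<^sup>2 * (Q $ i $ i)"
    using form_symmetric[OF sym, of "axis j 1" "axis i 1"]
    by (simp add: matrix_vector_right_distrib matrix_vector_mult_scaleR inner_simps form_axis ij
        power2_eq_square algebra_simps)
  also have "\<dots> = - 1"
    using \<open>b \<noteq> 0\<close> assms(3) by (simp add: h_def field_simps)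
  finally show False
    using psd[of "axis j 1 + h *\<^sub>R axis i 1"] by simp
qed

(* Induction on the number of nonzero diagonal entries of Q, one of which is removed by passing to a
   Schur complement; this avoids the spectral theorem. *)
lemma trace_mult_psd_nonneg:
  fixes A Q :: "real ^ 'n ^ 'n"
  assumes A: "\<And>e. 0 \<le> form A e"
  shows "transpose Q = Q \<Longrightarrow> (\<And>e. 0 \<le> form Q e) \<Longrightarrow> 0 \<le> trace (A ** Q)"
proof (induction "card {i. Q $ i $ i \<noteq> 0}" arbitrary: Q rule: less_induct)
  case less
  note sym = less.prems(1) and psd = less.prems(2)
  show ?case
  proof (cases "\<exists>i. Q $ i $ i \<noteq> 0")
    case False
    then have "Q = 0"
      using psd_diagonal_zero[OF sym psd] by (simp add: vec_eq_iff)
    then show ?thesis by (simp add: trace_def)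
  next
    case True
    then obtain i where "Q $ i $ i \<noteq> 0" by blast
    moreover have "0 \<le> Q $ i $ i"
      using psd[of "axis i 1"] by (simp add: form_axis)
    ultimately have pos: "0 < Q $ i $ i" by simp
    define v where "v = Q *v axis i 1"
    define Q' where "Q' = Q - (1 / Q $ i $ i) *\<^sub>R outer v v"
    have v: "v $ j = Q $ j $ i" for j
      by (simp add: v_def matrix_vector_mult_basis column_def)
    have ve: "e \<bullet> (Q *v axis i 1) = v \<bullet> e" "axis i 1 \<bullet> (Q *v e) = v \<bullet> e" for e
      using form_symmetric[OF sym, of e "axis i 1"] by (simp_all add: v_def inner_commute)
    have sym': "transpose Q' = Q'"
      using sym by (simp add: Q'_def transpose_def outer_def vec_eq_iff)
    have form': "form Q' e = form Q e - (v \<bullet> e)\<^sup>2 / Q $ i $ i" for e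
      by (simp add: Q'_def matrix_vector_mult_diff_rdistrib scaleR_matrix_vector_assoc[symmetric]
          outer_mult_vec inner_simps power2_eq_square inner_commute)
    have psd': "0 \<le> form Q' e" for e
    proof -
      have va: "v \<bullet> axis i 1 = Q $ i $ i"
        by (simp add: inner_axis v)
      \<comment> \<open>This c minimises the form of \<open>Q\<close> on the line from e in
        direction \<open>axis i 1\<close>, and the minimum is the form of the Schur complement at
        e.\<close>
      define c where "c = v \<bullet> e / Q $ i $ i"
      have c: "c * Q $ i $ i = v \<bullet> e"
        using pos by (simp add: c_def)
      have "0 \<le> form Q (e - c *\<^sub>R axis i 1)"
        by (rule psd)
      also have "\<dots> = form Q e - 2 * c * (v \<bullet> e) + c * (c * Q $ i $ i)"
        by (simp add: matrix_vector_mult_diff_distrib matrix_vector_mult_scaleR inner_diff_left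
          inner_diff_right
            ve va right_diff_distrib left_diff_distrib)
      also have "\<dots> = form Q' e"
        unfolding c form' by (simp add: c_def power2_eq_square del: mult_eq_0_iff)
      finally show ?thesis .
    qed
    have "{j. Q' $ j $ j \<noteq> 0} \<subset> {j. Q $ j $ j \<noteq> 0}"
    proof
      show "{j. Q' $ j $ j \<noteq> 0} \<subseteq> {j. Q $ j $ j \<noteq> 0}"
      proof safe
        fix j assume *: "Q' $ j $ j \<noteq> 0" "Q $ j $ j = 0"
        then have "Q $ i $ j = 0" using psd_diagonal_zero[OF sym psd] by blast
        moreover have "Q $ j $ i = Q $ i $ j"
          by (subst (2) sym[symmetric]) (simp add: transpose_def)
        ultimately show False
          using * by (simp add: Q'_def outer_def v)
      qed
      show "{j. Q' $ j $ j \<noteq> 0} \<noteq> {j. Q $ j $ j \<noteq> 0}"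
        using pos by (auto simp: Q'_def outer_def v set_eq_iff intro!: exI[of _ i])
    qed
    then have "card {j. Q' $ j $ j \<noteq> 0} < card {j. Q $ j $ j \<noteq> 0}"
      by (intro psubset_card_mono) auto
    then have "0 \<le> trace (A ** Q')"
      by (rule less.hyps[OF _ sym' psd'])
    also have "trace (A ** Q') = trace (A ** Q) - form A v / Q $ i $ i"
      by (simp add: Q'_def matrix_mult_diff trace_sub matrix_mult_scaleR trace_scaleR trace_mult_outer)
    finally show ?thesis
      using A[of v] pos by (smt (verit) divide_nonneg_pos)
  qed
qed

lemma form_mat_1: "form (c *\<^sub>R mat 1) e = c * (e \<bullet> e)"
  by (simp flip: scaleR_matrix_vector_assoc)

lemma form_add: "form (A + B) e = form A e + form B e"
  by (simp add: matrix_vector_mult_add_rdistrib inner_simps)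

lemma form_diff: "form (A - B) e = form A e - form B e"
  by (simp add: matrix_vector_mult_diff_rdistrib inner_simps)

lemma form_scaleR: "form (c *\<^sub>R A) e = c * form A e"
  by (simp flip: scaleR_matrix_vector_assoc)

lemma form_outer: "form (outer u v) e = (u \<bullet> e) * (v \<bullet> e)"
  by (simp add: outer_mult_vec inner_commute)

lemma trace_mult_le:
  fixes M Q :: "real ^ 'n ^ 'n"
  assumes "form_le M c" "transpose Q = Q" "\<And>e. 0 \<le> form Q e"
  shows "trace (M ** Q) \<le> c * trace Q"
proof -
  have "0 \<le> trace ((c *\<^sub>R mat 1 - M) ** Q)"
    using assms by (intro trace_mult_psd_nonneg) (auto simp: form_le_def form_diff form_mat_1)
  also have "(c *\<^sub>R mat 1 - M) ** Q = c *\<^sub>R Q - M ** Q"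
    by (simp add: matrix_diff_mult matrix_mult_scaleR)
  finally show ?thesis
    by (simp add: trace_sub trace_scaleR)
qed

subsection \<open>Hessian differences of the model solutions\<close>

definition L :: "real ^ 5 \<Rightarrow> real ^ 5 ^ 5" where "L x = matrix (mul x)"

lemma L_mult_vec: "L x *v e = mul x e"
  using bilinear_mul by (simp add: L_def matrix_works linear_matrix_vector_mul_eq bilinear_def)

lemma L_nth: "L x $ i $ j = mul x (axis j 1) $ i"
  by (simp add: L_def matrix_def)

lemma trace_L: "trace (L x) = 0"
  by (simp add: trace_def sum_5 L_nth mul_def axis_def)

lemma trace_L_L: "trace (L x ** L y) = 7 / 2 * (x \<bullet> y)"
  by (simp add: trace_def matrix_matrix_mult_def sum_5 L_nth mul_def axis_def inner_5 field_simps)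

lemma transpose_L: "transpose (L x) = L x"
  by (simp add: vec_eq_iff forall_5 transpose_def L_nth mul_def axis_def)

(* For a0 = g(|y|^2), a1 = g'(|y|^2), a2 = g''(|y|^2) this is the Hessian of y \<mapsto> cubic y * g(|y|^2). *)
definition radial_hessian :: "real \<Rightarrow> real \<Rightarrow> real \<Rightarrow> real ^ 5 \<Rightarrow> real ^ 5 ^ 5" where
  "radial_hessian a0 a1 a2 y =
     (6 * a0) *\<^sub>R L y + (6 * a1) *\<^sub>R (outer y (mul y y) + outer (mul y y) y)
     + (2 * a1 * cubic y) *\<^sub>R mat 1 + (4 * a2 * cubic y) *\<^sub>R outer y y"

(* The Hessian of cubic x / |x|, extended by 0 to the origin. *)
definition W :: "real ^ 5 \<Rightarrow> real ^ 5 ^ 5" where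
  "W x = radial_hessian 1 (- 1 / 2) (3 / 4) (sgn x)"

text \<open>As \<open>6 *\<^sub>R L x\<close> is the Hessian of \<open>cubic\<close>, this is the
  Hessian of \<open>cubic x + t * cubic x / norm x\<close>.\<close>

definition H :: "real \<Rightarrow> real ^ 5 \<Rightarrow> real ^ 5 ^ 5" where
  "H t x = 6 *\<^sub>R L x + t *\<^sub>R W x"

lemma trace_radial_hessian:
  "trace (radial_hessian a0 a1 a2 y) = (22 * a1 + 4 * a2 * (y \<bullet> y)) * cubic y"
  by (simp add: radial_hessian_def trace_add trace_scaleR trace_outer trace_L trace_I cubic_mul
      inner_commute[of "mul y y"] algebra_simps)

lemma trace_mult_scaleR: "trace ((c *\<^sub>R A) ** B) = c * trace (A ** (B :: real ^ 'n ^ 'n))"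
  by (simp add: trace_scaleR matrix_mult_scaleR)

lemma trace_outer_L: "trace (outer u v ** L \<phi>) = mul \<phi> u \<bullet> v"
  by (simp add: trace_mul_sym[of _ "L \<phi>"] trace_mult_outer L_mult_vec inner_commute)

lemma trace_radial_hessian_L:
  "trace (radial_hessian a0 a1 a2 y ** L \<phi>) =
     21 * a0 * (y \<bullet> \<phi>) + 12 * a1 * (y \<bullet> y) * (y \<bullet> \<phi>) + 4 * a2 * cubic y * (mul y y \<bullet> \<phi>)"
proof -
  have 1: "mul \<phi> y \<bullet> mul y y = (y \<bullet> y) * (y \<bullet> \<phi>)"
    by (metis inner_commute inner_scaleR_left mul_commute mul_inner mul_self)
  have 2: "mul \<phi> (mul y y) \<bullet> y = (y \<bullet> y) * (y \<bullet> \<phi>)"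
    by (metis 1 inner_commute mul_inner)
  have 3: "mul \<phi> y \<bullet> y = mul y y \<bullet> \<phi>"
    by (metis inner_commute mul_commute mul_inner)
  show ?thesis
    by (simp add: radial_hessian_def matrix_add_mult trace_add trace_mult_scaleR trace_outer_L
        trace_L_L trace_L 1 2 3 algebra_simps)
qed

lemma form_radial_hessian:
  "form (radial_hessian a0 a1 a2 y) e =
     6 * a0 * (mul y e \<bullet> e) + 12 * a1 * (y \<bullet> e) * (mul y y \<bullet> e) + 2 * a1 * cubic y * (e \<bullet> e)
     + 4 * a2 * cubic y * (y \<bullet> e)\<^sup>2"
  by (simp add: radial_hessian_def form_add form_scaleR form_outer form_mat_1 L_mult_vec
      inner_commute[of e y] inner_commute[of e "mul y y"] inner_commute[of e "mul y e"]
      power2_eq_square algebra_simps)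

lemma radial_hessian_scaleR:
  "radial_hessian a0 a1 a2 (c *\<^sub>R y) = radial_hessian (a0 * c) (a1 * c ^ 3) (a2 * c ^ 5) y"
proof -
  have "L (c *\<^sub>R y) = c *\<^sub>R L y" "outer (a *\<^sub>R u) (b *\<^sub>R v) = (a * b) *\<^sub>R outer u v"
    for a b and u v :: "real ^ 5"
    by (simp_all add: vec_eq_iff L_nth mul_algebra outer_def)
  then show ?thesis
    by (simp add: radial_hessian_def cubic_def mul_algebra power_numeral_reduce algebra_simps)
qed

text \<open>The test matrix \<open>Q\<close> is positive semidefinite because
  \<open>mul_form_le\<close> bounds the form of \<open>L \<phi>\<close> by |\<phi>|, and its trace
  is 5 |\<phi>| because \<open>L \<phi>\<close> is traceless.\<close>

lemma form_le_test:
  assumes "form_le M c"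
  shows "trace (M ** L \<phi>) + norm \<phi> * trace M \<le> 5 * norm \<phi> * c"
proof -
  define Q where "Q = L \<phi> + norm \<phi> *\<^sub>R mat 1"
  have "transpose Q = Q"
    using transpose_L[of \<phi>] by (simp add: Q_def transpose_def vec_eq_iff mat_def)
  moreover have "0 \<le> form Q e" for e
    using mul_form_le[of \<phi> e]
    by (simp add: Q_def form_add form_mat_1 L_mult_vec inner_commute[of e "mul \<phi> e"] power2_norm_eq_inner)
  ultimately have "trace (M ** Q) \<le> c * trace Q"
    using assms by (intro trace_mult_le) auto
  then show ?thesis
    by (simp add: Q_def matrix_add_ldistrib matrix_mult_scaleR trace_add trace_scaleR trace_L trace_I
      algebra_simps)
qed

lemma trace_H: "trace (H t x) = - 8 * t * cubic (sgn x)"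
  by (cases "x = 0")
    (simp_all add: H_def trace_add trace_scaleR trace_L W_def trace_radial_hessian cubic_def mul_algebra
      dot_square_norm norm_sgn)

lemma trace_H_L:
  "trace (H t x ** L \<phi>) =
     21 * (x \<bullet> \<phi>) + t * (15 * (sgn x \<bullet> \<phi>) + 3 * cubic (sgn x) * (mul (sgn x) (sgn x) \<bullet> \<phi>))"
  by (cases "x = 0")
    (simp_all add: H_def matrix_add_mult matrix_mult_scaleR trace_add trace_scaleR trace_L_L W_def
      trace_radial_hessian_L
      cubic_def mul_algebra dot_square_norm norm_sgn algebra_simps)

lemma H_minus: "H t (- x) = - H t x"
proof -
  have "L (- x) = - L x" for x
    by (simp add: vec_eq_iff L_nth mul_algebra)
  moreover have "radial_hessian a b c (- x) = - radial_hessian a b c x" for a b c x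
    using radial_hessian_scaleR[of a b c "- 1" x]
    by (simp add: radial_hessian_def)
  ultimately show ?thesis
    by (simp add: H_def W_def sgn_minus)
qed

lemma form_H:
  assumes "x \<noteq> 0"
  shows "form (H t x) e = 6 * (norm x + t) * (mul (sgn x) e \<bullet> e)
    + t * (3 * cubic (sgn x) * (sgn x \<bullet> e)\<^sup>2 - 6 * (sgn x \<bullet> e) * (mul (sgn x) (sgn x) \<bullet> e)
           - cubic (sgn x) * (e \<bullet> e))"
proof -
  have "x = norm x *\<^sub>R sgn x"
    using assms by (simp add: sgn_div_norm)
  then have "mul x e \<bullet> e = norm x * (mul (sgn x) e \<bullet> e)"
    by (metis inner_scaleR_left mul_algebra(5))
  then show ?thesis
    by (simp add: H_def W_def form_add form_scaleR L_mult_vec form_radial_hessian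
        inner_commute[of e "mul x e"] algebra_simps)
qed

text \<open>A three-dimensional space on which the form is at least \<mu> is the min-max certificate
  for the third eigenvalue in dimension five. Two such spaces always meet
  (\<open>subspaces_meet\<close>), so eigenvalues of the 5x5 matrices never have to be
  defined.\<close>

lemma span3_form_ge:
  fixes M :: "real ^ 'n ^ 'n"
  assumes orth: "u \<bullet> v = 0" "u \<bullet> w = 0" "v \<bullet> w = 0" and nz: "u \<noteq> 0" "v \<noteq> 0" "w \<noteq> 0"
    and ge: "\<And>a b c. form M (a *\<^sub>R u + b *\<^sub>R v + c *\<^sub>R w) \<ge> \<mu> * (a\<^sup>2 * (u \<bullet> u) + b\<^sup>2 * (v \<bullet> v)
      + c\<^sup>2 * (w \<bullet> w))"
  obtains S where "subspace S" "dim S = 3" "\<And>e. e \<in> S \<Longrightarrow> form M e \<ge> \<mu> * (e \<bullet> e)"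
proof
  have "u \<noteq> v" "u \<noteq> w" "v \<noteq> w"
    using orth nz by auto
  moreover have "independent {u, v, w}"
    using orth nz by (intro pairwise_orthogonal_independent) (auto simp: pairwise_def orthogonal_def
      inner_commute)
  ultimately show "dim (span {u, v, w}) = 3"
    by (simp add: dim_eq_card_independent)
  fix e assume "e \<in> span {u, v, w}"
  then obtain a b c where e: "e = a *\<^sub>R u + b *\<^sub>R v + c *\<^sub>R w"
    by (auto simp: span_breakdown_eq algebra_simps eq_diff_eq diff_eq_eq)
  have "e \<bullet> e = a\<^sup>2 * (u \<bullet> u) + b\<^sup>2 * (v \<bullet> v) + c\<^sup>2 * (w \<bullet> w)"
    using orth by (simp add: e inner_simps inner_commute power2_eq_square)
  then show "form M e \<ge> \<mu> * (e \<bullet> e)"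
    using ge[of a b c] by (simp add: e)
qed auto

lemma cubic_minus: "cubic (- x) = - cubic x"
  by (simp add: cubic_def mul_algebra)

lemma inner_sgn_self: "x \<noteq> 0 \<Longrightarrow> sgn x \<bullet> sgn x = (1 :: real)"
  for x :: "'a :: real_inner"
  by (simp add: dot_square_norm norm_sgn)

(* The middle eigenvalue of H t x is - 3 (|x| + t) \<beta> - t p, where p = cubic (x / |x|) and \<beta> is
   the middle root of \<beta>^3 - 3 \<beta> = 2 p, i.e. the middle eigenvalue of the 3x3 matrix of x / |x|. *)
lemma middle_eigenvalue:
  assumes x: "x \<noteq> 0" and t: "0 \<le> t"
  obtains \<beta> S where "\<beta> ^ 3 - 3 * \<beta> = 2 * cubic (sgn x)" "\<bar>\<beta>\<bar> \<le> 1" "subspace S" "dim S = 3"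
    "\<And>e. e \<in> S \<Longrightarrow> form (H t x) e \<ge> (- 3 * (norm x + t) * \<beta> - t * cubic (sgn x)) * (e \<bullet> e)"
proof -
  define \<theta> where "\<theta> = sgn x"
  define p where "p = cubic \<theta>"
  have unit: "\<theta> \<bullet> \<theta> = 1" using x by (simp add: \<theta>_def inner_sgn_self)
  have "\<theta> \<noteq> 0" using x by (simp add: \<theta>_def sgn_zero_iff)
  then obtain n1 n2 n3 \<alpha> \<beta> \<gamma> where
    orth: "norm n1 = 1" "norm n2 = 1" "norm n3 = 1" "n1 \<bullet> n2 = 0" "n1 \<bullet> n3 = 0" "n2 \<bullet> n3 = 0"
    and eig: "symm3 \<theta> n1 = \<alpha> *\<^sub>R n1" "symm3 \<theta> n2 = \<beta> *\<^sub>R n2" "symm3 \<theta> n3 = \<gamma> *\<^sub>R n3"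
    and le: "\<beta> \<le> \<alpha>" "\<gamma> \<le> \<beta>"
    by (rule symm3_frame)
  note inv = frame_invariants[OF orth eig]
  have ag: "\<alpha> * \<gamma> = \<beta>\<^sup>2 - 3"
    using inv(1,2) unit by algebra
  have cub: "\<beta> ^ 3 - 3 * \<beta> = 2 * p"
    using ag inv(3) unfolding p_def by algebra
  have "0 \<le> (\<alpha> - \<beta>) * (\<beta> - \<gamma>)"
    using le by (intro mult_nonneg_nonneg) auto
  also have "\<dots> = 3 - 3 * \<beta>\<^sup>2"
    using ag inv(1) by algebra
  finally have b1: "\<bar>\<beta>\<bar> \<le> 1"
    by (simp add: abs_square_le_1)
  define R where "R = norm x + t"
  have R: "t \<le> R" by (simp add: R_def)
  \<comment> \<open>These are eigenvectors of \<open>mul \<theta>\<close> orthogonal to \<theta>. On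
    u the normalised form takes the claimed value exactly, on v a value at least as large because
    \<gamma> \<le> \<beta>. Only the third direction depends on the sign of \<beta>.\<close>
  define u v where "u = dyad n1 n3" and "v = dyad n1 n2"
  have nn: "n1 \<bullet> n1 = 1" "n2 \<bullet> n2 = 1" "n3 \<bullet> n3 = 1" "n2 \<bullet> n1 = 0" "n3 \<bullet> n1 = 0" "n3 \<bullet> n2 = 0"
    using orth by (simp_all add: norm_eq_1 inner_commute)
  have uv: "u \<bullet> u = 3" "v \<bullet> v = 3" "u \<bullet> v = 0" "v \<bullet> u = 0"
    using orth by (simp_all add: u_def v_def dyad_inner_dyad nn)
  have mu: "mul \<theta> u = (- \<beta> / 2) *\<^sub>R u" "mul \<theta> v = (- \<gamma> / 2) *\<^sub>R v"
    using mul_dyad[OF eig(1) eig(3)] mul_dyad[OF eig(1) eig(2)] orth inv(1)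
    by (simp_all add: u_def v_def eq_neg_iff_add_eq_0 add_divide_distrib[symmetric] flip: scaleR_add_left)
  have \<theta>uv: "\<theta> \<bullet> u = 0" "\<theta> \<bullet> v = 0"
    using orth by (simp_all add: u_def v_def inner_commute[of \<theta>] dyad_inner eig)
  then have uv\<theta>: "u \<bullet> \<theta> = 0" "v \<bullet> \<theta> = 0"
    by (simp_all add: inner_commute)
  have \<theta>2uv: "mul \<theta> \<theta> \<bullet> u = 0" "mul \<theta> \<theta> \<bullet> v = 0"
    by (simp_all add: mul_inner mu \<theta>uv)
  have nz: "u \<noteq> 0" "v \<noteq> 0" using uv by auto
  have form: "form (H t x) e = 6 * R * (mul \<theta> e \<bullet> e) + t * (3 * p * (\<theta> \<bullet> e)\<^sup>2 - 6 * (\<theta> \<bullet> e) * (mul \<theta> \<theta> \<bullet>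
    e) - p * (e \<bullet> e))" for e
    using form_H[OF x, where t=t and e=e] by (simp add: R_def \<theta>_def p_def)
  have "\<exists>S. subspace S \<and> dim S = 3 \<and> (\<forall>e\<in>S. form (H t x) e \<ge> (- 3 * R * \<beta> - t * p) * (e \<bullet> e))"
  proof (cases "0 \<le> \<beta>")
    case True
    \<comment> \<open>The diagonal direction orthogonal to \<theta>: its coefficients form the cross
      product of (\<alpha>, \<beta>, \<gamma>) and (1, 1, 1). Its normalised value is - 6 R p - t p,
      which is large enough since \<beta> - 2 p = \<beta> (4 - \<beta>^2) \<ge> 0.\<close>
    define w where "w = (\<beta> - \<gamma>) *\<^sub>R dyad n1 n1 + (\<gamma> - \<alpha>) *\<^sub>R dyad n2 n2 + (\<alpha> - \<beta>) *\<^sub>R dyad n3 n3"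
    have dd: "dyad n1 n1 \<bullet> dyad n1 n1 = 4" "dyad n2 n2 \<bullet> dyad n2 n2 = 4" "dyad n3 n3 \<bullet> dyad n3 n3 = 4"
      "dyad n1 n1 \<bullet> dyad n2 n2 = -2" "dyad n1 n1 \<bullet> dyad n3 n3 = -2" "dyad n2 n2 \<bullet> dyad n3 n3 = -2"
      "dyad n2 n2 \<bullet> dyad n1 n1 = -2" "dyad n3 n3 \<bullet> dyad n1 n1 = -2" "dyad n3 n3 \<bullet> dyad n2 n2 = -2"
      using orth by (simp_all add: dyad_inner_dyad nn)
    have uvw: "u \<bullet> w = 0" "v \<bullet> w = 0"
      using orth by (simp_all add: u_def v_def w_def inner_simps dyad_inner_dyad nn)
    then have wuv: "w \<bullet> u = 0" "w \<bullet> v = 0"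
      by (simp_all add: inner_commute)
    have \<theta>w: "\<theta> \<bullet> w = 0"
      using nn by (simp add: w_def inner_simps inner_commute[of \<theta>] dyad_inner eig algebra_simps)
    have mw: "mul \<theta> w = ((\<beta> - \<gamma>) * \<alpha>) *\<^sub>R dyad n1 n1 + ((\<gamma> - \<alpha>) * \<beta>) *\<^sub>R dyad n2 n2
      + ((\<alpha> - \<beta>) * \<gamma>) *\<^sub>R dyad n3 n3"
      by (simp add: w_def mul_algebra mul_dyad[OF eig(1) eig(1)] mul_dyad[OF eig(2) eig(2)]
          mul_dyad[OF eig(3) eig(3)] nn algebra_simps)
    have ww: "w \<bullet> w = 108"
    proof -
      have "w \<bullet> w = 6 * ((\<beta> - \<gamma>)\<^sup>2 + (\<gamma> - \<alpha>)\<^sup>2 + (\<alpha> - \<beta>)\<^sup>2)"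
        by (simp add: w_def inner_add_left inner_add_right dd power2_eq_square) (simp add: algebra_simps)
      also have "\<dots> = 18 * (\<alpha>\<^sup>2 + \<beta>\<^sup>2 + \<gamma>\<^sup>2) - 6 * (\<alpha> + \<beta> + \<gamma>)\<^sup>2"
        by (simp add: power2_eq_square algebra_simps)
      finally have "w \<bullet> w = 18 * (\<theta> \<bullet> \<theta>) * 6 - 0"
        by (simp add: inv)
      then show ?thesis by (simp add: unit)
    qed
    have mww: "mul \<theta> w \<bullet> w = - 108 * p"
    proof -
      have "mul \<theta> w \<bullet> w = 6 * ((\<beta> - \<gamma>)\<^sup>2 * \<alpha> + (\<gamma> - \<alpha>)\<^sup>2 * \<beta> + (\<alpha> - \<beta>)\<^sup>2 * \<gamma>)"
        unfolding mw by (simp add: w_def inner_add_left inner_add_right dd power2_eq_square) (simp add: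
          algebra_simps)
      also have "\<dots> = - 108 * p"
        using inv(1) inv(3)[folded p_def] ag by algebra
      finally show ?thesis .
    qed
    have ge: "form (H t x) (a *\<^sub>R u + b *\<^sub>R v + c *\<^sub>R w)
        \<ge> (- 3 * R * \<beta> - t * p) * (a\<^sup>2 * (u \<bullet> u) + b\<^sup>2 * (v \<bullet> v) + c\<^sup>2 * (w \<bullet> w))" for a b c
    proof -
      define e where "e = a *\<^sub>R u + b *\<^sub>R v + c *\<^sub>R w"
      have \<theta>e: "\<theta> \<bullet> e = 0"
        by (simp add: e_def inner_simps \<theta>uv \<theta>w)
      have ee: "e \<bullet> e = 3 * a\<^sup>2 + 3 * b\<^sup>2 + 108 * c\<^sup>2"
        by (simp add: e_def inner_simps uv uvw ww wuv power2_eq_square)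
      have "mul \<theta> e \<bullet> e = - 3 * \<beta> / 2 * a\<^sup>2 - 3 * \<gamma> / 2 * b\<^sup>2 + c\<^sup>2 * (mul \<theta> w \<bullet> w)"
        by (simp add: e_def mul_algebra mu inner_simps uv uvw wuv power2_eq_square
            mul_inner[of \<theta> w u] mul_inner[of \<theta> w v] algebra_simps)
      then have me: "mul \<theta> e \<bullet> e = - 3 * \<beta> / 2 * a\<^sup>2 - 3 * \<gamma> / 2 * b\<^sup>2 - 108 * p * c\<^sup>2"
        by (simp add: mww)
      have "form (H t x) e - (- 3 * R * \<beta> - t * p) * (e \<bullet> e)
          = 9 * R * (\<beta> - \<gamma>) * b\<^sup>2 + 324 * R * (\<beta> - 2 * p) * c\<^sup>2"
        unfolding form \<theta>e me ee by (simp add: algebra_simps)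
      moreover have "0 \<le> R" using R t by simp
      moreover have "0 \<le> \<beta> - 2 * p"
      proof -
        have "\<beta> - 2 * p = \<beta> * (4 - \<beta>\<^sup>2)"
          using cub by algebra
        moreover have "\<beta>\<^sup>2 \<le> 1" using b1 by (simp add: abs_square_le_1)
        ultimately show ?thesis using True by simp
      qed
      ultimately have "0 \<le> form (H t x) e - (- 3 * R * \<beta> - t * p) * (e \<bullet> e)"
        using le by simp
      then have "(- 3 * R * \<beta> - t * p) * (a\<^sup>2 * (u \<bullet> u) + b\<^sup>2 * (v \<bullet> v) + c\<^sup>2 * (w \<bullet> w)) \<le> form (H t x) e"
        by (simp add: uv ww ee mult.commute)
      then show ?thesis
        by (simp only: e_def)
    qed
    have "w \<noteq> 0" using ww by auto
    show ?thesis
      by (rule span3_form_ge[OF uv(3) uvw nz \<open>w \<noteq> 0\<close> ge]) blast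
  next
    \<comment> \<open>Here \<theta> itself is the third direction, with value 6 R p - 4 t p; now 2 p
      + \<beta> = - \<beta> (2 - \<beta>^2) is positive.\<close>
    case False
    have ge: "form (H t x) (a *\<^sub>R u + b *\<^sub>R v + c *\<^sub>R \<theta>)
        \<ge> (- 3 * R * \<beta> - t * p) * (a\<^sup>2 * (u \<bullet> u) + b\<^sup>2 * (v \<bullet> v) + c\<^sup>2 * (\<theta> \<bullet> \<theta>))" for a b c
    proof -
      define e where "e = a *\<^sub>R u + b *\<^sub>R v + c *\<^sub>R \<theta>"
      have \<theta>e: "\<theta> \<bullet> e = c" "mul \<theta> \<theta> \<bullet> e = c * p"
        by (simp_all add: e_def inner_simps \<theta>uv \<theta>2uv unit p_def cubic_def)
      have ee: "e \<bullet> e = 3 * a\<^sup>2 + 3 * b\<^sup>2 + c\<^sup>2"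
        by (simp add: e_def inner_simps uv \<theta>uv unit uv\<theta> power2_eq_square)
      have me: "mul \<theta> e \<bullet> e = - 3 * \<beta> / 2 * a\<^sup>2 - 3 * \<gamma> / 2 * b\<^sup>2 + c\<^sup>2 * p"
        by (simp add: e_def mul_algebra mu inner_simps uv \<theta>uv \<theta>2uv uv\<theta> power2_eq_square
            mul_commute[of u \<theta>] mul_commute[of v \<theta>] p_def cubic_def algebra_simps)
      have "form (H t x) e - (- 3 * R * \<beta> - t * p) * (e \<bullet> e)
          = 9 * R * (\<beta> - \<gamma>) * b\<^sup>2 + (3 * R * (2 * p + \<beta>) - 3 * t * p) * c\<^sup>2"
        unfolding form \<theta>e me ee by (simp add: algebra_simps power2_eq_square)
      moreover have "0 \<le> R" using R t by simp
      moreover have "0 \<le> 3 * R * (2 * p + \<beta>) - 3 * t * p"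
      proof -
        have "3 * R * (2 * p + \<beta>) - 3 * t * p = - \<beta> * (3 * (R - t) * (2 - \<beta>\<^sup>2) + 3 / 2 * t * (1 - \<beta>\<^sup>2))"
          using cub by algebra
        moreover have "\<beta>\<^sup>2 \<le> 1" using b1 by (simp add: abs_square_le_1)
        ultimately show ?thesis
          using False R t by (simp add: mult_nonpos_nonneg)
      qed
      ultimately have "0 \<le> form (H t x) e - (- 3 * R * \<beta> - t * p) * (e \<bullet> e)"
        using le by simp
      then have "(- 3 * R * \<beta> - t * p) * (a\<^sup>2 * (u \<bullet> u) + b\<^sup>2 * (v \<bullet> v) + c\<^sup>2 * (\<theta> \<bullet> \<theta>)) \<le> form (H t x) e"
        by (simp add: uv unit ee mult.commute)
      then show ?thesis
        by (simp only: e_def)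
    qed
    show ?thesis
      by (rule span3_form_ge[OF uv(3) uv\<theta> nz \<open>\<theta> \<noteq> 0\<close> ge]) blast
  qed
  then show ?thesis
    using that cub b1 by (auto simp: R_def p_def \<theta>_def)
qed

section \<open>Lower bounds for differences of model Hessians\<close>

lemma cubic_add: "cubic (x + y) = cubic x + 3 * (mul x x \<bullet> y) + 3 * (x \<bullet> mul y y) + cubic y"
  using mul_inner[of x y x] mul_inner[of y x x] mul_inner[of x y y] mul_inner[of y x y]
  unfolding cubic_def mul_algebra inner_add_left inner_add_right mul_commute[of y x]
  by (simp only: inner_commute)

lemma cubic_sgn_le: "\<bar>cubic (sgn x)\<bar> \<le> 1"
  using cubic_le[of "sgn x"] by (cases "x = 0") (auto simp: norm_sgn cubic_def)

lemma subspaces_meet: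
  fixes S T :: "(real ^ 5) set"
  assumes "subspace S" "subspace T" "dim S = 3" "dim T = 3"
  obtains e where "e \<in> S" "e \<in> T" "e \<noteq> 0"
proof -
  have "dim {x + y |x y. x \<in> S \<and> y \<in> T} \<le> 5"
    using dim_subset_UNIV[of "{x + y |x y. x \<in> S \<and> y \<in> T}"] by simp
  then have "dim (S \<inter> T) \<noteq> 0"
    using dim_sums_Int[OF assms(1,2)] assms(3,4) by linarith
  then have "\<not> S \<inter> T \<subseteq> {0}"
    by simp
  then show ?thesis using that by blast
qed

text \<open>The certificate for \<open>- y\<close> bounds the form of \<open>H t y\<close> from
  above, because \<open>H\<close> is odd. On a common vector of the two spaces c dominates the
  difference of the middle eigenvalues. Since \<beta>^3 - 3 \<beta> decreases on [-1, 1], the larger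
  cubic value at x belongs to the smaller root.\<close>

lemma hyperbolic_near:
  assumes "x \<noteq> 0" "y \<noteq> 0" "0 \<le> t" "cubic (sgn y) < cubic (sgn x)" "norm y \<le> norm x"
    and le: "form_le (H t x - H t y) c"
    and near: "norm x - norm y \<le> 3 / 4 * t * (cubic (sgn x) - cubic (sgn y))"
  shows "t * (cubic (sgn x) - cubic (sgn y)) \<le> 4 * c"
proof -
  define p q where "p = cubic (sgn x)" and "q = cubic (sgn y)"
  obtain a S where a: "a ^ 3 - 3 * a = 2 * p" "\<bar>a\<bar> \<le> 1" and S: "subspace S" "dim S = 3"
    and geS: "\<And>e. e \<in> S \<Longrightarrow> form (H t x) e \<ge> (- 3 * (norm x + t) * a - t * p) * (e \<bullet> e)"
    unfolding p_def using middle_eigenvalue[OF assms(1) assms(3)] by metis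
  obtain b' T where b': "b' ^ 3 - 3 * b' = 2 * cubic (sgn (- y))" "\<bar>b'\<bar> \<le> 1" and T: "subspace T" "dim T = 3"
    and geT: "\<And>e. e \<in> T \<Longrightarrow> form (H t (- y)) e \<ge> (- 3 * (norm (- y)
      + t) * b' - t * cubic (sgn (- y))) * (e \<bullet> e)"
    using middle_eigenvalue[of "- y" t] assms(2,3) by (metis neg_equal_0_iff_equal)
  define b where "b = - b'"
  have b: "b ^ 3 - 3 * b = 2 * q" "\<bar>b\<bar> \<le> 1"
    using b' by (simp_all add: b_def q_def sgn_minus cubic_minus power3_eq_cube)
  have leT: "form (H t y) e \<le> (- 3 * (norm y + t) * b - t * q) * (e \<bullet> e)" if "e \<in> T" for e
    using geT[OF that] form_scaleR[of e "- 1" "H t y"]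
    by (simp add: b_def q_def sgn_minus cubic_minus H_minus algebra_simps)
  obtain e where e: "e \<in> S" "e \<in> T" "e \<noteq> 0"
    using subspaces_meet[OF S(1) T(1) S(2) T(2)] .
  have "form (H t x - H t y) e \<le> c * (e \<bullet> e)"
    using le by (simp add: form_le_def)
  then have "(- 3 * (norm x + t) * a - t * p - (- 3 * (norm y + t) * b - t * q)) * (e \<bullet> e) \<le> c * (e \<bullet> e)"
    using geS[OF e(1)] leT[OF e(2)] unfolding form_diff left_diff_distrib by linarith
  then have c: "- 3 * (norm x + t) * a - t * p - (- 3 * (norm y + t) * b - t * q) \<le> c"
    using e(3) by (simp add: mult_le_cancel_right)
  define D \<Delta> where "D = b - a" and "\<Delta> = p - q"
  have "0 < \<Delta>" using assms(4) by (simp add: \<Delta>_def p_def q_def)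
  have \<Delta>: "2 * \<Delta> = D * (3 - (a\<^sup>2 + a * b + b\<^sup>2))"
    using a(1) b(1) unfolding \<Delta>_def D_def by algebra
  have a2: "a\<^sup>2 \<le> 1" and b2: "b\<^sup>2 \<le> 1"
    using a(2) b(2) by (simp_all add: abs_square_le_1)
  have "a * b \<le> 1"
  proof -
    have "0 \<le> (a - b)\<^sup>2" by simp
    then show ?thesis using a2 b2 by (simp add: power2_diff)
  qed
  then have "0 \<le> 3 - (a\<^sup>2 + a * b + b\<^sup>2)" using a2 b2 by simp
  then have D: "0 < D"
    using \<Delta> \<open>0 < \<Delta>\<close> by (metis mult_nonpos_nonneg not_less mult_pos_pos zero_less_numeral)
  \<comment> \<open>Besides - t \<Delta>, only the term - 3 a (|x| - |y|) can be negative, and only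
    for a > 0; that case is where \<open>near\<close> enters.\<close>
  have c': "3 * D * t - 3 * a * (norm x - norm y) - t * \<Delta> \<le> c"
  proof -
    have "0 \<le> 3 * D * norm y" using D by simp
    then show ?thesis using c by (simp add: D_def \<Delta>_def algebra_simps)
  qed
  have "t * \<Delta> \<le> 4 * c"
  proof (cases "a \<le> 0")
    case True
    have "0 \<le> a\<^sup>2 + a * b + b\<^sup>2"
    proof -
      have "a\<^sup>2 + a * b + b\<^sup>2 = (a + b / 2)\<^sup>2 + 3 / 4 * b\<^sup>2"
        by (simp add: power2_eq_square algebra_simps)
      then show ?thesis by simp
    qed
    then have "0 \<le> D * (a\<^sup>2 + a * b + b\<^sup>2)" using D by simp
    then have "2 * \<Delta> \<le> 3 * D"
      unfolding \<Delta> right_diff_distrib by linarith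
    then have "t * (2 * \<Delta>) \<le> t * (3 * D)"
      using assms(3) by (rule mult_left_mono)
    moreover have "a * (norm x - norm y) \<le> 0"
      using True assms(5) by (simp add: mult_nonpos_nonneg)
    moreover have "0 \<le> t * \<Delta>" using assms(3) \<open>0 < \<Delta>\<close> by simp
    ultimately show ?thesis using c' by (simp add: algebra_simps)
  next
    case False
    \<comment> \<open>For 0 < a < b the bound 2 \<Delta> \<le> 3 D improves to 2 \<Delta> (1 + a^2)
      \<le> 3 D. The threshold 3/4 then leaves the factor 1 + 2 a^2 - 9 a / 4, whose minimum, at a =
      9/16, exceeds 1/4.\<close>
    then have "a < b" "0 < a" using D by (simp_all add: D_def)
    then have "a * a \<le> a * b" "a * a \<le> b * b" by (simp_all add: mult_mono)
    then have "3 * a\<^sup>2 \<le> a\<^sup>2 + a * b + b\<^sup>2"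
      by (simp add: power2_eq_square)
    then have "2 * \<Delta> \<le> D * (3 - 3 * a\<^sup>2)"
      unfolding \<Delta> using D by (intro mult_left_mono) auto
    then have "2 * \<Delta> * (1 + a\<^sup>2) \<le> D * (3 - 3 * a\<^sup>2) * (1 + a\<^sup>2)"
      by (rule mult_right_mono) simp
    also have "\<dots> = 3 * D - 3 * D * a ^ 4"
      by (simp add: power2_eq_square power4_eq_xxxx algebra_simps)
    also have "\<dots> \<le> 3 * D" using D by simp
    finally have "t * (2 * \<Delta> * (1 + a\<^sup>2)) \<le> t * (3 * D)"
      using assms(3) by (rule mult_left_mono)
    moreover have "3 * a * (norm x - norm y) \<le> 3 * a * (3 / 4 * t * \<Delta>)"
      using near \<open>0 < a\<close> unfolding \<Delta>_def p_def q_def by (intro mult_left_mono) auto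
    ultimately have "t * \<Delta> * (1 + 2 * a\<^sup>2 - 9 / 4 * a) \<le> c"
      using c' by (simp add: algebra_simps)
    moreover have "1 / 4 \<le> 1 + 2 * a\<^sup>2 - 9 / 4 * a"
    proof -
      have "1 + 2 * a\<^sup>2 - 9 / 4 * a - 1 / 4 = 2 * (a - 9 / 16)\<^sup>2 + 15 / 128"
        by (simp add: power2_eq_square algebra_simps)
      moreover have "0 \<le> (a - 9 / 16)\<^sup>2" by simp
      ultimately show ?thesis by linarith
    qed
    then have "t * \<Delta> * (1 / 4) \<le> t * \<Delta> * (1 + 2 * a\<^sup>2 - 9 / 4 * a)"
      using assms(3) \<open>0 < \<Delta>\<close> by (intro mult_left_mono) auto
    ultimately show ?thesis by simp
  qed
  then show ?thesis by (simp add: \<Delta>_def p_def q_def)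
qed

lemma hyperbolic_test:
  assumes "form_le (H t x - H t y) c"
  shows "21 * ((x - y) \<bullet> \<phi>)
      + t * (15 * ((sgn x - sgn y) \<bullet> \<phi>)
             + 3 * ((cubic (sgn x) *\<^sub>R mul (sgn x) (sgn x) - cubic (sgn y) *\<^sub>R mul (sgn y) (sgn y)) \<bullet> \<phi>))
      - 8 * t * (cubic (sgn x) - cubic (sgn y)) * norm \<phi> \<le> 5 * norm \<phi> * c"
  using form_le_test[OF assms, of \<phi>]
  by (simp add: matrix_diff_mult trace_sub trace_H_L trace_H inner_diff_left algebra_simps)

text \<open>Testing with \<phi> = \<open>sgn x\<close> produces the radial gain 21 (|x| - |y|). The
  angular terms lose at most 5 t (p - q) and the trace term 8 t (p - q). The common threshold 3/4
  works here because 21 * 3/4 > 5 + 8.\<close>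

lemma hyperbolic_far:
  assumes "x \<noteq> 0" "y \<noteq> 0" "0 \<le> t" "cubic (sgn y) < cubic (sgn x)" "norm y \<le> norm x"
    and le: "form_le (H t x - H t y) c"
    and far: "3 / 4 * t * (cubic (sgn x) - cubic (sgn y)) \<le> norm x - norm y"
  shows "t * (cubic (sgn x) - cubic (sgn y)) \<le> 4 * c"
proof -
  define \<theta> \<eta> where "\<theta> = sgn x" and "\<eta> = sgn y"
  define p q where "p = cubic \<theta>" and "q = cubic \<eta>"
  define \<delta> where "\<delta> = \<theta> - \<eta>"
  have unit: "\<theta> \<bullet> \<theta> = 1" "\<eta> \<bullet> \<eta> = 1" "norm \<theta> = 1" "norm \<eta> = 1"
    using assms(1,2) by (simp_all add: \<theta>_def \<eta>_def inner_sgn_self norm_sgn)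
  have \<delta>2: "\<delta> \<bullet> \<delta> = 2 - 2 * (\<eta> \<bullet> \<theta>)"
    by (simp add: \<delta>_def inner_simps unit inner_commute)
  have x: "x \<bullet> \<theta> = norm x"
    using assms(1) by (simp add: \<theta>_def sgn_div_norm dot_square_norm power2_eq_square)
  have y: "y \<bullet> \<theta> = norm y * (\<eta> \<bullet> \<theta>)"
    using assms(2) by (simp add: \<eta>_def sgn_div_norm)
  have "\<eta> \<bullet> \<theta> \<le> 1"
    using norm_cauchy_schwarz[of \<eta> \<theta>] unit by simp
  then have yle: "norm y * (\<eta> \<bullet> \<theta>) \<le> norm y"
    by (simp add: mult_left_le)
  have pq: "\<bar>p\<bar> \<le> 1" "\<bar>q\<bar> \<le> 1" "q < p"
    using cubic_sgn_le assms(4) by (simp_all add: p_def q_def \<theta>_def \<eta>_def)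
  have \<theta>: "\<theta> = \<eta> + \<delta>" by (simp add: \<delta>_def)
  \<comment> \<open>Expanding around \<eta> turns
    \<open>mul \<eta> \<eta> \<bullet> \<theta>\<close> into (p + 2 q) / 3 up to a remainder of
    order \<delta> . \<delta>, which the gain 15/2 (\<delta> . \<delta>) from the angular term
    absorbs.\<close>
  have "p = q + 3 * (mul \<eta> \<eta> \<bullet> \<delta>) + 3 * (\<eta> \<bullet> mul \<delta> \<delta>) + cubic \<delta>"
    unfolding p_def q_def by (subst \<theta>) (rule cubic_add)
  moreover have "mul \<eta> \<eta> \<bullet> \<delta> = mul \<eta> \<eta> \<bullet> \<theta> - q"
    by (simp add: \<delta>_def inner_simps q_def cubic_def)
  ultimately have \<eta>\<theta>: "3 * (mul \<eta> \<eta> \<bullet> \<theta>) = p + 2 * q - (3 * (\<eta> \<bullet> mul \<delta> \<delta>) + cubic \<delta>)"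
    by simp
  have err: "\<bar>3 * (\<eta> \<bullet> mul \<delta> \<delta>) + cubic \<delta>\<bar> \<le> 5 * (\<delta> \<bullet> \<delta>)"
  proof -
    have "\<bar>\<eta> \<bullet> mul \<delta> \<delta>\<bar> \<le> \<delta> \<bullet> \<delta>"
      using Cauchy_Schwarz_ineq2[of \<eta> "mul \<delta> \<delta>"] by (simp add: unit norm_mul_self power2_norm_eq_inner)
    moreover have "norm \<delta> \<le> 2"
      using norm_triangle_ineq4[of \<theta> \<eta>] by (simp add: \<delta>_def unit)
    then have "norm \<delta> * (norm \<delta>)\<^sup>2 \<le> 2 * (norm \<delta>)\<^sup>2"
      by (intro mult_right_mono) auto
    then have "\<bar>cubic \<delta>\<bar> \<le> 2 * (\<delta> \<bullet> \<delta>)"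
      using cubic_le[of \<delta>] by (simp add: power3_eq_cube power2_eq_square mult.assoc dot_square_norm)
    ultimately show ?thesis by linarith
  qed
  have "q * (3 * (\<eta> \<bullet> mul \<delta> \<delta>) + cubic \<delta>) \<ge> - (5 * (\<delta> \<bullet> \<delta>))"
  proof -
    have "\<bar>q * (3 * (\<eta> \<bullet> mul \<delta> \<delta>) + cubic \<delta>)\<bar> \<le> 1 * (5 * (\<delta> \<bullet> \<delta>))"
      unfolding abs_mult using pq err by (intro mult_mono) auto
    then show ?thesis by linarith
  qed
  moreover have "3 * ((p *\<^sub>R mul \<theta> \<theta> - q *\<^sub>R mul \<eta> \<eta>) \<bullet> \<theta>) = 3 * p\<^sup>2 - q * (3 * (mul \<eta> \<eta> \<bullet> \<theta>))"
    by (simp add: inner_simps p_def cubic_def power2_eq_square)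
  moreover have "15 * ((\<theta> - \<eta>) \<bullet> \<theta>) = 15 / 2 * (\<delta> \<bullet> \<delta>)"
    by (simp add: \<delta>2 inner_simps unit)
  moreover have "0 \<le> \<delta> \<bullet> \<delta>" by simp
  moreover have "3 * p\<^sup>2 - q * (p + 2 * q) = (p - q) * (3 * p + 2 * q)"
    by (simp add: power2_eq_square algebra_simps)
  moreover have "(p - q) * (- 5) \<le> (p - q) * (3 * p + 2 * q)"
    using pq by (intro mult_left_mono) auto
  ultimately have "15 * ((\<theta> - \<eta>) \<bullet> \<theta>) + 3 * ((p *\<^sub>R mul \<theta> \<theta> - q *\<^sub>R mul \<eta> \<eta>) \<bullet> \<theta>) \<ge> - 5 * (p - q)"
    unfolding \<eta>\<theta> right_diff_distrib[of q] by linarith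
  then have "t * (- 5 * (p - q)) \<le> t * (15 * ((\<theta> - \<eta>) \<bullet> \<theta>) + 3 * ((p *\<^sub>R mul \<theta> \<theta> - q *\<^sub>R mul \<eta> \<eta>) \<bullet> \<theta>))"
    using assms(3) by (rule mult_left_mono)
  moreover have "21 * ((x - y) \<bullet> \<theta>) \<ge> 21 * (norm x - norm y)"
    using yle by (simp add: inner_diff_left x y)
  ultimately have "21 * (norm x - norm y) - 13 * (t * (p - q)) \<le> 5 * c"
    using hyperbolic_test[OF le, of \<theta>] unfolding \<theta>_def[symmetric] \<eta>_def[symmetric] p_def[symmetric]
      q_def[symmetric]
    by (simp add: unit algebra_simps)
  moreover have "0 \<le> t * (p - q)"
    using assms(3) pq by simp
  moreover have "3 / 4 * (t * (p - q)) \<le> norm x - norm y"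
    using far by (simp add: p_def q_def \<theta>_def \<eta>_def)
  moreover have "X \<le> 4 * c" if "21 * d - 13 * X \<le> 5 * c" "0 \<le> X" "3 / 4 * X \<le> d" for X d :: real
    using that by linarith
  ultimately have "t * (p - q) \<le> 4 * c"
    by blast
  then show ?thesis
    by (simp add: p_def q_def \<theta>_def \<eta>_def)
qed

text \<open>The two regimes of |x| - |y| share the threshold 3/4. If |x| < |y|, the pair (- y, - x)
  has the same difference of Hessians and of cubic values, both being odd. If the left side is not
  positive, only c \<ge> 0 is to be shown.\<close>

lemma H_trace_bound:
  assumes "x \<noteq> 0" "y \<noteq> 0" "0 \<le> t" and le: "form_le (H t x - H t y) c"
  shows "t * (cubic (sgn x) - cubic (sgn y)) \<le> 4 * c"
proof (cases "cubic (sgn y) < cubic (sgn x)")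
  case False
  then have "t * (cubic (sgn x) - cubic (sgn y)) \<le> 0"
    using assms(3) by (simp add: mult_nonneg_nonpos)
  moreover have "form_le (H t x - H t y) c \<Longrightarrow> 0 \<le> c"
  proof -
    have "trace ((H t x - H t y) ** mat 1) \<le> c * trace (mat 1 :: real ^ 5 ^ 5)"
      by (intro trace_mult_le le) (auto simp: transpose_mat)
    then show "0 \<le> c"
      using \<open>t * (cubic (sgn x) - cubic (sgn y)) \<le> 0\<close>
      by (simp add: trace_sub trace_H trace_I algebra_simps)
  qed
  ultimately show ?thesis using le by simp
next
  case True
  have wlog: "t * (cubic (sgn x) - cubic (sgn y)) \<le> 4 * c"
    if "x \<noteq> 0" "y \<noteq> 0" "cubic (sgn y) < cubic (sgn x)" "norm y \<le> norm x" "form_le (H t x - H t y) c" for x y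
    using hyperbolic_near[OF that(1,2) assms(3) that(3-5)] hyperbolic_far[OF that(1,2) assms(3) that(3-5)]
    by linarith
  show ?thesis
  proof (cases "norm y \<le> norm x")
    case True
    then show ?thesis using wlog[of x y] assms \<open>cubic (sgn y) < cubic (sgn x)\<close> by simp
  next
    case False
    then show ?thesis
      using wlog[of "- y" "- x"] assms \<open>cubic (sgn y) < cubic (sgn x)\<close>
      by (simp add: sgn_minus cubic_minus H_minus)
  qed
qed

lemma cubic_midpoint:
  "cubic (m + (1/2) *\<^sub>R \<delta>) - cubic (m - (1/2) *\<^sub>R \<delta>) = 3 * (mul m m \<bullet> \<delta>) + cubic \<delta> / 4"
  using cubic_add[of m "(1/2) *\<^sub>R \<delta>"] cubic_add[of m "- ((1/2) *\<^sub>R \<delta>)"]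
  by (simp add: mul_algebra cubic_def)

lemma form_le_trace: "form_le M c \<Longrightarrow> trace M \<le> 5 * c" for M :: "real ^ 5 ^ 5"
  using trace_mult_le[of M c "mat 1"] by (simp add: transpose_mat trace_I)

text \<open>Testing with \<phi> = \<delta>, the difference of directions, bounds t |\<delta>| by a
  multiple of c, the trace term being controlled by \<open>H_trace_bound\<close>. This makes the
  angular terms harmless in the test \<phi> = x - y, whose main term is 21 |x - y|^2. The constant
  32 = 8 * 4 comes from the trace; the distance alone would allow about 9.\<close>

lemma H_difference_bound:
  assumes t: "0 \<le> t" and le: "form_le (H t x - H t y) c"
  shows "norm (x - y) \<le> 32 * c" and "trace (H t y) - trace (H t x) \<le> 32 * c"
proof -
  have main: "norm (x - y) \<le> 32 * c" if "x \<noteq> 0" "y \<noteq> 0" "form_le (H t x - H t y) c" for x y c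
  proof -
    define \<theta> \<eta> where "\<theta> = sgn x" and "\<eta> = sgn y"
    define p q where "p = cubic \<theta>" and "q = cubic \<eta>"
    define \<delta> where "\<delta> = \<theta> - \<eta>"
    define V where "V = p *\<^sub>R mul \<theta> \<theta> - q *\<^sub>R mul \<eta> \<eta>"
    note test = hyperbolic_test[OF that(3)]
    have unit: "\<theta> \<bullet> \<theta> = 1" "\<eta> \<bullet> \<eta> = 1" "norm \<theta> = 1" "norm \<eta> = 1"
      using that(1,2) by (simp_all add: \<theta>_def \<eta>_def inner_sgn_self norm_sgn)
    have pq: "\<bar>p\<bar> \<le> 1" "\<bar>q\<bar> \<le> 1"
      using cubic_sgn_le by (simp_all add: p_def q_def \<theta>_def \<eta>_def)
    have tr: "t * (p - q) \<le> 4 * c"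
      using H_trace_bound[OF that(1,2) t that(3)] by (simp add: p_def q_def \<theta>_def \<eta>_def)
    have "norm \<delta> \<le> 2"
      using norm_triangle_ineq4[of \<theta> \<eta>] by (simp add: \<delta>_def unit)
    have \<delta>2: "\<delta> \<bullet> \<delta> = 2 - 2 * (\<eta> \<bullet> \<theta>)"
      by (simp add: \<delta>_def inner_simps unit inner_commute)
    have xy: "x = norm x *\<^sub>R \<theta>" "y = norm y *\<^sub>R \<eta>"
      using that(1,2) by (simp_all add: \<theta>_def \<eta>_def sgn_div_norm)
    have "(x - y) \<bullet> \<delta> = (norm x + norm y) * (1 - \<eta> \<bullet> \<theta>)"
      by (subst xy(1), subst xy(2)) (simp add: \<delta>_def inner_diff_left inner_diff_right unit
        inner_commute[of \<theta> \<eta>] algebra_simps)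
    also have "\<dots> = (norm x + norm y) * (\<delta> \<bullet> \<delta>) / 2"
      by (simp add: \<delta>2)
    also have "\<dots> \<ge> 0" by simp
    finally have rad: "0 \<le> (x - y) \<bullet> \<delta>" .
    define m where "m = (1/2) *\<^sub>R (\<theta> + \<eta>)"
    have \<theta>m: "\<theta> = m + (1/2) *\<^sub>R \<delta>" and \<eta>m: "\<eta> = m - (1/2) *\<^sub>R \<delta>"
      by (simp_all add: m_def \<delta>_def vec_eq_iff field_simps)
    \<comment> \<open>The factors p - q = 3 g + h / 4 and half of 2 g + h / 2 share the leading
      quantity g, so their product is a square up to - h^2 / 48. This keeps 15 (\<delta> . \<delta>)
      + 3 (V . \<delta>) above 8 (\<delta> . \<delta>).\<close>
    have V\<delta>: "- 7 / 3 * (\<delta> \<bullet> \<delta>) \<le> V \<bullet> \<delta>"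
    proof -
      define g h where "g = mul m m \<bullet> \<delta>" and "h = cubic \<delta>"
      have diff: "p - q = 3 * g + h / 4"
        unfolding p_def q_def
        using cubic_midpoint[of m \<delta>] by (simp add: g_def h_def flip: \<theta>m \<eta>m)
      have sum: "(mul \<theta> \<theta> + mul \<eta> \<eta>) \<bullet> \<delta> = 2 * g + h / 2"
      proof -
        have "mul \<theta> \<theta> = mul m m + mul m \<delta> + (1/4) *\<^sub>R mul \<delta> \<delta>"
          by (subst (1 2) \<theta>m) (simp add: mul_algebra mul_commute[of \<delta> m] vec_eq_iff field_simps)
        moreover have "mul \<eta> \<eta> = mul m m - mul m \<delta> + (1/4) *\<^sub>R mul \<delta> \<delta>"
          by (subst (1 2) \<eta>m) (simp add: mul_algebra mul_commute[of \<delta> m] vec_eq_iff field_simps)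
        ultimately show ?thesis
          by (simp only: inner_add_left inner_diff_left inner_scaleR_left g_def h_def cubic_def)
      qed
      have sq: "\<bar>(mul \<theta> \<theta> - mul \<eta> \<eta>) \<bullet> \<delta>\<bar> \<le> 2 * (\<delta> \<bullet> \<delta>)"
      proof -
        have "mul \<theta> \<theta> - mul \<eta> \<eta> = mul (\<theta> + \<eta>) \<delta>"
          by (simp add: \<delta>_def mul_algebra mul_commute)
        moreover have "norm (\<theta> + \<eta>) \<le> 2"
          using norm_triangle_ineq[of \<theta> \<eta>] by (simp add: unit)
        then have "norm (\<theta> + \<eta>) * (norm \<delta>)\<^sup>2 \<le> 2 * (norm \<delta>)\<^sup>2"
          by (intro mult_right_mono) auto
        ultimately show ?thesis
          using mul_form_le[of "\<theta> + \<eta>" \<delta>] by (simp add: power2_norm_eq_inner)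
      qed
      have "V = ((p + q) / 2) *\<^sub>R (mul \<theta> \<theta> - mul \<eta> \<eta>) + ((p - q) / 2) *\<^sub>R (mul \<theta> \<theta> + mul \<eta> \<eta>)"
        by (simp add: V_def vec_eq_iff field_simps)
      then have "V \<bullet> \<delta> = (p + q) / 2 * ((mul \<theta> \<theta> - mul \<eta> \<eta>) \<bullet> \<delta>) + (p - q) / 2 * ((mul \<theta> \<theta> + mul \<eta> \<eta>) \<bullet> \<delta>)"
        by (simp only: inner_add_left[of "_ *\<^sub>R _"] inner_scaleR_left)
      also have "(p - q) / 2 * ((mul \<theta> \<theta> + mul \<eta> \<eta>) \<bullet> \<delta>) = 3 * (g + h / 6)\<^sup>2 - h\<^sup>2 / 48"
        unfolding diff sum by (simp add: power2_eq_square field_simps)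
      finally have eq: "V \<bullet> \<delta> = (p + q) / 2 * ((mul \<theta> \<theta> - mul \<eta> \<eta>) \<bullet> \<delta>) + (3 * (g + h / 6)\<^sup>2 - h\<^sup>2 / 48)" .
      have "\<bar>(p + q) / 2 * ((mul \<theta> \<theta> - mul \<eta> \<eta>) \<bullet> \<delta>)\<bar> \<le> 1 * (2 * (\<delta> \<bullet> \<delta>))"
        unfolding abs_mult using pq sq by (intro mult_mono) auto
      moreover have "h\<^sup>2 \<le> 16 * (\<delta> \<bullet> \<delta>)"
      proof -
        have "\<bar>h\<bar> \<le> (norm \<delta>)\<^sup>2 * norm \<delta>"
          using cubic_le[of \<delta>] by (simp add: h_def power3_eq_cube power2_eq_square)
        also have "\<dots> \<le> 2\<^sup>2 * norm \<delta>"
          using \<open>norm \<delta> \<le> 2\<close> by (intro mult_right_mono power_mono) auto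
        finally have "\<bar>h\<bar>\<^sup>2 \<le> (4 * norm \<delta>)\<^sup>2"
          by (intro power_mono) auto
        then show ?thesis
          by (simp add: power_mult_distrib power2_norm_eq_inner)
      qed
      moreover have "0 \<le> (g + h / 6)\<^sup>2" by simp
      ultimately show ?thesis unfolding eq by linarith
    qed
    have "8 * (\<delta> \<bullet> \<delta>) \<le> 15 * (\<delta> \<bullet> \<delta>) + 3 * (V \<bullet> \<delta>)"
      using V\<delta> by simp
    then have "t * (8 * (\<delta> \<bullet> \<delta>)) \<le> t * (15 * (\<delta> \<bullet> \<delta>) + 3 * (V \<bullet> \<delta>))"
      using t by (rule mult_left_mono)
    moreover have "8 * (t * (p - q)) * norm \<delta> \<le> 8 * (4 * c) * norm \<delta>"
      using tr by (intro mult_right_mono) auto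
    ultimately have "8 * t * (norm \<delta> * norm \<delta>) \<le> 37 * c * norm \<delta>"
      using test[of \<delta>] rad
      unfolding \<theta>_def[symmetric] \<eta>_def[symmetric] p_def[symmetric] q_def[symmetric] V_def[symmetric]
        \<delta>_def[symmetric]
      by (simp add: dot_square_norm power2_eq_square algebra_simps)
    \<comment> \<open>The trace of the difference is - 8 t (p - q) \<le> 5 c; together with t (p -
      q) \<le> 4 c this gives 0 \<le> 37 c.\<close>
    moreover have "0 \<le> c"
      using tr form_le_trace[OF that(3)] by (simp add: trace_sub trace_H p_def q_def \<theta>_def \<eta>_def
        algebra_simps)
    ultimately have t\<delta>: "8 * t * norm \<delta> \<le> 37 * c"
      by (cases "\<delta> = 0") (auto simp: mult.assoc[symmetric])
    have V: "norm V \<le> 6 * norm \<delta>"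
    proof -
      have "\<bar>p - q\<bar> \<le> 4 * norm \<delta>"
      proof -
        have "norm (\<theta> + \<eta>) \<le> 2"
          using norm_triangle_ineq[of \<theta> \<eta>] by (simp add: unit)
        then have "norm m \<le> 1" by (simp add: m_def)
        then have "norm (mul m m) \<le> 1"
          by (simp add: norm_mul_self power_le_one)
        then have "norm (mul m m) * norm \<delta> \<le> 1 * norm \<delta>"
          by (intro mult_right_mono) auto
        then have "\<bar>mul m m \<bullet> \<delta>\<bar> \<le> norm \<delta>"
          using Cauchy_Schwarz_ineq2[of "mul m m" \<delta>] by simp
        moreover have "(norm \<delta>)\<^sup>2 * norm \<delta> \<le> 2\<^sup>2 * norm \<delta>"
          using \<open>norm \<delta> \<le> 2\<close> by (intro mult_right_mono power_mono) auto
        then have "\<bar>cubic \<delta>\<bar> \<le> 4 * norm \<delta>"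
          using cubic_le[of \<delta>] by (simp add: power3_eq_cube power2_eq_square)
        moreover have "p - q = 3 * (mul m m \<bullet> \<delta>) + cubic \<delta> / 4"
          using cubic_midpoint[of m \<delta>] by (simp add: p_def q_def flip: \<theta>m \<eta>m)
        ultimately show ?thesis by linarith
      qed
      moreover have "norm (mul (\<theta> + \<eta>) \<delta>) \<le> 2 * norm \<delta>"
      proof (rule order_trans[OF norm_mul_le])
        show "norm (\<theta> + \<eta>) * norm \<delta> \<le> 2 * norm \<delta>"
          using norm_triangle_ineq[of \<theta> \<eta>] by (intro mult_right_mono) (auto simp: unit)
      qed
      then have "\<bar>p\<bar> * norm (mul (\<theta> + \<eta>) \<delta>) \<le> 1 * (2 * norm \<delta>)"
        using pq by (intro mult_mono) auto
      moreover have "V = p *\<^sub>R mul (\<theta> + \<eta>) \<delta> + (p - q) *\<^sub>R mul \<eta> \<eta>"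
        by (simp add: V_def \<delta>_def mul_algebra mul_commute[of \<eta> \<theta>] scaleR_diff_right scaleR_diff_left)
      then have "norm V \<le> \<bar>p\<bar> * norm (mul (\<theta> + \<eta>) \<delta>) + \<bar>p - q\<bar>"
        using norm_triangle_ineq[of "p *\<^sub>R mul (\<theta> + \<eta>) \<delta>" "(p - q) *\<^sub>R mul \<eta> \<eta>"]
        by (simp add: norm_mul_self unit)
      ultimately show ?thesis by linarith
    qed
    define w where "w = x - y"
    have "\<bar>15 * (\<delta> \<bullet> w) + 3 * (V \<bullet> w)\<bar> \<le> 33 * norm \<delta> * norm w"
    proof -
      have "\<bar>\<delta> \<bullet> w\<bar> \<le> norm \<delta> * norm w" "\<bar>V \<bullet> w\<bar> \<le> norm V * norm w"
        by (rule Cauchy_Schwarz_ineq2)+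
      moreover have "norm V * norm w \<le> 6 * norm \<delta> * norm w"
        using V by (intro mult_right_mono) auto
      ultimately show ?thesis by (simp add: mult.assoc)
    qed
    then have "t * \<bar>15 * (\<delta> \<bullet> w) + 3 * (V \<bullet> w)\<bar> \<le> t * (33 * norm \<delta> * norm w)"
      using t by (rule mult_left_mono)
    also have "\<dots> = 33 / 8 * ((8 * t * norm \<delta>) * norm w)"
      by simp
    also have "(8 * t * norm \<delta>) * norm w \<le> 37 * c * norm w"
      using t\<delta> by (intro mult_right_mono) auto
    finally have 1: "- (33 / 8 * (37 * c * norm w)) \<le> t * (15 * (\<delta> \<bullet> w) + 3 * (V \<bullet> w))"
      using t by (simp add: abs_mult_pos' abs_le_iff)
    have 2: "8 * (t * (p - q)) * norm w \<le> 8 * (4 * c) * norm w"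
      using tr by (intro mult_right_mono) auto
    have "21 * (w \<bullet> w) \<le> (5 + 33 / 8 * 37 + 32) * c * norm w"
      using test[of w] 1 2
      unfolding \<theta>_def[symmetric] \<eta>_def[symmetric] p_def[symmetric] q_def[symmetric] V_def[symmetric]
        \<delta>_def[symmetric]
        w_def[symmetric]
      by (simp add: algebra_simps)
    then have "21 * (norm w * norm w) \<le> (5 + 33 / 8 * 37 + 32) * c * norm w"
      by (simp add: dot_square_norm power2_eq_square)
    then have "21 * norm w \<le> (5 + 33 / 8 * 37 + 32) * c"
      using \<open>0 \<le> c\<close> by (cases "w = 0") (auto simp: mult.assoc[symmetric])
    then show ?thesis
      using \<open>0 \<le> c\<close> by (simp add: w_def)
  qed
  have tr: "trace (H t y) - trace (H t x) \<le> 32 * c" if "x \<noteq> 0" "y \<noteq> 0" "form_le (H t x - H t y) c" for x y c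
    using H_trace_bound[OF that(1,2) t that(3)] by (simp add: trace_H algebra_simps)
  have double: "form_le (M - - M) (2 * c)" if "form_le M c" for M :: "real ^ 5 ^ 5" and c
  proof -
    have "form (M - - M) e = 2 * form M e" for e
      using form_diff[of e M "- M"] form_scaleR[of e "- 1" M] by simp
    then show ?thesis using that by (simp add: form_le_def)
  qed
  have H0: "H t 0 = 0"
    using H_minus[of t 0] by (simp add: vec_eq_iff)
  have tr0: "trace (0 :: real ^ 5 ^ 5) = 0"
    by (simp add: trace_def)
  \<comment> \<open>A zero base point reduces to the pair (x, - x): by oddness their Hessian
    difference is twice \<open>H t x\<close>.\<close>
  have one: "norm x \<le> 32 * c \<and> - trace (H t x) \<le> 32 * c" if "x \<noteq> 0" "form_le (H t x) c" for x c
  proof -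
    have "form_le (H t x - H t (- x)) (2 * c)"
      using double[OF that(2)] by (simp add: H_minus)
    from main[OF that(1) _ this] tr[OF that(1) _ this] that(1) show ?thesis
      by (simp add: trace_H sgn_minus cubic_minus flip: scaleR_2)
  qed
  have "norm (x - y) \<le> 32 * c \<and> trace (H t y) - trace (H t x) \<le> 32 * c"
  proof (cases "x = 0 \<or> y = 0")
    case False
    then show ?thesis using main tr le by blast
  next
    case True
    then consider "x = 0" "y = 0" | "x \<noteq> 0" "y = 0" | "x = 0" "y \<noteq> 0" by blast
    then show ?thesis
    proof cases
      case 1
      then show ?thesis using form_le_trace[OF le] by (simp add: trace_def)
    next
      case 2
      then show ?thesis using one[of x c] le tr0 by (simp add: H0 trace_H cubic_def mul_algebra)
    next
      case 3
      then show ?thesis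
        using one[of "- y" c] le trace_H[of t "- y"]
        by (simp add: H0 tr0 H_minus trace_H sgn_minus cubic_minus)
    qed
  qed
  then show "norm (x - y) \<le> 32 * c" and "trace (H t y) - trace (H t x) \<le> 32 * c"
    by simp_all
qed

subsection \<open>A compactly supported singular bump\<close>

text \<open>At the joint m = 1 the difference quotient of the truncation is dominated by that of f,
  which tends to 0.\<close>

lemma truncate_has_real_derivative:
  assumes deriv: "\<And>m. 0 < m \<Longrightarrow> (f has_real_derivative f' m) (at m)" and "f 1 = 0" "f' 1 = 0" and "0 < m"
  shows "((\<lambda>m. if m < 1 then f m else 0) has_real_derivative (if m < 1 then f' m else 0)) (at m)"
proof -
  consider "m < 1" | "1 < m" | "m = 1" by linarith
  then show ?thesis
  proof cases
    case 1
    have "((\<lambda>m. if m < 1 then f m else 0) has_real_derivative f' m) (at m)"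
      by (rule has_field_derivative_transform_within_open[OF deriv[OF \<open>0 < m\<close>], of "{..<1}"])
        (use 1 in auto)
    with 1 show ?thesis by simp
  next
    case 2
    have "((\<lambda>m. if m < 1 then f m else 0) has_real_derivative 0) (at m)"
      by (rule has_field_derivative_transform_within_open[OF DERIV_const, of "{1<..}"]) (use 2 in auto)
    with 2 show ?thesis by simp
  next
    case 3
    have "((\<lambda>h. (f (1 + h) - f 1) / h) \<longlongrightarrow> 0) (at 0)"
      using deriv[of 1] assms(3) by (simp add: DERIV_def)
    then have "((\<lambda>h. \<bar>f (1 + h) / h\<bar>) \<longlongrightarrow> 0) (at 0)"
      using tendsto_rabs[of _ 0] assms(2) by fastforce
    then have "((\<lambda>h. ((if 1 + h < 1 then f (1 + h) else 0) - 0) / h) \<longlongrightarrow> 0) (at 0)"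
      by (rule Lim_null_comparison[rotated]) (auto intro!: always_eventually)
    then show ?thesis
      using 3 by (simp add: DERIV_def)
  qed
qed

(* Subtracting the second order Taylor polynomial of 1 / sqrt m at m = 1 makes the truncation at
   m = 1 twice continuously differentiable. *)
definition tay :: "real \<Rightarrow> real" where "tay m = 1 - (m - 1) / 2 + 3 / 8 * (m - 1)\<^sup>2"
definition tay1 :: "real \<Rightarrow> real" where "tay1 m = - 1 / 2 + 3 / 4 * (m - 1)"

definition prof :: "real \<Rightarrow> real" where
  "prof m = (if m < 1 then 1 / sqrt m - tay m else 0)"
definition prof1 :: "real \<Rightarrow> real" where
  "prof1 m = (if m < 1 then - 1 / (2 * m * sqrt m) - tay1 m else 0)"
definition prof2 :: "real \<Rightarrow> real" where
  "prof2 m = (if m < 1 then 3 / (4 * m\<^sup>2 * sqrt m) - 3 / 4 else 0)"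

lemma prof_has_derivative:
  assumes "0 < m"
  shows "(prof has_real_derivative prof1 m) (at m)" "(prof1 has_real_derivative prof2 m) (at m)"
proof -
  show "(prof has_real_derivative prof1 m) (at m)"
    unfolding prof_def prof1_def
  proof (rule truncate_has_real_derivative[OF _ _ _ assms])
    fix m :: real assume "0 < m"
    then show "((\<lambda>m. 1 / sqrt m - tay m) has_real_derivative - 1 / (2 * m * sqrt m) - tay1 m) (at m)"
      unfolding tay_def tay1_def
      by (auto intro!: derivative_eq_intros simp: field_simps power2_eq_square)
  qed (auto simp: tay_def tay1_def)
  show "(prof1 has_real_derivative prof2 m) (at m)"
    unfolding prof1_def prof2_def
  proof (rule truncate_has_real_derivative[OF _ _ _ assms])
    fix m :: real assume m: "0 < m"
    have "((\<lambda>m. - 1 / (2 * m * sqrt m)) has_real_derivative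
        - ((- (2 * sqrt m) - inverse (sqrt m) * m) / ((2 * m * sqrt m) * (2 * m * sqrt m)))) (at m)"
      using m by (auto intro!: derivative_eq_intros)
    also have "- ((- (2 * sqrt m) - inverse (sqrt m) * m) / ((2 * m * sqrt m) * (2 * m * sqrt m)))
        = 3 / (4 * m\<^sup>2 * sqrt m)"
    proof -
      define r where "r = sqrt m"
      have "0 < r" "m = r * r" using m by (simp_all add: r_def)
      then show ?thesis unfolding r_def[symmetric] by (simp add: field_simps power2_eq_square)
    qed
    finally have "((\<lambda>m. - 1 / (2 * m * sqrt m)) has_real_derivative 3 / (4 * m\<^sup>2 * sqrt m)) (at m)" .
    moreover have "(tay1 has_real_derivative 3 / 4) (at m)"
      unfolding tay1_def by (auto intro!: derivative_eq_intros)
    ultimately show "((\<lambda>m. - 1 / (2 * m * sqrt m) - tay1 m) has_real_derivative 3 / (4 * m\<^sup>2 * sqrt m) -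
      3 / 4) (at m)"
      by (rule DERIV_diff)
  qed (auto simp: tay1_def)
qed

text \<open>For m > 0 the truncation is a maximum with 0, because 3 / (4 m^2 sqrt m) exceeds 3/4
  exactly when m < 1; so the joint requires no separate limit.\<close>

lemma isCont_prof2:
  assumes "0 < m"
  shows "isCont prof2 m"
proof -
  have "prof2 m = max 0 (3 / (4 * m\<^sup>2 * sqrt m) - 3 / 4)" if "0 < m" for m
  proof (cases "m < 1")
    case True
    then have "m\<^sup>2 * sqrt m \<le> 1 * 1"
      using that by (intro mult_mono) (auto simp: power_le_one)
    then show ?thesis using True that by (simp add: prof2_def field_simps)
  next
    case False
    then have "1 * 1 \<le> m\<^sup>2 * sqrt m"
      using that by (intro mult_mono) auto
    then show ?thesis using False that by (simp add: prof2_def field_simps)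
  qed
  then have "continuous_on {0<..} prof2 \<longleftrightarrow> continuous_on {0<..} (\<lambda>m. max 0 (3 / (4 * m\<^sup>2 * sqrt m) - 3 / 4))"
    by (intro continuous_on_cong) auto
  then have "continuous_on {0<..} prof2"
    by (auto intro!: continuous_intros)
  then show ?thesis
    using assms by (simp add: continuous_on_eq_continuous_at open_greaterThan)
qed

text \<open>The weights r, r^3, r^5 are those with which the three profiles enter the Hessian of the
  bump. For 0 < r < 1 each weighted profile is a polynomial in r divisible by 1 - r. The resulting
  linear decay at the boundary is what bounds the Hessian at a point of the ball by the distance to
  any point outside.\<close>

lemma prof_bounds:
  assumes "0 \<le> r"
  shows "r * \<bar>prof (r\<^sup>2)\<bar> \<le> 4 * max 0 (1 - r)" "r ^ 3 * \<bar>prof1 (r\<^sup>2)\<bar> \<le> 4 * max 0 (1 - r)"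
    "r ^ 5 * \<bar>prof2 (r\<^sup>2)\<bar> \<le> 4 * max 0 (1 - r)"
proof -
  consider "r = 0" | "1 \<le> r" | "0 < r" "r < 1" using assms by linarith
  then have "r * \<bar>prof (r\<^sup>2)\<bar> \<le> 4 * max 0 (1 - r) \<and> r ^ 3 * \<bar>prof1 (r\<^sup>2)\<bar> \<le> 4 * max 0 (1 - r) \<and>
    r ^ 5 * \<bar>prof2 (r\<^sup>2)\<bar> \<le> 4 * max 0 (1 - r)"
  proof cases
    case 2
    then have "\<not> r\<^sup>2 < 1" by (simp add: power2_less_1_iff)
    then show ?thesis by (simp add: prof_def prof1_def prof2_def)
  next
    case 3
    have r2: "r\<^sup>2 < 1" using 3 by (simp add: power_less_one_iff)
    have le: "r \<le> 1" "r\<^sup>2 \<le> 1" "r ^ 3 \<le> 1" "r ^ 4 \<le> 1" using 3 by (simp_all add: power_le_one)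
    have gen: "\<bar>a\<bar> \<le> (1 - r) * 4" if "a = (1 - r) * X" "\<bar>X\<bar> \<le> 4" for a X
      using mult_left_mono[OF that(2), of "1 - r"] 3 that(1) by (simp add: abs_mult)
    have "r * prof (r\<^sup>2) = (1 - r) * ((1 - r)\<^sup>2 * (1 + 9 / 8 * r + 3 / 8 * r\<^sup>2))"
      using 3 r2 by (simp add: prof_def tay_def field_simps power2_eq_square)
    moreover have "\<bar>(1 - r)\<^sup>2 * (1 + 9 / 8 * r + 3 / 8 * r\<^sup>2)\<bar> \<le> 4"
    proof -
      have "0 \<le> r\<^sup>2" by simp
      then have "\<bar>1 + 9 / 8 * r + 3 / 8 * r\<^sup>2\<bar> \<le> 4"
        using le 3 by linarith
      then have "\<bar>(1 - r)\<^sup>2\<bar> * \<bar>1 + 9 / 8 * r + 3 / 8 * r\<^sup>2\<bar> \<le> 1 * 4"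
        using 3 by (intro mult_mono) (auto simp: power_le_one)
      then show ?thesis by (simp add: abs_mult)
    qed
    ultimately have 1: "\<bar>r * prof (r\<^sup>2)\<bar> \<le> (1 - r) * 4" by (rule gen)
    have "r ^ 3 * prof1 (r\<^sup>2) = (1 - r) * (- ((1 - r) * (1 / 2 + r + 3 / 2 * r\<^sup>2 + 3 / 4 * r ^ 3)))"
      using 3 r2 by (simp add: prof1_def tay1_def field_simps power2_eq_square power3_eq_cube)
    moreover have "\<bar>- ((1 - r) * (1 / 2 + r + 3 / 2 * r\<^sup>2 + 3 / 4 * r ^ 3))\<bar> \<le> 4"
    proof -
      have "0 \<le> r\<^sup>2" "0 \<le> r ^ 3" using 3 by simp_all
      then have "\<bar>1 / 2 + r + 3 / 2 * r\<^sup>2 + 3 / 4 * r ^ 3\<bar> \<le> 4"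
        using le 3 by linarith
      then have "\<bar>1 - r\<bar> * \<bar>1 / 2 + r + 3 / 2 * r\<^sup>2 + 3 / 4 * r ^ 3\<bar> \<le> 1 * 4"
        using 3 by (intro mult_mono) auto
      then show ?thesis by (simp add: abs_mult)
    qed
    ultimately have 2: "\<bar>r ^ 3 * prof1 (r\<^sup>2)\<bar> \<le> (1 - r) * 4" by (rule gen)
    have "r ^ 5 * prof2 (r\<^sup>2) = (1 - r) * (3 / 4 * (1 + r + r\<^sup>2 + r ^ 3 + r ^ 4))"
      using 3 r2 by (simp add: prof2_def field_simps power_numeral_reduce)
    moreover have "\<bar>3 / 4 * (1 + r + r\<^sup>2 + r ^ 3 + r ^ 4)\<bar> \<le> 4"
    proof -
      have "0 \<le> r\<^sup>2" "0 \<le> r ^ 3" "0 \<le> r ^ 4" using 3 by simp_all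
      then have "0 \<le> 1 + r + r\<^sup>2 + r ^ 3 + r ^ 4" "1 + r + r\<^sup>2 + r ^ 3 + r ^ 4 \<le> 5"
        using le 3 by simp_all
      then show ?thesis by (simp only: abs_mult abs_of_nonneg) simp
    qed
    ultimately have "\<bar>r ^ 5 * prof2 (r\<^sup>2)\<bar> \<le> (1 - r) * 4" by (rule gen)
    with 1 2 3 show ?thesis
      by (simp add: abs_mult mult.commute)
  qed (simp add: prof_def prof1_def prof2_def)
  then show "r * \<bar>prof (r\<^sup>2)\<bar> \<le> 4 * max 0 (1 - r)" "r ^ 3 * \<bar>prof1 (r\<^sup>2)\<bar> \<le> 4 * max 0 (1 - r)"
    "r ^ 5 * \<bar>prof2 (r\<^sup>2)\<bar> \<le> 4 * max 0 (1 - r)"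
    by blast+
qed

section \<open>The bump and its first two derivatives\<close>

definition bump :: "real ^ 5 \<Rightarrow> real" where
  "bump y = cubic y * prof (y \<bullet> y)"

definition bump_grad :: "real ^ 5 \<Rightarrow> real ^ 5" where
  "bump_grad y = (3 * prof (y \<bullet> y)) *\<^sub>R mul y y + (2 * cubic y * prof1 (y \<bullet> y)) *\<^sub>R y"

definition bump_hess :: "real ^ 5 \<Rightarrow> real ^ 5 ^ 5" where
  "bump_hess y = radial_hessian (prof (y \<bullet> y)) (prof1 (y \<bullet> y)) (prof2 (y \<bullet> y)) y"

lemma cubic_has_derivative: "(cubic has_derivative (\<lambda>h. 3 * (mul y y \<bullet> h))) (at y)"
proof -
  have "((\<lambda>y. mul y y \<bullet> y) has_derivative (\<lambda>h. mul y y \<bullet> h + (mul y h + mul h y) \<bullet> y)) (at y)"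
    by (auto intro!: derivative_eq_intros bounded_bilinear.FDERIV[OF bounded_bilinear_mul])
  moreover have "mul y y \<bullet> h + (mul y h + mul h y) \<bullet> y = 3 * (mul y y \<bullet> h)" for h
    by (simp only: mul_commute[of h y] inner_add_left mul_inner[of y h y] inner_commute[of h])
  ultimately show ?thesis
    by (simp add: cubic_def[abs_def])
qed

lemma compose_inner_has_derivative:
  fixes y :: "'a :: real_inner"
  assumes "(f has_real_derivative f') (at (y \<bullet> y))"
  shows "((\<lambda>y. f (y \<bullet> y)) has_derivative (\<lambda>h. f' * (2 * (y \<bullet> h)))) (at y)"
proof -
  have "((\<lambda>y. y \<bullet> y) has_derivative (\<lambda>h. 2 * (y \<bullet> h))) (at y)"
    by (auto intro!: derivative_eq_intros simp: inner_commute)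
  from has_derivative_compose[OF this assms[unfolded has_field_derivative_def]]
  show ?thesis by simp
qed

lemma bump_has_derivative:
  assumes "y \<noteq> 0"
  shows "(bump has_derivative (\<lambda>h. bump_grad y \<bullet> h)) (at y)"
proof -
  have "0 < y \<bullet> y" using assms by simp
  note d = compose_inner_has_derivative[OF prof_has_derivative(1)[OF this]]
  have "(bump has_derivative (\<lambda>h. cubic y * (prof1 (y \<bullet> y) * (2 * (y \<bullet> h)))
    + 3 * (mul y y \<bullet> h) * prof (y \<bullet> y))) (at y)"
    unfolding bump_def[abs_def] by (rule has_derivative_mult[OF cubic_has_derivative d])
  then show ?thesis
    by (rule has_derivative_eq_rhs) (simp add: bump_grad_def inner_add_left fun_eq_iff)
qed

lemma bump_grad_has_derivative:
  assumes "y \<noteq> 0"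
  shows "(bump_grad has_derivative (\<lambda>h. bump_hess y *v h)) (at y)"
proof -
  have pos: "0 < y \<bullet> y" using assms by simp
  note d0 = compose_inner_has_derivative[OF prof_has_derivative(1)[OF pos]]
  note d1 = compose_inner_has_derivative[OF prof_has_derivative(2)[OF pos]]
  have m: "((\<lambda>y. mul y y) has_derivative (\<lambda>h. mul y h + mul h y)) (at y)"
    by (auto intro!: derivative_eq_intros bounded_bilinear.FDERIV[OF bounded_bilinear_mul])
  have d: "(bump_grad has_derivative (\<lambda>h.
      ((3 * prof (y \<bullet> y)) *\<^sub>R (mul y h + mul h y) + (3 * (prof1 (y \<bullet> y) * (2 * (y \<bullet> h)))) *\<^sub>R mul y y)
      + ((2 * cubic y * prof1 (y \<bullet> y)) *\<^sub>R h
         + ((2 * cubic y) * (prof2 (y \<bullet> y) * (2 * (y \<bullet> h))) + (2 * (3 * (mul y y \<bullet> h))) * prof1 (y \<bullet> y))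
           *\<^sub>R y))) (at y)"
    unfolding bump_grad_def[abs_def]
    by (intro has_derivative_add has_derivative_scaleR has_derivative_mult_right has_derivative_mult m d0 d1
        cubic_has_derivative has_derivative_ident)
  have hess: "bump_hess y *v h = (6 * prof (y \<bullet> y)) *\<^sub>R mul y h
       + (6 * prof1 (y \<bullet> y)) *\<^sub>R ((mul y y \<bullet> h) *\<^sub>R y + (y \<bullet> h) *\<^sub>R mul y y)
       + (2 * prof1 (y \<bullet> y) * cubic y) *\<^sub>R h + (4 * prof2 (y \<bullet> y) * cubic y) *\<^sub>R ((y \<bullet> h) *\<^sub>R y)" for h
    by (simp add: bump_hess_def radial_hessian_def matrix_vector_mult_add_rdistrib L_mult_vec outer_mult_vec
        flip: scaleR_matrix_vector_assoc)
  show ?thesis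
    by (rule has_derivative_eq_rhs[OF d]) (simp add: fun_eq_iff hess vec_eq_iff mul_commute algebra_simps)
qed

lemma bump_eq_0:
  assumes "1 \<le> norm y"
  shows "bump y = 0" "bump_grad y = 0" "bump_hess y = 0"
proof -
  have "\<not> y \<bullet> y < 1"
    using assms by (simp add: dot_square_norm power2_less_1_iff)
  then show "bump y = 0" "bump_grad y = 0" "bump_hess y = 0"
    by (simp_all add: bump_def bump_grad_def bump_hess_def prof_def prof1_def prof2_def radial_hessian_def)
qed

lemma bump_0: "bump 0 = 0" "bump_grad 0 = 0"
  by (simp_all add: bump_def bump_grad_def cubic_def mul_algebra)

lemma bump_minus: "bump (- y) = - bump y"
  by (simp add: bump_def cubic_minus)

lemma bump_le: "\<bar>bump y\<bar> \<le> 4 * (norm y)\<^sup>2"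
proof -
  define r where "r = norm y"
  have "\<bar>bump y\<bar> \<le> r ^ 3 * \<bar>prof (r\<^sup>2)\<bar>"
    unfolding bump_def abs_mult r_def dot_square_norm using cubic_le[of y] by (intro mult_right_mono) auto
  also have "\<dots> = r\<^sup>2 * (r * \<bar>prof (r\<^sup>2)\<bar>)"
    by (simp add: power2_eq_square power3_eq_cube)
  also have "\<dots> \<le> r\<^sup>2 * 4"
  proof (rule mult_left_mono)
    have "4 * max 0 (1 - r) \<le> 4" by (simp add: r_def)
    then show "r * \<bar>prof (r\<^sup>2)\<bar> \<le> 4"
      using prof_bounds(1)[of r] by (smt (verit) r_def norm_ge_zero)
  qed simp
  finally show ?thesis by (simp add: r_def)
qed

lemma bump_grad_le: "norm (bump_grad y) \<le> 20 * norm y"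
proof -
  define r where "r = norm y"
  have "0 \<le> r" by (simp add: r_def)
  have b: "r * \<bar>prof (r\<^sup>2)\<bar> \<le> 4" "r ^ 3 * \<bar>prof1 (r\<^sup>2)\<bar> \<le> 4"
    using prof_bounds[OF \<open>0 \<le> r\<close>] \<open>0 \<le> r\<close> by (smt (verit))+
  have "norm (bump_grad y) \<le> 3 * \<bar>prof (r\<^sup>2)\<bar> * r\<^sup>2 + 2 * \<bar>cubic y\<bar> * \<bar>prof1 (r\<^sup>2)\<bar> * r"
    unfolding bump_grad_def by (rule order_trans[OF norm_triangle_ineq]) (simp add: norm_mul_self r_def
      dot_square_norm abs_mult)
  also have "\<dots> \<le> 3 * \<bar>prof (r\<^sup>2)\<bar> * r\<^sup>2 + 2 * r ^ 3 * \<bar>prof1 (r\<^sup>2)\<bar> * r"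
    using cubic_le[of y] by (intro add_mono mult_mono) (auto simp: r_def)
  also have "\<dots> = r * (3 * (r * \<bar>prof (r\<^sup>2)\<bar>) + 2 * (r ^ 3 * \<bar>prof1 (r\<^sup>2)\<bar>))"
    by (simp add: power2_eq_square algebra_simps)
  also have "\<dots> \<le> r * 20"
    using b \<open>0 \<le> r\<close> by (intro mult_left_mono) auto
  finally show ?thesis by (simp add: r_def)
qed

lemma bump_hess_le: "norm (bump_hess y *v h) \<le> 96 * max 0 (1 - norm y) * norm h"
proof -
  define r where "r = norm y"
  have "0 \<le> r" by (simp add: r_def)
  have tri: "norm (a + (b + c) + d + e) \<le> norm a + (norm b + norm c) + norm d + norm e"
    for a b c d e :: "real ^ 5"
    by (intro order_trans[OF norm_triangle_ineq] add_mono order_refl)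
  have "bump_hess y *v h = (6 * prof (r\<^sup>2)) *\<^sub>R mul y h
       + ((6 * prof1 (r\<^sup>2) * (mul y y \<bullet> h)) *\<^sub>R y + (6 * prof1 (r\<^sup>2) * (y \<bullet> h)) *\<^sub>R mul y y)
       + (2 * prof1 (r\<^sup>2) * cubic y) *\<^sub>R h + (4 * prof2 (r\<^sup>2) * cubic y * (y \<bullet> h)) *\<^sub>R y"
    by (simp add: r_def dot_square_norm[symmetric] bump_hess_def radial_hessian_def
      matrix_vector_mult_add_rdistrib
        L_mult_vec outer_mult_vec scaleR_add_right flip: scaleR_matrix_vector_assoc)
  then have "norm (bump_hess y *v h) \<le> norm ((6 * prof (r\<^sup>2)) *\<^sub>R mul y h)
     + (norm ((6 * prof1 (r\<^sup>2) * (mul y y \<bullet> h)) *\<^sub>R y) + norm ((6 * prof1 (r\<^sup>2) * (y \<bullet> h)) *\<^sub>R mul y y))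
         + norm ((2 * prof1 (r\<^sup>2) * cubic y) *\<^sub>R h) + norm ((4 * prof2 (r\<^sup>2) * cubic y * (y \<bullet> h)) *\<^sub>R y)"
    using tri by metis
  also have "\<dots> = 6 * \<bar>prof (r\<^sup>2)\<bar> * norm (mul y h)
     + (6 * \<bar>prof1 (r\<^sup>2)\<bar> * r * \<bar>mul y y \<bullet> h\<bar> + 6 * \<bar>prof1 (r\<^sup>2)\<bar> * r\<^sup>2 * \<bar>y \<bullet> h\<bar>)
     + 2 * \<bar>prof1 (r\<^sup>2)\<bar> * norm h * \<bar>cubic y\<bar> + 4 * \<bar>prof2 (r\<^sup>2)\<bar> * r * (\<bar>cubic y\<bar> * \<bar>y \<bullet> h\<bar>)"
    by (simp add: abs_mult norm_mul_self r_def)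
  also have "\<dots> \<le> 6 * \<bar>prof (r\<^sup>2)\<bar> * (r * norm h)
     + (6 * \<bar>prof1 (r\<^sup>2)\<bar> * r * (r\<^sup>2 * norm h) + 6 * \<bar>prof1 (r\<^sup>2)\<bar> * r\<^sup>2 * (r * norm h))
     + 2 * \<bar>prof1 (r\<^sup>2)\<bar> * norm h * r ^ 3 + 4 * \<bar>prof2 (r\<^sup>2)\<bar> * r * (r ^ 3 * (r * norm h))"
  proof -
    have "norm (mul y h) \<le> r * norm h" "\<bar>mul y y \<bullet> h\<bar> \<le> r\<^sup>2 * norm h" "\<bar>y \<bullet> h\<bar> \<le> r * norm h" "\<bar>cubic y\<bar>
      \<le> r ^ 3"
      using cubic_le[of y] norm_mul_le[of y h] Cauchy_Schwarz_ineq2[of "mul y y" h]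
        Cauchy_Schwarz_ineq2[of y h]
      by (simp_all add: r_def norm_mul_self)
    moreover from this(3,4) have "\<bar>cubic y\<bar> * \<bar>y \<bullet> h\<bar> \<le> r ^ 3 * (r * norm h)"
      using \<open>0 \<le> r\<close> by (intro mult_mono) auto
    ultimately show ?thesis
      using \<open>0 \<le> r\<close> by (intro add_mono mult_left_mono) auto
  qed
  also have "\<dots> = (6 * (r * \<bar>prof (r\<^sup>2)\<bar>) + 14 * (r ^ 3 * \<bar>prof1 (r\<^sup>2)\<bar>)
    + 4 * (r ^ 5 * \<bar>prof2 (r\<^sup>2)\<bar>)) * norm h"
    by (simp add: power_numeral_reduce algebra_simps)
  also have "\<dots> \<le> (96 * max 0 (1 - r)) * norm h"
    using prof_bounds[OF \<open>0 \<le> r\<close>] by (intro mult_right_mono) auto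
  finally show ?thesis by (simp add: r_def)
qed

text \<open>The mean value estimate applies only to segments avoiding the origin. If the segment
  contains it, then |x - y| = |x| + |y| and the linear growth of the gradient suffices.\<close>

lemma bump_grad_lipschitz: "norm (bump_grad x - bump_grad y) \<le> 96 * norm (x - y)"
proof (cases "0 \<in> closed_segment x y")
  case True
  then have "dist x y = dist x 0 + dist 0 y"
    unfolding between_mem_segment[symmetric] between .
  then have "norm (x - y) = norm x + norm y" by (simp add: dist_norm)
  moreover have "norm (bump_grad x - bump_grad y) \<le> norm (bump_grad x) + norm (bump_grad y)"
    by (rule norm_triangle_ineq4)
  moreover have "0 \<le> norm x" "0 \<le> norm y" by simp_all
  ultimately show ?thesis
    using bump_grad_le[of x] bump_grad_le[of y] by linarith
next
  case False
  show ?thesis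
  proof (rule differentiable_bound[where S="closed_segment x y" and f'="\<lambda>z h. bump_hess z *v h"])
    fix z assume "z \<in> closed_segment x y"
    then have "z \<noteq> 0" using False by auto
    then show "(bump_grad has_derivative (*v) (bump_hess z)) (at z within closed_segment x y)"
      by (rule has_derivative_at_withinI[OF bump_grad_has_derivative])
    show "onorm ((*v) (bump_hess z)) \<le> 96"
    proof (rule onorm_le)
      fix h :: "real ^ 5"
      have "96 * max 0 (1 - norm z) * norm h \<le> 96 * norm h"
        by (intro mult_right_mono) auto
      then show "norm (bump_hess z *v h) \<le> 96 * norm h"
        using bump_hess_le[of z h] by linarith
    qed
  qed auto
qed

lemma isCont_bump_hess:
  assumes "y \<noteq> 0"
  shows "isCont bump_hess y"
proof -
  have pos: "0 < y \<bullet> y" using assms by simp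
  have lin: "isCont (\<lambda>y. mul y (e y)) y" if "isCont e y" for e
    using that unfolding isCont_def by (intro bounded_bilinear.tendsto[OF bounded_bilinear_mul]
      tendsto_ident_at)
  have c: "isCont (\<lambda>y. prof (y \<bullet> y)) y" "isCont (\<lambda>y. prof1 (y \<bullet> y)) y" "isCont (\<lambda>y. prof2 (y \<bullet> y)) y"
    using prof_has_derivative[OF pos, THEN DERIV_isCont] isCont_prof2[OF pos]
    by (auto intro!: isCont_o2[of y "\<lambda>y. y \<bullet> y"] continuous_intros)
  have cc: "isCont cubic y"
    using cubic_has_derivative has_derivative_continuous by blast
  have "isCont (\<lambda>y. bump_hess y $ i $ j) y" for i j
    using c cc unfolding bump_hess_def radial_hessian_def isCont_def
    by (cases "i = j") (auto simp: L_nth outer_def mat_def intro!: tendsto_intros lin[unfolded isCont_def])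
  then show ?thesis
    by (simp add: isCont_def vec_tendstoI)
qed

section \<open>The polynomial part of the bump Hessian\<close>

definition taylor_hess :: "real ^ 5 \<Rightarrow> real ^ 5 ^ 5" where
  "taylor_hess y = radial_hessian (tay (y \<bullet> y)) (tay1 (y \<bullet> y)) (3 / 4) y"

text \<open>Inside the ball the bump is \<open>cubic y / norm y\<close> minus a polynomial, and the
  second derivatives split accordingly. At the origin all three terms are 0, for \<open>W\<close>
  because \<open>sgn 0 = 0\<close>.\<close>

lemma bump_hess_eq:
  assumes "norm y < 1"
  shows "bump_hess y = W y - taylor_hess y"
proof (cases "y = 0")
  case True
  have "radial_hessian a b c 0 = 0" for a b c
    by (simp add: radial_hessian_def cubic_def mul_algebra vec_eq_iff L_nth outer_def)
  with True show ?thesis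
    by (simp add: bump_hess_def W_def taylor_hess_def)
next
  case False
  define r where "r = norm y"
  have r: "0 < r" "r < 1" using False assms by (simp_all add: r_def)
  have yy: "y \<bullet> y = r\<^sup>2" by (simp add: r_def dot_square_norm)
  have "r\<^sup>2 < 1" using r by (simp add: power_less_one_iff)
  then have p: "prof (y \<bullet> y) = inverse r - tay (y \<bullet> y)" "prof1 (y \<bullet> y)
    = - 1 / 2 * inverse r ^ 3 - tay1 (y \<bullet> y)"
    "prof2 (y \<bullet> y) = 3 / 4 * inverse r ^ 5 - 3 / 4"
    using r by (simp_all add: yy prof_def prof1_def prof2_def field_simps power_numeral_reduce)
  have "W y = radial_hessian 1 (- 1 / 2) (3 / 4) (inverse r *\<^sub>R y)"
    by (simp add: W_def sgn_div_norm r_def)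
  then have W: "W y = radial_hessian (inverse r) (- 1 / 2 * inverse r ^ 3) (3 / 4 * inverse r ^ 5) y"
    by (simp add: radial_hessian_scaleR)
  have diff: "radial_hessian (a - a') (b - b') (c - c') y = radial_hessian a b c y - radial_hessian a' b'
    c' y" for a b c a' b' c'
    by (simp add: radial_hessian_def algebra_simps)
  show ?thesis
    unfolding bump_hess_def p diff W taylor_hess_def by simp
qed

text \<open>Recording the bound together with the Lipschitz constant makes the class closed under
  products, so that it contains the polynomial entries of \<open>taylor_hess\<close>.\<close>

definition bounded_lipschitz :: "(real ^ 5 \<Rightarrow> real) \<Rightarrow> bool" where
  "bounded_lipschitz f \<longleftrightarrow>
     (\<exists>C. \<forall>x\<in>cball 0 1. \<forall>y\<in>cball 0 1. \<bar>f x\<bar> \<le> C \<and> \<bar>f x - f y\<bar> \<le> C * norm (x - y))"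

lemma bounded_lipschitz_const: "bounded_lipschitz (\<lambda>x. c)"
  unfolding bounded_lipschitz_def by (intro exI[of _ "\<bar>c\<bar>"]) auto

lemma bounded_lipschitz_linear:
  assumes "linear f"
  shows "bounded_lipschitz f"
proof -
  obtain B where B: "0 < B" "\<And>x. norm (f x) \<le> B * norm x"
    using linear_bounded_pos[OF assms] by blast
  have "\<bar>f x\<bar> \<le> B \<and> \<bar>f x - f y\<bar> \<le> B * norm (x - y)" if "norm x \<le> 1" for x y
  proof
    have "B * norm x \<le> B * 1" using B(1) that by (intro mult_left_mono) auto
    then show "\<bar>f x\<bar> \<le> B" using B(2)[of x] by simp
    show "\<bar>f x - f y\<bar> \<le> B * norm (x - y)"
      using B(2)[of "x - y"] by (simp add: linear_diff[OF assms])
  qed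
  then show ?thesis
    unfolding bounded_lipschitz_def by (intro exI[of _ B]) auto
qed

lemma bounded_lipschitz_add:
  assumes "bounded_lipschitz f" "bounded_lipschitz g"
  shows "bounded_lipschitz (\<lambda>x. f x + g x)"
proof -
  obtain C D where "\<forall>x\<in>cball 0 1. \<forall>y\<in>cball 0 1. \<bar>f x\<bar> \<le> C \<and> \<bar>f x - f y\<bar> \<le> C * norm (x - y)"
    "\<forall>x\<in>cball 0 1. \<forall>y\<in>cball 0 1. \<bar>g x\<bar> \<le> D \<and> \<bar>g x - g y\<bar> \<le> D * norm (x - y)"
    using assms unfolding bounded_lipschitz_def by blast
  then show ?thesis
    unfolding bounded_lipschitz_def by (intro exI[of _ "C + D"]) (smt (verit) distrib_right)
qed

lemma bounded_lipschitz_mult: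
  assumes "bounded_lipschitz f" "bounded_lipschitz g"
  shows "bounded_lipschitz (\<lambda>x. f x * g x)"
proof -
  obtain C D where C: "\<And>x y. x \<in> cball 0 1 \<Longrightarrow> y \<in> cball 0 1 \<Longrightarrow> \<bar>f x\<bar> \<le> C \<and> \<bar>f x - f y\<bar> \<le> C * norm (x - y)"
    and D: "\<And>x y. x \<in> cball 0 1 \<Longrightarrow> y \<in> cball 0 1 \<Longrightarrow> \<bar>g x\<bar> \<le> D \<and> \<bar>g x - g y\<bar> \<le> D * norm (x - y)"
    using assms unfolding bounded_lipschitz_def by blast
  have "0 \<le> C" "0 \<le> D"
    using C[of 0 0] D[of 0 0] by auto
  have "\<bar>f x * g x\<bar> \<le> 2 * C * D \<and> \<bar>f x * g x - f y * g y\<bar> \<le> 2 * C * D * norm (x - y)"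
    if xy: "x \<in> cball 0 1" "y \<in> cball 0 1" for x y
  proof
    have "\<bar>f x\<bar> * \<bar>g x\<bar> \<le> C * D"
      using C[OF xy] D[OF xy] \<open>0 \<le> C\<close> by (intro mult_mono) auto
    moreover have "0 \<le> C * D" using \<open>0 \<le> C\<close> \<open>0 \<le> D\<close> by simp
    ultimately show "\<bar>f x * g x\<bar> \<le> 2 * C * D" by (simp add: abs_mult)
    have "\<bar>f x * g x - f y * g y\<bar> = \<bar>f x * (g x - g y) + (f x - f y) * g y\<bar>"
      by (simp add: algebra_simps)
    also have "\<dots> \<le> \<bar>f x\<bar> * \<bar>g x - g y\<bar> + \<bar>f x - f y\<bar> * \<bar>g y\<bar>"
      by (metis abs_mult abs_triangle_ineq)
    also have "\<dots> \<le> C * (D * norm (x - y)) + (C * norm (x - y)) * D"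
      using C[OF xy] D[OF xy] D[OF xy(2) xy(1)] \<open>0 \<le> C\<close> by (intro add_mono mult_mono) auto
    finally show "\<bar>f x * g x - f y * g y\<bar> \<le> 2 * C * D * norm (x - y)"
      by (simp add: algebra_simps)
  qed
  then show ?thesis
    unfolding bounded_lipschitz_def by blast
qed

lemma bounded_lipschitz_taylor_hess: "bounded_lipschitz (\<lambda>y. taylor_hess y $ i $ j)"
proof -
  note bl = bounded_lipschitz_const bounded_lipschitz_add bounded_lipschitz_mult
  have nth: "bounded_lipschitz (\<lambda>y. y $ i)" for i
    by (rule bounded_lipschitz_linear) (auto intro!: linearI)
  have mul: "bounded_lipschitz (\<lambda>y. mul y y $ i)" for i
  proof -
    have "linear (\<lambda>y. mul y (axis i 1) $ k)" for k
      using bilinear_mul by (auto intro!: linearI simp: mul_algebra)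
    moreover have "mul y y $ i = (\<Sum>k\<in>UNIV. y $ k * mul y (axis i 1) $ k)" for y
    proof -
      have "mul y y $ i = mul y y \<bullet> axis i 1" by (simp add: inner_axis)
      also have "\<dots> = y \<bullet> mul y (axis i 1)" by (rule mul_inner)
      finally show ?thesis by (simp add: inner_vec_def)
    qed
    ultimately show ?thesis
      by (simp add: sum_5 bl nth bounded_lipschitz_linear)
  qed
  have lin: "bounded_lipschitz (\<lambda>y. L y $ i $ j)" for i j
    by (rule bounded_lipschitz_linear) (auto intro!: linearI simp: L_nth mul_algebra)
  have dot: "bounded_lipschitz (\<lambda>y. y \<bullet> y)"
    unfolding inner_5 by (intro bl nth)
  have cub: "bounded_lipschitz cubic"
    unfolding cubic_def[abs_def] inner_5 by (intro bl nth mul)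
  have "bounded_lipschitz (\<lambda>y. (6 * (1 + (- 1 / 2) * (y \<bullet> y + - 1) + 3 / 8 * ((y \<bullet> y + - 1) * (y \<bullet> y
    + - 1)))) * L y $ i $ j
      + (6 * (- 1 / 2 + 3 / 4 * (y \<bullet> y + - 1))) * (y $ i * mul y y $ j + mul y y $ i * y $ j)
      + (2 * (- 1 / 2 + 3 / 4 * (y \<bullet> y + - 1))) * cubic y * (mat 1 :: real ^ 5 ^ 5) $ i $ j
      + 3 * cubic y * (y $ i * y $ j))"
    by (intro bl nth mul lin dot cub)
  moreover have "taylor_hess y $ i $ j = (6 * (1 + (- 1 / 2) * (y \<bullet> y + - 1) + 3 / 8 * ((y \<bullet> y
    + - 1) * (y \<bullet> y + - 1)))) * L y $ i $ j
      + (6 * (- 1 / 2 + 3 / 4 * (y \<bullet> y + - 1))) * (y $ i * mul y y $ j + mul y y $ i * y $ j)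
      + (2 * (- 1 / 2 + 3 / 4 * (y \<bullet> y + - 1))) * cubic y * (mat 1 :: real ^ 5 ^ 5) $ i $ j
      + 3 * cubic y * (y $ i * y $ j)" for y
    by (simp add: taylor_hess_def radial_hessian_def outer_def tay_def tay1_def power2_eq_square)
  ultimately show ?thesis by simp
qed

lemma form_le_entries:
  fixes A :: "real ^ 5 ^ 5"
  assumes "\<And>i j. \<bar>A $ i $ j\<bar> \<le> C"
  shows "\<bar>form A e\<bar> \<le> 25 * C * (e \<bullet> e)"
proof -
  have "0 \<le> C" using assms[of 1 1] by linarith
  have le: "\<bar>e $ i * (A $ i $ j * e $ j)\<bar> \<le> C * (e \<bullet> e)" for i j
  proof -
    have "\<bar>e $ i\<bar> * \<bar>e $ j\<bar> \<le> norm e * norm e"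
      by (intro mult_mono) (auto simp: component_le_norm_cart)
    then have "\<bar>A $ i $ j\<bar> * (\<bar>e $ i\<bar> * \<bar>e $ j\<bar>) \<le> C * (norm e * norm e)"
      by (rule mult_mono[OF assms _ \<open>0 \<le> C\<close>]) simp
    then show ?thesis
      by (simp add: abs_mult dot_square_norm power2_eq_square mult_ac)
  qed
  have "form A e = (\<Sum>i\<in>UNIV. \<Sum>j\<in>UNIV. e $ i * (A $ i $ j * e $ j))"
    by (simp add: inner_vec_def matrix_vector_mult_def sum_distrib_left)
  also have "\<bar>\<dots>\<bar> \<le> (\<Sum>i\<in>(UNIV :: 5 set). \<Sum>j\<in>(UNIV :: 5 set). C * (e \<bullet> e))"
    by (intro order_trans[OF sum_abs] sum_mono) (intro order_trans[OF sum_abs] sum_mono le)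
  finally show ?thesis by simp
qed

lemma taylor_hess_lipschitz:
  obtains C where "0 \<le> C" "\<And>x y e. norm x \<le> 1 \<Longrightarrow> norm y \<le> 1 \<Longrightarrow>
    \<bar>form (taylor_hess x - taylor_hess y) e\<bar> \<le> C * norm (x - y) * (e \<bullet> e)"
proof -
  have "\<forall>i j. \<exists>C. \<forall>x\<in>cball 0 1. \<forall>y\<in>cball 0 1. \<bar>taylor_hess x $ i $ j - taylor_hess y $ i $ j\<bar>
    \<le> C * norm (x - y)"
    using bounded_lipschitz_taylor_hess unfolding bounded_lipschitz_def by blast
  then obtain D where D: "\<And>i j x y. x \<in> cball 0 1 \<Longrightarrow> y \<in> cball 0 1 \<Longrightarrow>
      \<bar>taylor_hess x $ i $ j - taylor_hess y $ i $ j\<bar> \<le> D i j * norm (x - y)"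
    by metis
  define C where "C = (\<Sum>i\<in>UNIV. \<Sum>j\<in>UNIV. \<bar>D i j\<bar>)"
  have DC: "D i j \<le> C" for i j
  proof -
    have "D i j \<le> \<bar>D i j\<bar>" by simp
    also have "\<dots> \<le> (\<Sum>j\<in>UNIV. \<bar>D i j\<bar>)" by (intro member_le_sum) auto
    also have "\<dots> \<le> C" unfolding C_def by (rule member_le_sum) (auto intro: sum_nonneg)
    finally show ?thesis .
  qed
  show ?thesis
  proof
    show "0 \<le> 25 * C" by (simp add: C_def sum_nonneg)
    fix x y e :: "real ^ 5" assume xy: "norm x \<le> 1" "norm y \<le> 1"
    have "\<bar>(taylor_hess x - taylor_hess y) $ i $ j\<bar> \<le> C * norm (x - y)" for i j
      using D[of x y i j] xy mult_right_mono[OF DC[of i j], of "norm (x - y)"] by simp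
    from form_le_entries[OF this] show "\<bar>form (taylor_hess x - taylor_hess y) e\<bar>
      \<le> 25 * C * norm (x - y) * (e \<bullet> e)"
      by (simp add: mult.assoc)
  qed
qed

subsection \<open>Uniformly elliptic operators vanishing on a prescribed set\<close>

definition min_form :: "real ^ 'n ^ 'n \<Rightarrow> real" where
  "min_form M = (INF e\<in>sphere 0 1. form M e)"

lemma sphere_nonempty: "sphere (0 :: real ^ 'n) 1 \<noteq> {}"
  by simp

lemma continuous_on_form: "continuous_on S (form M)"
  by (intro continuous_intros linear_continuous_on matrix_vector_mul_bounded_linear)

lemma bdd_below_form: "bdd_below (form M ` sphere 0 1)"
  by (intro bounded_imp_bdd_below compact_imp_bounded compact_continuous_image continuous_on_form
    compact_sphere)

lemma bdd_above_form: "bdd_above (form M ` sphere 0 1)"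
  by (intro bounded_imp_bdd_above compact_imp_bounded compact_continuous_image continuous_on_form
    compact_sphere)

lemma min_form_le: "norm e = 1 \<Longrightarrow> min_form M \<le> form M e"
  unfolding min_form_def by (rule cINF_lower[OF bdd_below_form]) simp

lemma min_form_ge: "(\<And>e. norm e = 1 \<Longrightarrow> c \<le> form M e) \<Longrightarrow> c \<le> min_form M"
  unfolding min_form_def by (rule cINF_greatest[OF sphere_nonempty]) simp

lemma form_ge_min_form: "min_form M * (e \<bullet> e) \<le> form M e"
proof (cases "e = 0")
  case False
  have "min_form M \<le> form M (sgn e)"
    using False by (intro min_form_le) (simp add: norm_sgn)
  also have "form M (sgn e) = form M e / (norm e)\<^sup>2"
    by (simp add: sgn_div_norm matrix_vector_mult_scaleR power2_eq_square divide_inverse mult_ac)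
  finally show ?thesis
    using False by (simp add: dot_square_norm field_simps)
qed simp

lemma trace_mono:
  assumes "\<And>e. form M e \<le> form N e"
  shows "trace M \<le> trace N"
  unfolding trace_def by (intro sum_mono) (use assms[of "axis _ 1"] in \<open>simp add: form_axis\<close>)

text \<open>\<open>N\<close> is paired with the projection \<open>mat 1 - outer e e\<close>, which
  is positive semidefinite by Cauchy-Schwarz; the pairing equals
  \<open>trace N - form N e\<close>.\<close>

lemma form_le_nonneg_trace:
  fixes N :: "real ^ 'n ^ 'n"
  assumes "nonneg_matrix N" "norm e = 1"
  shows "form N e \<le> trace N"
proof -
  have "0 \<le> trace (N ** (mat 1 - outer e e))"
  proof (rule trace_mult_psd_nonneg)
    show "0 \<le> form N v" for v
      using assms(1) by (simp add: nonneg_matrix_def)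
    show "transpose (mat 1 - outer e e) = mat 1 - outer e e"
      by (simp add: transpose_def mat_def outer_def vec_eq_iff)
    show "0 \<le> form (mat 1 - outer e e) v" for v
      using Cauchy_Schwarz_ineq[of e v] assms(2)
      by (simp add: form_diff form_outer power2_eq_square dot_square_norm)
  qed
  then show ?thesis
    by (simp add: matrix_mult_diff trace_sub trace_mult_outer)
qed

(* F M is the supremum over i of (least eigenvalue of M - A i) + \<epsilon> * trace (M - A i); the hypothesis
   says exactly that the i-th term is nonpositive at every A j. *)
lemma elliptic_operator_exists:
  fixes A :: "'i \<Rightarrow> real ^ 'n ^ 'n"
  assumes "I \<noteq> {}" "0 < \<epsilon>"
    and hyp: "\<And>i j c. i \<in> I \<Longrightarrow> j \<in> I \<Longrightarrow> form_le (A i - A j) c \<Longrightarrow> \<epsilon> * (trace (A j) - trace (A i)) \<le> c"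
  obtains F where "uniformly_elliptic F"
    "\<And>i M. i \<in> I \<Longrightarrow> (\<And>e. form (A i) e \<le> form M e) \<Longrightarrow> 0 \<le> F M"
    "\<And>i M. i \<in> I \<Longrightarrow> (\<And>e. form M e \<le> form (A i) e) \<Longrightarrow> F M \<le> 0"
proof -
  define g where "g M = min_form M + \<epsilon> * trace M" for M :: "real ^ 'n ^ 'n"
  define F where "F M = (SUP i\<in>I. g (M - A i))" for M
  have neg: "g (A j - A i) \<le> 0" if "i \<in> I" "j \<in> I" for i j
  proof -
    have "form_le (A i - A j) (- min_form (A j - A i))"
      using form_ge_min_form[of "A j - A i"] by (simp add: form_le_def form_diff algebra_simps)
    from hyp[OF that this] show ?thesis
      by (simp add: g_def trace_sub)
  qed
  have mono: "g M \<le> g N" if "\<And>e. form M e \<le> form N e" for M N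
  proof -
    have "min_form M \<le> min_form N"
      by (rule min_form_ge) (rule order_trans[OF min_form_le that])
    then show ?thesis
      using trace_mono[OF that] assms(2) by (simp add: g_def add_mono)
  qed
  \<comment> \<open>Finiteness of the supremum: passing from M to a fixed A k raises the least
    eigenvalue bound by at most a constant B independent of i, and at A k every term is nonpositive
    by \<open>neg\<close>.\<close>
  have bdd: "bdd_above ((\<lambda>i. g (M - A i)) ` I)" for M
  proof -
    obtain k where k: "k \<in> I" using assms(1) by blast
    obtain B where B: "\<And>e. norm e = 1 \<Longrightarrow> form (M - A k) e \<le> B"
      using bdd_above_form[of "M - A k"] unfolding bdd_above_def by (metis imageI mem_sphere_0)
    have "g (M - A i) \<le> B + \<epsilon> * trace (M - A k)" if "i \<in> I" for i
    proof -
      have "min_form (M - A i) - B \<le> min_form (A k - A i)"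
      proof (rule min_form_ge)
        fix e :: "real ^ 'n" assume e: "norm e = 1"
        show "min_form (M - A i) - B \<le> form (A k - A i) e"
          using min_form_le[OF e, of "M - A i"] B[OF e] by (simp add: form_diff)
      qed
      then show ?thesis
        using neg[OF that k] by (simp add: g_def trace_sub algebra_simps)
    qed
    then show ?thesis unfolding bdd_above_def by blast
  qed
  have F_mono: "F M \<le> F N" if "\<And>e. form M e \<le> form N e" for M N
    unfolding F_def[of M]
  proof (rule cSUP_least[OF assms(1)])
    fix i assume "i \<in> I"
    have "g (M - A i) \<le> g (N - A i)"
      by (rule mono) (simp add: form_diff that)
    also have "\<dots> \<le> F N"
      unfolding F_def by (rule cSUP_upper[OF \<open>i \<in> I\<close> bdd])
    finally show "g (M - A i) \<le> F N" .
  qed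
  have F_A: "F (A j) = 0" if "j \<in> I" for j
  proof (rule antisym)
    show "F (A j) \<le> 0"
      unfolding F_def using assms(1) by (rule cSUP_least) (rule neg[OF _ that])
    have "0 \<le> g (A j - A j)"
      using min_form_ge[of 0 "0 :: real ^ 'n ^ 'n"] by (simp add: g_def trace_def)
    also have "\<dots> \<le> F (A j)"
      unfolding F_def by (rule cSUP_upper[OF that bdd])
    finally show "0 \<le> F (A j)" .
  qed
  have "uniformly_elliptic F"
    unfolding uniformly_elliptic_def
  proof (intro exI conjI ballI allI impI)
    show "0 < \<epsilon>" by fact
    show "\<epsilon> \<le> 1 + \<epsilon>" by simp
    fix M N :: "real ^ 'n ^ 'n" assume N: "nonneg_matrix N"
    have lower: "g P + \<epsilon> * trace N \<le> g (P + N)" for P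
    proof -
      have "min_form P \<le> min_form (P + N)"
        using N by (intro min_form_ge) (auto simp: form_add nonneg_matrix_def intro: order_trans[OF
          min_form_le])
      then show ?thesis by (simp add: g_def trace_add algebra_simps)
    qed
    have upper: "g (P + N) \<le> g P + (1 + \<epsilon>) * trace N" for P
    proof -
      have "min_form (P + N) - trace N \<le> min_form P"
      proof (rule min_form_ge)
        fix e :: "real ^ 'n" assume e: "norm e = 1"
        show "min_form (P + N) - trace N \<le> form P e"
          using min_form_le[OF e, of "P + N"] form_le_nonneg_trace[OF N e] by (simp add: form_add)
      qed
      then show ?thesis by (simp add: g_def trace_add algebra_simps)
    qed
    have shift: "M + N - A i = (M - A i) + N" for i by simp
    have "g (M - A i) \<le> F (M + N) - \<epsilon> * trace N" if "i \<in> I" for i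
    proof -
      have "g (M - A i) + \<epsilon> * trace N \<le> g (M + N - A i)"
        unfolding shift by (rule lower)
      also have "\<dots> \<le> F (M + N)"
        unfolding F_def by (rule cSUP_upper[OF that bdd])
      finally show ?thesis by simp
    qed
    then have "F M \<le> F (M + N) - \<epsilon> * trace N"
      unfolding F_def[of M] using assms(1) by (intro cSUP_least) auto
    then show "\<epsilon> * trace N \<le> F (M + N) - F M" by simp
    have "g (M + N - A i) \<le> F M + (1 + \<epsilon>) * trace N" if "i \<in> I" for i
    proof -
      have "g (M + N - A i) \<le> g (M - A i) + (1 + \<epsilon>) * trace N"
        unfolding shift by (rule upper)
      also have "g (M - A i) \<le> F M"
        unfolding F_def by (rule cSUP_upper[OF that bdd])
      finally show ?thesis by simp
    qed
    then have "F (M + N) \<le> F M + (1 + \<epsilon>) * trace N"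
      unfolding F_def[of "M + N"] using assms(1) by (intro cSUP_least) auto
    then show "F (M + N) - F M \<le> (1 + \<epsilon>) * trace N" by simp
  qed
  then show ?thesis
    using that[of F] F_mono F_A by metis
qed

subsection \<open>Second differences\<close>

lemma grad_has_derivative:
  assumes "f differentiable (at x)"
  shows "(f has_derivative (\<lambda>h. grad f x \<bullet> h)) (at x)"
proof -
  let ?D = "frechet_derivative f (at x)"
  have D: "(f has_derivative ?D) (at x)"
    using assms frechet_derivative_works by blast
  have lin: "linear ?D" by (rule has_derivative_linear[OF D])
  have "?D h = grad f x \<bullet> h" for h
  proof -
    have "?D h = ?D (\<Sum>i\<in>UNIV. h $ i *\<^sub>R axis i 1)"
      using basis_expansion[of h] by (simp add: scalar_mult_eq_scaleR)
    also have "\<dots> = (\<Sum>i\<in>UNIV. h $ i * ?D (axis i 1))"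
      by (simp add: linear_sum[OF lin] linear_scale[OF lin])
    finally show ?thesis
      by (simp add: grad_def inner_vec_def mult.commute)
  qed
  then have "?D = (\<lambda>h. grad f x \<bullet> h)" by blast
  with D show ?thesis by simp
qed

lemma grad_eq:
  assumes "(f has_derivative (\<lambda>h. g \<bullet> h)) (at x)"
  shows "grad f x = g"
  using frechet_derivative_at[OF assms, symmetric]
  by (simp add: grad_def vec_eq_iff inner_axis)

lemma hessian_has_derivative:
  assumes "grad f differentiable (at x)"
  shows "(grad f has_derivative (\<lambda>h. hessian f x *v h)) (at x)"
proof -
  have D: "(grad f has_derivative frechet_derivative (grad f) (at x)) (at x)"
    using assms frechet_derivative_works by blast
  then have "linear (frechet_derivative (grad f) (at x))"
    by (rule has_derivative_linear)
  then have "frechet_derivative (grad f) (at x) = (\<lambda>h. hessian f x *v h)"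
    by (simp add: hessian_def matrix_works linear_matrix_vector_mul_eq fun_eq_iff)
  with D show ?thesis by simp
qed

lemma hessian_eq:
  assumes "(grad f has_derivative (\<lambda>h. B *v h)) (at x)"
  shows "hessian f x = B"
  using frechet_derivative_at[OF assms, symmetric] by (simp add: hessian_def)

text \<open>One application of l'Hopital in h leaves the symmetric difference quotient of the
  directional derivative \<psi>, which converges because \<psi> is differentiable at 0.\<close>

lemma second_difference:
  assumes "open U" "x \<in> U" "C2_on U f"
  shows "((\<lambda>h. (f (x + h *\<^sub>R e) + f (x - h *\<^sub>R e) - 2 * f x) / h\<^sup>2) \<longlongrightarrow> form (hessian f x) e) (at_right 0)"
proof -
  have diff: "f differentiable (at y)" "grad f differentiable (at y)" if "y \<in> U" for y
    using assms that by (auto simp: C2_on_def differentiable_on_eq_differentiable_at)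
  have d: "((\<lambda>h. f (x + h *\<^sub>R e)) has_real_derivative grad f (x + h *\<^sub>R e) \<bullet> e) (at h)" if "x
    + h *\<^sub>R e \<in> U" for h e
  proof -
    have "((\<lambda>h. x + h *\<^sub>R e) has_derivative (\<lambda>k. k *\<^sub>R e)) (at h)"
      by (auto intro!: derivative_eq_intros)
    from has_derivative_compose[OF this grad_has_derivative[OF diff(1)[OF that]]]
    show ?thesis
      by (simp add: has_field_derivative_def mult_commute_abs)
  qed
  have ev: "\<forall>\<^sub>F h in at_right 0. x + h *\<^sub>R e \<in> U" for e
  proof -
    have "((\<lambda>h. x + h *\<^sub>R e) \<longlongrightarrow> x + 0 *\<^sub>R e) (at_right 0)"
      by (intro tendsto_intros)
    then show ?thesis
      using assms(1,2) by (auto dest: topological_tendstoD)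
  qed
  define \<psi> where "\<psi> h = grad f (x + h *\<^sub>R e) \<bullet> e" for h
  have "(\<psi> has_real_derivative form (hessian f x) e) (at 0)"
  proof -
    have l: "((\<lambda>h. x + h *\<^sub>R e) has_derivative (\<lambda>k. k *\<^sub>R e)) (at 0)"
      by (auto intro!: derivative_eq_intros)
    have "(grad f has_derivative (\<lambda>h. hessian f x *v h)) (at (x + 0 *\<^sub>R e))"
      using hessian_has_derivative[OF diff(2)[OF assms(2)]] by simp
    from has_derivative_inner_left[OF has_derivative_compose[OF l this], of e]
    show ?thesis
      by (simp add: \<psi>_def[abs_def] has_field_derivative_def matrix_vector_mult_scaleR inner_commute
        mult_commute_abs)
  qed
  then have D: "((\<lambda>h. (\<psi> h - \<psi> 0) / h) \<longlongrightarrow> form (hessian f x) e) (at 0)"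
    by (simp add: DERIV_def)
  have "((\<lambda>h. ((\<psi> h - \<psi> 0) / h + (\<psi> (- h) - \<psi> 0) / (- h)) / 2) \<longlongrightarrow> (form (hessian f x) e
    + form (hessian f x) e) / 2) (at 0)"
    by (intro tendsto_intros D filterlim_compose[OF D]) (auto simp: filterlim_at eventually_at_filter
      intro!: tendsto_eq_intros)
  moreover have "((\<psi> h - \<psi> 0) / h + (\<psi> (- h) - \<psi> 0) / (- h)) / 2 = (\<psi> h - \<psi> (- h)) / (2 * h)" for h
    by (cases "h = 0") (simp_all add: field_simps)
  moreover have "(form (hessian f x) e + form (hessian f x) e) / 2 = form (hessian f x) e"
    by simp
  ultimately have lim: "((\<lambda>h. (\<psi> h - \<psi> (- h)) / (2 * h)) \<longlongrightarrow> form (hessian f x) e) (at 0)"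
    by (simp only:)
  show ?thesis
  proof (rule lhopital_right_0[where f' = "\<lambda>h. \<psi> h - \<psi> (- h)" and g' = "\<lambda>h. 2 * h"])
    have "continuous (at x) f"
      using diff(1)[OF assms(2)] differentiable_imp_continuous_within by blast
    then have c: "((\<lambda>h. f (x + h *\<^sub>R e)) \<longlongrightarrow> f x) (at_right 0)" for e
      by (intro continuous_within_tendsto_compose'[of x UNIV f]) (auto intro!: tendsto_eq_intros)
    have "((\<lambda>h. f (x + h *\<^sub>R e) + f (x + h *\<^sub>R (- e)) - 2 * f x) \<longlongrightarrow> f x + f x - 2 * f x) (at_right 0)"
      by (intro tendsto_intros c)
    then show "((\<lambda>h. f (x + h *\<^sub>R e) + f (x - h *\<^sub>R e) - 2 * f x) \<longlongrightarrow> 0) (at_right 0)"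
      by simp
    show "((\<lambda>h. h\<^sup>2) \<longlongrightarrow> 0) (at_right (0 :: real))"
      by (auto intro!: tendsto_eq_intros)
    show "\<forall>\<^sub>F h in at_right 0. h\<^sup>2 \<noteq> (0 :: real)" "\<forall>\<^sub>F h in at_right 0. 2 * h \<noteq> (0 :: real)"
      by (auto simp: eventually_at_right_field intro!: exI[of _ 1])
    show "\<forall>\<^sub>F h in at_right 0. ((\<lambda>h. f (x + h *\<^sub>R e) + f (x - h *\<^sub>R e) - 2 * f x) has_real_derivative \<psi> h
      - \<psi> (- h)) (at h)"
      using ev[of e] ev[of "- e"]
    proof eventually_elim
      case (elim h)
      from DERIV_diff[OF DERIV_add[OF d[OF elim(1)] d[OF elim(2)]] DERIV_const[of "2 * f x"]]
      show ?case by (simp add: \<psi>_def)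
    qed
    show "\<forall>\<^sub>F h in at_right 0. ((\<lambda>h. h\<^sup>2) has_real_derivative 2 * h) (at h)"
      by (auto intro!: always_eventually derivative_eq_intros)
    show "((\<lambda>h. (\<psi> h - \<psi> (- h)) / (2 * h)) \<longlongrightarrow> form (hessian f x) e) (at_right 0)"
      using lim by (rule filterlim_mono) (auto simp: at_le)
  qed
qed

text \<open>A test function touching u from above has the larger symmetric second differences along
  every line, so its Hessian dominates the limit form \<open>A x\<close>; likewise from below. This
  covers points where u has no Hessian.\<close>

lemma viscosity_solution_of_second_differences:
  assumes cont: "continuous_on B u" and "open B"
    and lim: "\<And>x e. x \<in> B \<Longrightarrow>
      ((\<lambda>h. (u (x + h *\<^sub>R e) + u (x - h *\<^sub>R e) - 2 * u x) / h\<^sup>2) \<longlongrightarrow> form (A x) e) (at_right 0)"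
    and above: "\<And>x M. x \<in> B \<Longrightarrow> (\<And>e. form (A x) e \<le> form M e) \<Longrightarrow> 0 \<le> F M"
    and below: "\<And>x M. x \<in> B \<Longrightarrow> (\<And>e. form M e \<le> form (A x) e) \<Longrightarrow> F M \<le> 0"
  shows "viscosity_solution F B u"
  unfolding viscosity_solution_def
proof (intro conjI ballI allI impI)
  show "continuous_on B u" by fact
  fix x \<phi> assume x: "x \<in> B" and "C2_near x \<phi>"
  then obtain U where U: "open U" "x \<in> U" "C2_on U \<phi>"
    by (auto simp: C2_near_def)
  have near: "\<forall>\<^sub>F h in at_right 0. P (x + h *\<^sub>R e) \<and> P (x - h *\<^sub>R e)" if "\<forall>\<^sub>F y in nhds x. P y" for P e
  proof -
    have "filterlim (\<lambda>h. x + h *\<^sub>R e) (nhds (x + 0 *\<^sub>R e)) (at_right 0)" "filterlim (\<lambda>h. x - h *\<^sub>R e)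
      (nhds (x - 0 *\<^sub>R e)) (at_right 0)"
      by (intro tendsto_intros)+
    with that show ?thesis
      by (auto intro!: eventually_conj simp: filterlim_iff)
  qed
  note lim\<phi> = second_difference[OF U]
  show "0 \<le> F (hessian \<phi> x)" if "touches_above \<phi> u x"
  proof (rule above[OF x])
    fix e
    have eq: "\<phi> x = u x" and le: "\<forall>\<^sub>F y in nhds x. u y \<le> \<phi> y"
      using that by (auto simp: touches_above_def)
    show "form (A x) e \<le> form (hessian \<phi> x) e"
    proof (rule tendsto_le[OF _ lim\<phi> lim[OF x]])
      show "\<forall>\<^sub>F h in at_right 0. (u (x + h *\<^sub>R e) + u (x - h *\<^sub>R e) - 2 * u x) / h\<^sup>2 \<le> (\<phi> (x + h *\<^sub>R e)
        + \<phi> (x - h *\<^sub>R e) - 2 * \<phi> x) / h\<^sup>2"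
        using near[OF le, of e] by eventually_elim (auto simp: eq intro!: divide_right_mono)
    qed simp
  qed
  show "F (hessian \<phi> x) \<le> 0" if "touches_below \<phi> u x"
  proof (rule below[OF x])
    fix e
    have eq: "\<phi> x = u x" and le: "\<forall>\<^sub>F y in nhds x. \<phi> y \<le> u y"
      using that by (auto simp: touches_below_def)
    show "form (hessian \<phi> x) e \<le> form (A x) e"
    proof (rule tendsto_le[OF _ lim[OF x] lim\<phi>])
      show "\<forall>\<^sub>F h in at_right 0. (\<phi> (x + h *\<^sub>R e) + \<phi> (x - h *\<^sub>R e) - 2 * \<phi> x) / h\<^sup>2 \<le> (u (x + h *\<^sub>R e)
        + u (x - h *\<^sub>R e) - 2 * u x) / h\<^sup>2"
        using near[OF le, of e] by eventually_elim (auto simp: eq intro!: divide_right_mono)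
    qed simp
  qed
qed

subsection \<open>Solutions with prescribed singular set\<close>

lemma has_derivative_zero_of_quadratic:
  fixes f :: "'a :: real_normed_vector \<Rightarrow> 'b :: real_normed_vector"
  assumes "\<And>y. norm (f y) \<le> C * (norm (y - x))\<^sup>2"
  shows "(f has_derivative (\<lambda>h. 0)) (at x)"
proof -
  have "f x = 0" using assms[of x] by simp
  have "(\<lambda>h. norm (f (x + h)) / norm h) \<midarrow>0\<rightarrow> 0"
  proof (rule Lim_null_comparison)
    show "\<forall>\<^sub>F h in at 0. norm (norm (f (x + h)) / norm h) \<le> C * norm h"
      unfolding eventually_at_filter
    proof (intro always_eventually allI impI)
      fix h :: 'a assume "h \<noteq> 0"
      then show "norm (norm (f (x + h)) / norm h) \<le> C * norm h"
        using assms[of "x + h"] by (simp add: power2_eq_square field_simps)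
    qed
    show "((\<lambda>h. C * norm h) \<longlongrightarrow> 0) (at 0)"
      by (auto intro!: tendsto_eq_intros)
  qed
  then show ?thesis
    unfolding has_derivative_at by (simp add: \<open>f x = 0\<close>)
qed

lemma bump_has_derivative': "(bump has_derivative (\<lambda>h. bump_grad y \<bullet> h)) (at y)"
proof (cases "y = 0")
  case True
  have "(bump has_derivative (\<lambda>h. 0)) (at 0)"
    by (rule has_derivative_zero_of_quadratic[where C = 4]) (use bump_le in simp)
  then show ?thesis by (simp add: True bump_0)
qed (rule bump_has_derivative)

lemma mul_self_has_derivative: "((\<lambda>y. 3 *\<^sub>R mul y y) has_derivative (\<lambda>h. (6 *\<^sub>R L y) *v h)) (at y)"
proof -
  have "((\<lambda>y. 3 *\<^sub>R mul y y) has_derivative (\<lambda>h. 3 *\<^sub>R (mul y h + mul h y))) (at y)"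
    by (auto intro!: derivative_eq_intros bounded_bilinear.FDERIV[OF bounded_bilinear_mul])
  then show ?thesis
    by (rule has_derivative_eq_rhs)
      (simp add: fun_eq_iff vec_eq_iff mul_commute[of _ y] L_mult_vec flip: scaleR_matrix_vector_assoc)
qed

text \<open>The factor 1/8 makes this function 1/8-Lipschitz: nearby radii are comparable, and a
  ball of this radius stays seven radii away from \<open>K\<close>.\<close>

definition radius :: "'a :: metric_space set \<Rightarrow> 'a \<Rightarrow> real" where
  "radius K z = min 1 (infdist z K) / 8"

text \<open>Since \<open>sep\<close> applies to both orders of a pair, balls of doubled radius about
  distinct centres are disjoint. The conditions on \<delta> serve two kinds of pairs of points:
  those not in a common ball (192 is twice the constant 96 of \<open>bump_hess_le\<close>) and those
  in one ball (the Taylor part). The budget 1/64 is half the inverse of the constant 32 in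
  \<open>H_difference_bound\<close>.\<close>

locale bubbles =
  fixes K X :: "(real ^ 5) set" and \<delta> :: real
  assumes K: "closed K" "K \<noteq> {}"
    and X: "X \<noteq> {}" "X \<inter> K = {}"
    and sep: "\<And>z w. z \<in> X \<Longrightarrow> w \<in> X \<Longrightarrow> z \<noteq> w \<Longrightarrow> 4 * radius K z \<le> dist z w"
    and dense: "K \<subseteq> closure X"
    and \<delta>: "0 < \<delta>" "\<delta> * 192 \<le> 1 / 64"
      "\<And>x y e. norm x \<le> 1 \<Longrightarrow> norm y \<le> 1 \<Longrightarrow>
         \<delta> * \<bar>form (taylor_hess x - taylor_hess y) e\<bar> \<le> 1 / 64 * norm (x - y) * (e \<bullet> e)"
begin

abbreviation \<rho> where "\<rho> \<equiv> radius K"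

lemma \<rho>_pos: "z \<in> X \<Longrightarrow> 0 < \<rho> z"
  using X(2) K in_closed_iff_infdist_zero[of K z] infdist_nonneg[of z K]
  by (auto simp: radius_def less_le)

lemma \<rho>_le: "\<rho> z \<le> 1"
  by (simp add: radius_def min_def)

lemma \<rho>_lipschitz: "8 * \<rho> x \<le> 8 * \<rho> y + dist x y"
proof -
  have "min 1 (infdist x K) \<le> min 1 (infdist y K) + dist x y"
    using infdist_triangle[of x K y] zero_le_dist[of x y] by linarith
  then show ?thesis by (simp add: radius_def)
qed

lemma \<rho>_near: "x \<in> K \<Longrightarrow> 8 * \<rho> z \<le> dist z x"
  using infdist_le[of x K z] by (simp add: radius_def)

lemma center_unique:
  assumes "z \<in> X" "w \<in> X" "dist z x < 2 * \<rho> z" "dist w x < 2 * \<rho> w"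
  shows "z = w"
proof (rule ccontr)
  assume "z \<noteq> w"
  then have "4 * \<rho> z \<le> dist z w" "4 * \<rho> w \<le> dist z w"
    using sep[of z w] sep[of w z] assms by (simp_all add: dist_commute)
  then show False
    using dist_triangle2[of z w x] assms by linarith
qed

lemma center_unique':
  assumes "z \<in> X" "w \<in> X" "dist z x < \<rho> z" "dist w x < \<rho> w"
  shows "z = w"
  using center_unique[of z w x] assms \<rho>_pos[of z] \<rho>_pos[of w] by simp

text \<open>By \<open>center_unique'\<close> the sum has at most one term: it selects the function
  of the ball containing x and defaults to 0 outside all balls.\<close>

definition patch :: "(real ^ 5 \<Rightarrow> real ^ 5 \<Rightarrow> 'b :: comm_monoid_add) \<Rightarrow> real ^ 5 \<Rightarrow> 'b" where
  "patch f x = (\<Sum>z\<in>{z\<in>X. dist z x < \<rho> z}. f z x)"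

lemma patch_in:
  assumes "z \<in> X" "dist z x < \<rho> z"
  shows "patch f x = f z x"
proof -
  have "{w\<in>X. dist w x < \<rho> w} = {z}"
  proof safe
    fix w assume "w \<in> X" "dist w x < \<rho> w"
    then show "w = z" by (rule center_unique'[OF _ assms(1) _ assms(2)])
  qed (use assms in auto)
  then show ?thesis by (simp only: patch_def sum.insert_remove sum.empty) simp
qed

lemma patch_out:
  assumes "\<And>z. z \<in> X \<Longrightarrow> \<rho> z \<le> dist z x"
  shows "patch f x = 0"
proof -
  have "{z\<in>X. dist z x < \<rho> z} = {}"
    using assms by force
  then show ?thesis by (simp only: patch_def sum.empty)
qed

definition supported :: "(real ^ 5 \<Rightarrow> real ^ 5 \<Rightarrow> 'b :: zero) \<Rightarrow> bool" where
  "supported f \<longleftrightarrow> (\<forall>z\<in>X. \<forall>x. \<rho> z \<le> dist z x \<longrightarrow> f z x = 0)"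

lemma patch_single:
  assumes "supported f" "z \<in> X" "\<And>w. w \<in> X \<Longrightarrow> dist w x < \<rho> w \<Longrightarrow> w = z"
  shows "patch f x = f z x"
proof (cases "dist z x < \<rho> z")
  case True
  with assms(2) show ?thesis by (rule patch_in)
next
  case False
  have "patch f x = 0"
  proof (rule patch_out)
    fix w assume "w \<in> X"
    show "\<rho> w \<le> dist w x"
    proof (rule ccontr)
      assume "\<not> \<rho> w \<le> dist w x"
      then have "dist w x < \<rho> w" by simp
      moreover from assms(3)[OF \<open>w \<in> X\<close> this] have "w = z" .
      ultimately show False using False by simp
    qed
  qed
  with False assms(1,2) show ?thesis by (simp add: supported_def)
qed

text \<open>Near x either all points lie in the doubled ball of one centre, which excludes every
  other centre, or no ball comes near. Being open, the doubled balls also handle boundary points of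
  the original ones.\<close>

lemma locally_single:
  assumes "x \<notin> K"
  obtains z e where "z \<in> X" "0 < e" "\<And>y w. y \<in> ball x e \<Longrightarrow> w \<in> X \<Longrightarrow> dist w y < \<rho> w \<Longrightarrow> w = z"
    "ball x e \<inter> K = {}"
proof (cases "\<exists>z\<in>X. dist z x < 2 * \<rho> z")
  case True
  then obtain z where z: "z \<in> X" "dist z x < 2 * \<rho> z" by blast
  define e where "e = 2 * \<rho> z - dist z x"
  have in_ball: "dist z y < 2 * \<rho> z" if "y \<in> ball x e" for y
    using that dist_triangle[of z y x] by (simp add: e_def)
  show ?thesis
  proof (rule that[OF z(1)])
    show "0 < e" using z by (simp add: e_def)
    show "w = z" if "y \<in> ball x e" "w \<in> X" "dist w y < \<rho> w" for y w
      using center_unique[of w z y] in_ball[OF that(1)] that z \<rho>_pos[of w] by simp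
    show "ball x e \<inter> K = {}"
    proof (safe, simp_all)
      fix y assume "y \<in> K" "dist x y < e"
      then show False
        using in_ball[of y] \<rho>_near[of y z] \<rho>_pos[OF z(1)] by simp
    qed
  qed
next
  case False
  \<comment> \<open>A ball about w meeting this neighbourhood would have \<rho> w < \<rho> x / 2,
    which contradicts the Lipschitz bound on \<rho>. So no ball meets it and any centre may serve as
    z.\<close>
  define e where "e = \<rho> x / 2"
  have "0 < \<rho> x"
    using assms K in_closed_iff_infdist_zero[of K x] infdist_nonneg[of x K] by (auto simp: radius_def less_le)
  then have "0 < e" by (simp add: e_def)
  obtain z where "z \<in> X" using X(1) by blast
  show ?thesis
  proof (rule that[OF \<open>z \<in> X\<close> \<open>0 < e\<close>])
    show "w = z" if "y \<in> ball x e" "w \<in> X" "dist w y < \<rho> w" for y w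
    proof -
      have "2 * \<rho> w \<le> dist w x" using False that by auto
      moreover have "dist w x \<le> dist w y + dist x y" by (rule dist_triangle2)
      ultimately show ?thesis
        using \<rho>_lipschitz[of x w] that \<rho>_pos[OF that(2)] by (simp add: e_def dist_commute)
    qed
    show "ball x e \<inter> K = {}"
      using \<rho>_near[of _ x] \<open>0 < e\<close> by (force simp: e_def)
  qed
qed

lemma patch_near_K:
  assumes "x \<in> K" "z \<in> X" "dist z y < \<rho> z"
  shows "7 * \<rho> z \<le> dist y x"
  using \<rho>_near[OF assms(1), of z] dist_triangle[of z x y] assms(3) by simp

lemma patch_K: "x \<in> K \<Longrightarrow> patch f x = 0"
  using patch_near_K[of x _ x] \<rho>_pos by (intro patch_out) force

text \<open>The factor 2 is for x and y in the balls of different centres z and w: there f z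
  vanishes at y and f w vanishes at x, so each value is bounded separately.\<close>

lemma patch_lipschitz:
  fixes f :: "real ^ 5 \<Rightarrow> real ^ 5 \<Rightarrow> 'b :: real_normed_vector"
  assumes "supported f" "\<And>z x y. z \<in> X \<Longrightarrow> norm (f z x - f z y) \<le> c * norm (x - y)"
  shows "norm (patch f x - patch f y) \<le> 2 * c * norm (x - y)"
proof -
  obtain z0 where "z0 \<in> X" using X by blast
  have c: "0 \<le> c * norm (x - y)" for x y :: "real ^ 5"
    using order_trans[OF norm_ge_zero assms(2)[OF \<open>z0 \<in> X\<close>, of x y]] .
  have one: "norm (f z x) \<le> c * norm (x - y)" if "z \<in> X" "\<rho> z \<le> dist z y" for z x y
    using assms(2)[OF that(1), of x y] assms(1) that by (simp add: supported_def)
  consider (none) "\<And>z. z \<in> X \<Longrightarrow> \<rho> z \<le> dist z x" | (some) z where "z \<in> X" "dist z x < \<rho> z"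
    by force
  then show ?thesis
  proof cases
    case none
    consider (none') "\<And>z. z \<in> X \<Longrightarrow> \<rho> z \<le> dist z y" | (some') w where "w \<in> X" "dist w y < \<rho> w"
      by force
    then show ?thesis
    proof cases
      case none'
      with none show ?thesis using c[of x y] by (simp add: patch_out mult.assoc)
    next
      case some'
      with none show ?thesis using one[OF some'(1) none[OF some'(1)], of y] c[of x y]
        by (simp add: patch_out patch_in norm_minus_commute mult.assoc)
    qed
  next
    case some
    show ?thesis
    proof (cases "\<exists>w\<in>X. dist w y < \<rho> w \<and> w \<noteq> z")
      case True
      then obtain w where w: "w \<in> X" "dist w y < \<rho> w" "w \<noteq> z" by blast
      then have far: "\<rho> w \<le> dist w x" "\<rho> z \<le> dist z y"
        using center_unique'[of z w x] center_unique'[of z w y] some by force+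
      have "norm (f z x - f w y) \<le> norm (f z x) + norm (f w y)" by (rule norm_triangle_ineq4)
      also have "\<dots> \<le> c * norm (x - y) + c * norm (y - x)"
        by (intro add_mono one some w far)
      finally show ?thesis
        using some w by (simp add: patch_in norm_minus_commute)
    next
      case False
      then have "patch f y = f z y"
        by (intro patch_single assms some) auto
      then show ?thesis
        using some assms(2)[OF some(1), of x y] c[of x y] by (simp add: patch_in mult.assoc)
    qed
  qed
qed

section \<open>Rescaled bumps and the C^{1,1} function they produce\<close>

definition rescale :: "real ^ 5 \<Rightarrow> real ^ 5 \<Rightarrow> real ^ 5" where
  "rescale z x = (1 / \<rho> z) *\<^sub>R (x - z)"

definition bump0 where "bump0 z x = \<delta> * \<rho> z ^ 3 * bump (rescale z x)"
definition bump1 where "bump1 z x = (\<delta> * (\<rho> z)\<^sup>2) *\<^sub>R bump_grad (rescale z x)"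
definition bump2 where "bump2 z x = (\<delta> * \<rho> z) *\<^sub>R bump_hess (rescale z x)"

definition sol :: "real ^ 5 \<Rightarrow> real" where "sol x = cubic x + patch bump0 x"
definition sol_grad :: "real ^ 5 \<Rightarrow> real ^ 5" where "sol_grad x = 3 *\<^sub>R mul x x + patch bump1 x"
definition sol_hess :: "real ^ 5 \<Rightarrow> real ^ 5 ^ 5" where "sol_hess x = 6 *\<^sub>R L x + patch bump2 x"

lemma norm_rescale: "z \<in> X \<Longrightarrow> norm (rescale z x) = dist z x / \<rho> z"
  using \<rho>_pos[of z] by (simp add: rescale_def dist_norm norm_minus_commute)

lemma rescale_diff: "z \<in> X \<Longrightarrow> norm (rescale z x - rescale z y) = norm (x - y) / \<rho> z"
  using \<rho>_pos[of z] by (simp add: rescale_def flip: scaleR_diff_right)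

lemma supported: "supported bump0" "supported bump1" "supported bump2"
proof -
  have "1 \<le> norm (rescale z x)" if "z \<in> X" "\<rho> z \<le> dist z x" for z x
    using that \<rho>_pos[OF that(1)] by (simp add: norm_rescale)
  then show "supported bump0" "supported bump1" "supported bump2"
    by (simp_all add: supported_def bump0_def bump1_def bump2_def bump_eq_0)
qed

lemma rescale_has_derivative: "(rescale z has_derivative (\<lambda>h. (1 / \<rho> z) *\<^sub>R h)) (at x)"
  unfolding rescale_def[abs_def] by (auto intro!: derivative_eq_intros)

lemma bump0_has_derivative:
  assumes "z \<in> X"
  shows "(bump0 z has_derivative (\<lambda>h. bump1 z x \<bullet> h)) (at x)"
proof -
  have "(bump0 z has_derivative (\<lambda>h. \<delta> * \<rho> z ^ 3 * (bump_grad (rescale z x) \<bullet> ((1 / \<rho> z) *\<^sub>R h)))) (at x)"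
    unfolding bump0_def[abs_def]
    by (intro has_derivative_mult_right has_derivative_compose[OF rescale_has_derivative
      bump_has_derivative'])
  then show ?thesis
    by (rule has_derivative_eq_rhs)
      (use \<rho>_pos[OF assms] in \<open>simp add: bump1_def fun_eq_iff power2_eq_square power3_eq_cube\<close>)
qed

lemma bump1_has_derivative:
  assumes "z \<in> X" "x \<noteq> z"
  shows "(bump1 z has_derivative (\<lambda>h. bump2 z x *v h)) (at x)"
proof -
  have "rescale z x \<noteq> 0"
    using assms \<rho>_pos[OF assms(1)] by (simp add: rescale_def)
  then have "(bump1 z has_derivative (\<lambda>h. (\<delta> * (\<rho> z)\<^sup>2) *\<^sub>R (bump_hess (rescale z x) *v ((1 / \<rho> z) *\<^sub>R
    h)))) (at x)"
    unfolding bump1_def[abs_def]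
    by (intro has_derivative_scaleR_right has_derivative_compose[OF rescale_has_derivative
      bump_grad_has_derivative])
  then show ?thesis
    by (rule has_derivative_eq_rhs)
      (use \<rho>_pos[OF assms(1)] in \<open>simp add: bump2_def fun_eq_iff power2_eq_square matrix_vector_mult_scaleR
        flip: scaleR_matrix_vector_assoc\<close>)
qed

lemma isCont_bump2:
  assumes "z \<in> X" "x \<noteq> z"
  shows "isCont (bump2 z) x"
proof -
  have "rescale z x \<noteq> 0"
    using assms \<rho>_pos[OF assms(1)] by (simp add: rescale_def)
  moreover have "isCont (rescale z) x"
    using rescale_has_derivative has_derivative_continuous by blast
  ultimately have "isCont (\<lambda>x. bump_hess (rescale z x)) x"
    using isCont_o2 isCont_bump_hess by blast
  then show ?thesis
    unfolding bump2_def[abs_def] by (intro continuous_intros)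
qed

text \<open>A ball containing y has radius at most |y - x|. Returning that radius r serves two
  purposes: r \<le> 1 yields a quadratic bound, for the derivative of \<open>sol\<close> on
  \<open>K\<close>, and r \<le> |y - x| a cubic one, for its second differences.\<close>

lemma patch_bump0_small:
  assumes "x \<in> K"
  obtains r where "0 \<le> r" "r \<le> 1" "r \<le> norm (y - x)" "\<bar>patch bump0 y\<bar> \<le> 4 * \<delta> * r ^ 3"
proof (cases "\<exists>z\<in>X. dist z y < \<rho> z")
  case True
  then obtain z where z: "z \<in> X" "dist z y < \<rho> z" by blast
  have "norm (rescale z y) \<le> 1"
    using z \<rho>_pos[OF z(1)] by (simp add: norm_rescale)
  then have "4 * (norm (rescale z y))\<^sup>2 \<le> 4 * 1"
    by (intro mult_left_mono) (auto simp: power_le_one)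
  then have "\<bar>bump (rescale z y)\<bar> \<le> 4"
    using bump_le[of "rescale z y"] by linarith
  then have "(\<delta> * \<rho> z ^ 3) * \<bar>bump (rescale z y)\<bar> \<le> (\<delta> * \<rho> z ^ 3) * 4"
    using \<delta>(1) \<rho>_pos[OF z(1)] by (intro mult_left_mono) auto
  then have "\<bar>patch bump0 y\<bar> \<le> 4 * \<delta> * \<rho> z ^ 3"
    using \<delta>(1) \<rho>_pos[OF z(1)] by (simp add: patch_in[OF z] bump0_def abs_mult mult_ac)
  moreover have "\<rho> z \<le> norm (y - x)"
    using patch_near_K[OF assms z] \<rho>_pos[OF z(1)] by (simp add: dist_norm)
  ultimately show ?thesis
    using that[of "\<rho> z"] \<rho>_pos[OF z(1)] \<rho>_le[of z] by simp
next
  case False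
  then have "patch bump0 y = 0" by (intro patch_out) force
  then show ?thesis using that[of 0] by simp
qed

lemma sol_has_derivative: "(sol has_derivative (\<lambda>h. sol_grad x \<bullet> h)) (at x)"
proof (cases "x \<in> K")
  case True
  have "(patch bump0 has_derivative (\<lambda>h. 0)) (at x)"
  proof (rule has_derivative_zero_of_quadratic[where C = "4 * \<delta>"])
    fix y
    obtain r where r: "0 \<le> r" "r \<le> 1" "r \<le> norm (y - x)" and le: "\<bar>patch bump0 y\<bar> \<le> 4 * \<delta> * r ^ 3"
      using patch_bump0_small[OF True, of y] by metis
    have "r\<^sup>2 * r \<le> (norm (y - x))\<^sup>2 * 1"
      using r by (intro mult_mono power_mono) auto
    then have "4 * \<delta> * r ^ 3 \<le> 4 * \<delta> * (norm (y - x))\<^sup>2"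
      using \<delta>(1) by (intro mult_left_mono) (auto simp: power2_eq_square power3_eq_cube)
    with le show "norm (patch bump0 y) \<le> 4 * \<delta> * (norm (y - x))\<^sup>2" by simp
  qed
  from has_derivative_add[OF cubic_has_derivative this]
  show ?thesis
    by (simp add: sol_def[abs_def] sol_grad_def patch_K[OF True])
next
  case False
  then obtain z e where z: "z \<in> X" "0 < e" and single: "\<And>y w. y \<in> ball x e \<Longrightarrow> w \<in> X \<Longrightarrow> dist w y < \<rho> w \<Longrightarrow> w = z"
    using locally_single[OF False] by metis
  have p: "patch bump0 y = bump0 z y" "patch bump1 y = bump1 z y" if "y \<in> ball x e" for y
    using single[OF that] z by (intro patch_single supported; blast)+
  have "((\<lambda>y. cubic y + bump0 z y) has_derivative (\<lambda>h. 3 * (mul x x \<bullet> h) + bump1 z x \<bullet> h)) (at x)"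
    by (intro has_derivative_add cubic_has_derivative bump0_has_derivative z)
  then have "(sol has_derivative (\<lambda>h. 3 * (mul x x \<bullet> h) + bump1 z x \<bullet> h)) (at x)"
    by (rule has_derivative_transform_within_open[OF _ open_ball[of x e]]) (use z p in \<open>auto simp: sol_def\<close>)
  then show ?thesis
    using p(2)[of x] z by (simp add: sol_grad_def inner_add_left)
qed

lemma grad_sol: "grad sol = sol_grad"
  by (rule ext) (rule grad_eq[OF sol_has_derivative])

lemma sol_local:
  assumes "x \<notin> K"
  obtains z e where "z \<in> X" "0 < e" "ball x e \<inter> K = {}" "\<And>y. y \<in> ball x e \<Longrightarrow> sol y = cubic y + bump0 z y"
    "\<And>y. y \<in> ball x e \<Longrightarrow> sol_grad y = 3 *\<^sub>R mul y y + bump1 z y"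
    "\<And>y. y \<in> ball x e \<Longrightarrow> sol_hess y = 6 *\<^sub>R L y + bump2 z y"
proof -
  obtain z e where z: "z \<in> X" "0 < e" "ball x e \<inter> K = {}"
    and single: "\<And>y w. y \<in> ball x e \<Longrightarrow> w \<in> X \<Longrightarrow> dist w y < \<rho> w \<Longrightarrow> w = z"
    using locally_single[OF assms] by metis
  have "patch bump0 y = bump0 z y" "patch bump1 y = bump1 z y" "patch bump2 y = bump2 z y"
    if "y \<in> ball x e" for y
    using single[OF that] z by (intro patch_single supported; blast)+
  with z that show ?thesis
    by (simp add: sol_def sol_grad_def sol_hess_def)
qed

lemma sol_grad_has_derivative:
  assumes "x \<notin> K" "x \<notin> X"
  shows "(sol_grad has_derivative (\<lambda>h. sol_hess x *v h)) (at x)" "isCont sol_hess x"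
proof -
  obtain z e where z: "z \<in> X" "0 < e"
    and g: "\<And>y. y \<in> ball x e \<Longrightarrow> sol_grad y = 3 *\<^sub>R mul y y + bump1 z y"
    and h: "\<And>y. y \<in> ball x e \<Longrightarrow> sol_hess y = 6 *\<^sub>R L y + bump2 z y"
    using sol_local[OF assms(1)] by metis
  have "x \<noteq> z" using assms z by blast
  have "((\<lambda>y. 3 *\<^sub>R mul y y + bump1 z y) has_derivative (\<lambda>h. (6 *\<^sub>R L x) *v h + bump2 z x *v h)) (at x)"
    by (intro has_derivative_add mul_self_has_derivative bump1_has_derivative z \<open>x \<noteq> z\<close>)
  then have "(sol_grad has_derivative (\<lambda>h. (6 *\<^sub>R L x) *v h + bump2 z x *v h)) (at x)"
    by (rule has_derivative_transform_within_open[OF _ open_ball[of x e]]) (use z g in auto)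
  then show "(sol_grad has_derivative (\<lambda>h. sol_hess x *v h)) (at x)"
    using h[of x] z by (simp add: matrix_vector_mult_add_rdistrib)
  have "isCont (\<lambda>y. L y) x"
  proof -
    have "isCont (\<lambda>y. L y $ i $ j) x" for i j
    proof -
      have "linear (\<lambda>y. L y $ i $ j)"
        by (auto intro!: linearI simp: L_nth mul_algebra)
      then show ?thesis
        using linear_continuous_at linear_conv_bounded_linear by blast
    qed
    then show ?thesis by (simp add: isCont_def vec_tendstoI)
  qed
  then have "isCont (\<lambda>y. 6 *\<^sub>R L y + bump2 z y) x"
    by (intro continuous_intros isCont_bump2 z \<open>x \<noteq> z\<close>)
  moreover have "\<forall>\<^sub>F y in nhds x. sol_hess y = 6 *\<^sub>R L y + bump2 z y"
    using z h by (auto simp: eventually_nhds intro!: exI[of _ "ball x e"])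
  ultimately show "isCont sol_hess x"
    by (simp add: isCont_cong)
qed

lemma hessian_sol: "x \<notin> K \<Longrightarrow> x \<notin> X \<Longrightarrow> hessian sol x = sol_hess x"
  by (rule hessian_eq) (simp add: grad_sol sol_grad_has_derivative(1))

lemma C2_on_sol:
  assumes "U \<inter> (K \<union> X) = {}" "open U"
  shows "C2_on U sol"
  unfolding C2_on_def
proof (intro conjI)
  show "sol differentiable_on U"
    unfolding differentiable_on_def differentiable_def
    by (intro ballI exI) (rule has_derivative_at_withinI[OF sol_has_derivative])
  show "grad sol differentiable_on U"
    unfolding differentiable_on_def differentiable_def grad_sol
  proof (intro ballI exI)
    fix x assume "x \<in> U"
    then show "(sol_grad has_derivative (\<lambda>h. sol_hess x *v h)) (at x within U)"
      using assms sol_grad_has_derivative(1)[of x, THEN has_derivative_at_withinI] by blast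
  qed
  have "continuous_on U sol_hess"
  proof (rule continuous_at_imp_continuous_on, rule ballI)
    fix x assume "x \<in> U"
    then have "x \<notin> K" "x \<notin> X" using assms(1) by auto
    then show "isCont sol_hess x" by (rule sol_grad_has_derivative(2))
  qed
  then show "continuous_on U (hessian sol)"
  proof (rule continuous_on_eq)
    fix x assume "x \<in> U"
    then have "x \<notin> K" "x \<notin> X" using assms(1) by auto
    then show "sol_hess x = hessian sol x" by (simp add: hessian_sol)
  qed
qed

lemma C11_on_sol: "C11_on (ball 0 1) sol"
  unfolding C11_on_def
proof (intro conjI exI)
  show "sol differentiable_on ball 0 1"
    unfolding differentiable_on_def differentiable_def
    by (intro ballI exI) (rule has_derivative_at_withinI[OF sol_has_derivative])
  have lip1: "norm (bump1 z x - bump1 z y) \<le> 96 * \<delta> * norm (x - y)" if "z \<in> X" for z x y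
  proof -
    have "norm (bump1 z x - bump1 z y) = \<delta> * (\<rho> z)\<^sup>2 * norm (bump_grad (rescale z x) - bump_grad (rescale
      z y))"
      using \<delta>(1) by (simp add: bump1_def flip: scaleR_diff_right)
    also have "\<dots> \<le> \<delta> * (\<rho> z)\<^sup>2 * (96 * norm (rescale z x - rescale z y))"
      using \<delta>(1) by (intro mult_left_mono bump_grad_lipschitz) auto
    also have "\<dots> = 96 * \<delta> * norm (x - y) * \<rho> z"
      using \<rho>_pos[OF that] by (simp add: rescale_diff[OF that] power2_eq_square)
    also have "\<dots> \<le> 96 * \<delta> * norm (x - y)"
      using \<rho>_le[of z] \<delta>(1) by (intro mult_left_le) auto
    finally show ?thesis .
  qed
  show "(6 + 2 * (96 * \<delta>))-lipschitz_on (ball 0 1) (grad sol)"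
    unfolding grad_sol
  proof (rule lipschitz_onI)
    fix x y :: "real ^ 5" assume xy: "x \<in> ball 0 1" "y \<in> ball 0 1"
    have "norm (mul (x + y) (x - y)) \<le> norm (x + y) * norm (x - y)" by (rule norm_mul_le)
    also have "\<dots> \<le> 2 * norm (x - y)"
      using xy norm_triangle_ineq[of x y] by (intro mult_right_mono) auto
    finally have m: "norm (mul x x - mul y y) \<le> 2 * norm (x - y)"
      by (simp add: mul_algebra mul_commute[of y x])
    have "norm (sol_grad x - sol_grad y) = norm (3 *\<^sub>R (mul x x - mul y y) + (patch bump1 x - patch bump1 y))"
      by (simp add: sol_grad_def algebra_simps)
    also have "\<dots> \<le> 3 * norm (mul x x - mul y y) + norm (patch bump1 x - patch bump1 y)"
      by (rule order_trans[OF norm_triangle_ineq]) simp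
    also have "\<dots> \<le> 3 * (2 * norm (x - y)) + 2 * (96 * \<delta>) * norm (x - y)"
      using m patch_lipschitz[OF supported(2) lip1, of x y] by simp
    finally show "dist (sol_grad x) (sol_grad y) \<le> (6 + 2 * (96 * \<delta>)) * dist x y"
      by (simp add: dist_norm algebra_simps)
  qed (use \<delta> in auto)
qed

end

section \<open>Perturbed Hessian differences and the singular set\<close>

lemma L_diff: "L (x - y) = L x - L y"
  by (simp add: vec_eq_iff L_nth mul_algebra)

lemma radial_hessian_0: "radial_hessian a b c 0 = 0"
  by (simp add: radial_hessian_def cubic_def mul_algebra vec_eq_iff L_nth outer_def)

lemma bump_hess_0: "bump_hess 0 = 0"
  by (simp add: bump_hess_def radial_hessian_0)

text \<open>Write d = |a - b|. Removing E raises the upper bound c by d / 64, so d \<le> 32 (c + d /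
  64), that is d \<le> 64 c. The trace estimate and the trace of E then add up to 32 c + 32 c + 5 c
  = 69 c.\<close>

lemma H_difference_perturbed:
  assumes "0 \<le> t" and E: "\<And>e. \<bar>form E e\<bar> \<le> 1 / 64 * norm (a - b) * (e \<bullet> e)"
    and le: "form_le (H t a - H t b + E) c"
  shows "- trace (H t a - H t b + E) \<le> 69 * c"
proof -
  define d where "d = norm (a - b)"
  have "form_le (H t a - H t b) (c + d / 64)"
    unfolding form_le_def
  proof
    fix e
    have "form (H t a - H t b) e + form E e \<le> c * (e \<bullet> e)"
      using le by (simp add: form_le_def form_add)
    then show "form (H t a - H t b) e \<le> (c + d / 64) * (e \<bullet> e)"
      using E[of e] by (simp add: d_def algebra_simps)
  qed
  note bound = H_difference_bound[OF assms(1) this]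
  have "\<bar>trace E\<bar> \<le> 5 * (d / 64)"
  proof -
    have "\<bar>E $ i $ i\<bar> \<le> d / 64" for i
      using E[of "axis i 1"] by (simp add: form_axis d_def inner_axis_axis)
    then have "\<bar>trace E\<bar> \<le> (\<Sum>i\<in>(UNIV :: 5 set). d / 64)"
      unfolding trace_def by (intro order_trans[OF sum_abs] sum_mono)
    then show ?thesis by simp
  qed
  moreover have "- (p - q + r) \<le> 69 * c"
    if "\<bar>r\<bar> \<le> 5 * (d / 64)" "d \<le> 32 * (c + d / 64)" "q - p \<le> 32 * (c + d / 64)" for p q r :: real
    using that by (simp add: abs_le_iff)
  ultimately show ?thesis
    using bound unfolding d_def[symmetric] trace_add trace_sub by blast
qed

context bubbles
begin

lemma regular_neighbourhood:
  assumes "x \<notin> K" "x \<notin> X"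
  obtains U where "open U" "x \<in> U" "U \<inter> (K \<union> X) = {}"
proof -
  obtain z e where z: "0 < e" "ball x e \<inter> K = {}"
    and single: "\<And>y w. y \<in> ball x e \<Longrightarrow> w \<in> X \<Longrightarrow> dist w y < \<rho> w \<Longrightarrow> w = z" and "z \<in> X"
    using locally_single[OF assms(1)] by metis
  show ?thesis
  proof
    show "open (ball x e - {z})" by (simp add: open_delete)
    show "x \<in> ball x e - {z}" using assms(2) \<open>z \<in> X\<close> z by auto
    have "w = z" if "w \<in> ball x e" "w \<in> X" for w
      using single[OF that] \<rho>_pos[OF that(2)] by simp
    then show "(ball x e - {z}) \<inter> (K \<union> X) = {}" using z by auto
  qed
qed

text \<open>On a line through z in a direction v with nonzero cubic value, the v-component of the
  bump gradient behaves like a nonzero multiple of |h|. This kink shows that the gradient is not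
  differentiable at z.\<close>

lemma not_C2_on_center:
  assumes "z \<in> X" "open U" "z \<in> U"
  shows "\<not> C2_on U sol"
proof
  assume "C2_on U sol"
  then have "grad sol differentiable (at z)"
    using assms by (simp add: C2_on_def differentiable_on_eq_differentiable_at)
  then obtain D where D: "(sol_grad has_derivative D) (at z)"
    unfolding grad_sol differentiable_def by blast
  define D' where "D' h = D h - (6 *\<^sub>R L z) *v h" for h
  have "((\<lambda>y. sol_grad y - 3 *\<^sub>R mul y y) has_derivative D') (at z)"
    unfolding D'_def by (intro has_derivative_diff D mul_self_has_derivative)
  then have der: "(bump1 z has_derivative D') (at z)"
  proof (rule has_derivative_transform_within_open[OF _ open_ball[of z "\<rho> z"]])
    show "z \<in> ball z (\<rho> z)" using \<rho>_pos[OF assms(1)] by simp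
    show "sol_grad y - 3 *\<^sub>R mul y y = bump1 z y" if "y \<in> ball z (\<rho> z)" for y
      using that patch_in[OF assms(1)] by (simp add: sol_grad_def)
  qed
  \<comment> \<open>This vector stands for the matrix diag(1, 1, -2), where \<open>cubic\<close>
    attains its minimum -1 on the unit sphere.\<close>
  define v :: "real ^ 5" where "v = axis 2 1"
  have v: "v \<bullet> v = 1" "cubic v = - 1"
    by (simp_all add: v_def cubic_def mul_def inner_5 axis_def)
  have "((\<lambda>h. z + h *\<^sub>R v) has_derivative (\<lambda>k. k *\<^sub>R v)) (at 0)"
    by (auto intro!: derivative_eq_intros)
  moreover have "(bump1 z has_derivative D') (at (z + 0 *\<^sub>R v))"
    using der by simp
  ultimately have "((\<lambda>h. bump1 z (z + h *\<^sub>R v)) has_derivative (\<lambda>k. D' (k *\<^sub>R v))) (at 0)"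
    by (rule has_derivative_compose)
  then have "((\<lambda>h. bump1 z (z + h *\<^sub>R v) \<bullet> v) has_derivative (\<lambda>k. D' (k *\<^sub>R v) \<bullet> v)) (at 0)"
    by (rule has_derivative_inner_left)
  moreover have "D' (k *\<^sub>R v) \<bullet> v = (D' v \<bullet> v) * k" for k
    using linear_scale[OF has_derivative_linear[OF der]] by simp
  ultimately have "((\<lambda>h. bump1 z (z + h *\<^sub>R v) \<bullet> v) has_real_derivative (D' v \<bullet> v)) (at 0)"
    by (simp add: has_field_derivative_def)
  then have lim: "((\<lambda>h. bump1 z (z + h *\<^sub>R v) \<bullet> v / h) \<longlongrightarrow> D' v \<bullet> v) (at 0)"
    by (simp add: DERIV_def bump1_def rescale_def bump_0)
  define R where "R = \<rho> z"
  have R: "0 < R" using \<rho>_pos[OF assms(1)] by (simp add: R_def)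
  \<comment> \<open>At distance s from the origin along the line of v, the v-component of
    \<open>bump_grad\<close> is s q(s). Here q(0) = -3 + 1 = -2: the first profile contributes -3
    and the second +1.\<close>
  define q where "q s = - 3 * (1 - s * tay (s\<^sup>2)) - 2 * (- 1 / 2 - s ^ 3 * tay1 (s\<^sup>2))" for s
  have val: "bump1 z (z + h *\<^sub>R v) \<bullet> v = \<delta> * R * \<bar>h\<bar> * q (\<bar>h\<bar> / R)" if "h \<noteq> 0" "\<bar>h\<bar> < R" for h
  proof -
    define s where "s = \<bar>h\<bar> / R"
    have s: "0 < s" "s < 1" using that R by (simp_all add: s_def)
    have s2: "(h / R)\<^sup>2 = s\<^sup>2" by (simp add: s_def power_divide)
    have lt: "s\<^sup>2 < 1" using s by (simp add: power_less_one_iff)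
    define k where "k = h / R"
    have kk: "(k *\<^sub>R v) \<bullet> (k *\<^sub>R v) = k\<^sup>2"
      using v by (simp add: power2_eq_square)
    have c: "cubic (k *\<^sub>R v) = - (k ^ 3)"
      using v by (simp add: cubic_def mul_algebra power3_eq_cube)
    have m: "mul (k *\<^sub>R v) (k *\<^sub>R v) \<bullet> v = - k\<^sup>2"
      using v(2) by (simp add: cubic_def mul_algebra power2_eq_square)
    have "bump_grad (k *\<^sub>R v) \<bullet> v = 3 * prof (k\<^sup>2) * - k\<^sup>2 - 2 * k ^ 3 * prof1 (k\<^sup>2) * k"
      unfolding bump_grad_def kk c by (simp add: inner_add_left inner_diff_left m v(1) del: scaleR_scaleR)
    moreover have "bump1 z (z + h *\<^sub>R v) = (\<delta> * R\<^sup>2) *\<^sub>R bump_grad (k *\<^sub>R v)"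
      by (simp add: bump1_def rescale_def R_def k_def)
    moreover have "k ^ 3 * P * k = k\<^sup>2 * k\<^sup>2 * P" for P
      by (simp add: power3_eq_cube power2_eq_square)
    moreover have "k\<^sup>2 = s\<^sup>2" using s2 by (simp add: k_def)
    ultimately have "bump1 z (z + h *\<^sub>R v) \<bullet> v = \<delta> * R\<^sup>2 * (- 3 * prof (s\<^sup>2) * s\<^sup>2 - 2 * (s\<^sup>2 * s\<^sup>2 *
      prof1 (s\<^sup>2)))"
      by (simp add: mult.assoc)
    also have "- 3 * prof (s\<^sup>2) * s\<^sup>2 - 2 * (s\<^sup>2 * s\<^sup>2 * prof1 (s\<^sup>2)) = s * q s"
      using s lt by (simp add: prof_def prof1_def q_def field_simps power2_eq_square power3_eq_cube)
    also have "\<delta> * R\<^sup>2 * (s * q s) = \<delta> * R * \<bar>h\<bar> * q s"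
      using R by (simp add: s_def power2_eq_square)
    finally show ?thesis by (simp add: s_def)
  qed
  have q0: "((\<lambda>h. q (\<bar>h\<bar> / R)) \<longlongrightarrow> - 2) (at 0 within S)" for S
    unfolding q_def tay_def tay1_def using R by (auto intro!: tendsto_eq_intros)
  have right: "((\<lambda>h. bump1 z (z + h *\<^sub>R v) \<bullet> v / h) \<longlongrightarrow> \<delta> * R * - 2) (at_right 0)"
  proof (rule Lim_transform_eventually)
    show "((\<lambda>h. \<delta> * R * q (\<bar>h\<bar> / R)) \<longlongrightarrow> \<delta> * R * - 2) (at_right 0)"
      by (intro tendsto_intros q0)
    show "\<forall>\<^sub>F h in at_right 0. \<delta> * R * q (\<bar>h\<bar> / R) = bump1 z (z + h *\<^sub>R v) \<bullet> v / h"
      unfolding eventually_at_right_field using R val by (intro exI[of _ R]) auto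
  qed
  have left: "((\<lambda>h. bump1 z (z + h *\<^sub>R v) \<bullet> v / h) \<longlongrightarrow> - (\<delta> * R * - 2)) (at_left 0)"
  proof (rule Lim_transform_eventually)
    show "((\<lambda>h. - (\<delta> * R * q (\<bar>h\<bar> / R))) \<longlongrightarrow> - (\<delta> * R * - 2)) (at_left 0)"
      by (intro tendsto_intros q0)
    show "\<forall>\<^sub>F h in at_left 0. - (\<delta> * R * q (\<bar>h\<bar> / R)) = bump1 z (z + h *\<^sub>R v) \<bullet> v / h"
      unfolding eventually_at_left_field using R val by (intro exI[of _ "- R"]) auto
  qed
  have lims: "((\<lambda>h. bump1 z (z + h *\<^sub>R v) \<bullet> v / h) \<longlongrightarrow> D' v \<bullet> v) (at_right 0)"
    "((\<lambda>h. bump1 z (z + h *\<^sub>R v) \<bullet> v / h) \<longlongrightarrow> D' v \<bullet> v) (at_left 0)"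
    using lim by (simp_all add: filterlim_at_split)
  have "\<delta> * R * - 2 = - (\<delta> * R * - 2)"
    using tendsto_unique[OF trivial_limit_at_right_real right lims(1)]
      tendsto_unique[OF trivial_limit_at_left_real left lims(2)] by (rule trans[OF _ sym])
  then show False
    using R \<delta>(1) by simp
qed

text \<open>A point of \<open>K\<close> is singular only by accumulation: each of its neighbourhoods
  contains a centre, where \<open>not_C2_on_center\<close> applies.\<close>

lemma Sing_sol: "Sing (ball 0 1) sol = (K \<union> X) \<inter> ball 0 1"
proof safe
  fix x assume x: "x \<in> Sing (ball 0 1) sol"
  show "x \<in> ball 0 1" using x by (simp add: Sing_def)
  assume "x \<notin> X"
  show "x \<in> K"
  proof (rule ccontr)
    assume "x \<notin> K"
    then obtain U where U: "open U" "x \<in> U" "U \<inter> (K \<union> X) = {}"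
      using regular_neighbourhood \<open>x \<notin> X\<close> by metis
    have "C2_on (U \<inter> ball 0 1) sol"
      by (rule C2_on_sol) (use U in auto)
    moreover have "open (U \<inter> ball 0 1)" "x \<in> U \<inter> ball 0 1" "U \<inter> ball 0 1 \<subseteq> ball 0 1"
      using U x by (auto simp: Sing_def)
    ultimately show False
      using x unfolding Sing_def by blast
  qed
next
  fix x :: "real ^ 5" assume "x \<in> ball 0 1" "x \<in> X"
  then show "x \<in> Sing (ball 0 1) sol"
    using not_C2_on_center by (auto simp: Sing_def)
next
  fix x :: "real ^ 5" assume x: "x \<in> ball 0 1" "x \<in> K"
  have "\<not> C2_on U sol" if U: "open U" "x \<in> U" for U
  proof -
    have "x \<in> closure X" using dense x by blast
    then obtain z where "z \<in> X" "z \<in> U"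
      using U by (metis closure_iff_nhds_not_empty disjoint_iff subset_refl)
    then show ?thesis using not_C2_on_center U by blast
  qed
  with x show "x \<in> Sing (ball 0 1) sol" by (auto simp: Sing_def)
qed

lemma form_bump2_le:
  assumes "z \<in> X"
  shows "\<bar>form (bump2 z x) e\<bar> \<le> 96 * \<delta> * max 0 (\<rho> z - dist z x) * (e \<bullet> e)"
proof -
  have R: "0 < \<rho> z" by (rule \<rho>_pos[OF assms])
  have "\<bar>form (bump_hess (rescale z x)) e\<bar> \<le> norm e * norm (bump_hess (rescale z x) *v e)"
    by (rule Cauchy_Schwarz_ineq2)
  also have "\<dots> \<le> norm e * (96 * max 0 (1 - norm (rescale z x)) * norm e)"
    by (intro mult_left_mono bump_hess_le) auto
  also have "\<dots> = 96 * max 0 (1 - dist z x / \<rho> z) * (e \<bullet> e)"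
    by (simp add: norm_rescale[OF assms] dot_square_norm power2_eq_square)
  finally have "\<delta> * \<rho> z * \<bar>form (bump_hess (rescale z x)) e\<bar>
    \<le> \<delta> * \<rho> z * (96 * max 0 (1 - dist z x / \<rho> z) * (e \<bullet> e))"
    using \<delta>(1) R by (intro mult_left_mono) auto
  also have "\<dots> = 96 * \<delta> * (\<rho> z * max 0 (1 - dist z x / \<rho> z)) * (e \<bullet> e)"
    by simp
  also have "\<rho> z * max 0 (1 - dist z x / \<rho> z) = max 0 (\<rho> z - dist z x)"
    using R by (simp add: max_def field_simps)
  finally show ?thesis
    using \<delta>(1) R by (simp add: bump2_def form_scaleR abs_mult)
qed

text \<open>If y lies outside the ball containing x, then \<rho> z - dist z x \<le> |x - y|, and the
  Hessian is bounded by a multiple of the left side.\<close>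

lemma form_patch_bump2_le:
  assumes "\<And>z. z \<in> X \<Longrightarrow> dist z x < \<rho> z \<Longrightarrow> \<rho> z \<le> dist z y"
  shows "\<bar>form (patch bump2 x) e\<bar> \<le> 96 * \<delta> * norm (x - y) * (e \<bullet> e)"
proof (cases "\<exists>z\<in>X. dist z x < \<rho> z")
  case True
  then obtain z where z: "z \<in> X" "dist z x < \<rho> z" by blast
  have "max 0 (\<rho> z - dist z x) \<le> norm (x - y)"
    using assms[OF z] dist_triangle[of z y x] by (simp add: dist_norm)
  then have "96 * \<delta> * max 0 (\<rho> z - dist z x) * (e \<bullet> e) \<le> 96 * \<delta> * norm (x - y) * (e \<bullet> e)"
    using \<delta>(1) by (intro mult_right_mono mult_left_mono) auto
  then show ?thesis
    using form_bump2_le[OF z(1), where x = x and e = e] by (simp add: patch_in[OF z])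
next
  case False
  then have "patch bump2 x = 0" by (intro patch_out) force
  then show ?thesis using \<delta>(1) by simp
qed

text \<open>In a common ball, linearity of \<open>L\<close> allows recentring at z, which gives a
  difference of \<open>H t\<close> with t = \<delta> \<rho> plus the Taylor error. Otherwise t = 0
  is used and both bump Hessians are errors bounded by the distance of the points.\<close>

lemma sol_hess_difference:
  assumes "form_le (sol_hess x - sol_hess y) c"
  shows "1 / 69 * (trace (sol_hess y) - trace (sol_hess x)) \<le> c"
proof (cases "\<exists>z\<in>X. dist z x < \<rho> z \<and> dist z y < \<rho> z")
  case True
  then obtain z where z: "z \<in> X" "dist z x < \<rho> z" "dist z y < \<rho> z" by blast
  have R: "0 < \<rho> z" by (rule \<rho>_pos[OF z(1)])
  define t where "t = \<delta> * \<rho> z"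
  define E where "E = - t *\<^sub>R (taylor_hess (rescale z x) - taylor_hess (rescale z y))"
  have b: "bump2 z w = t *\<^sub>R W (w - z) - t *\<^sub>R taylor_hess (rescale z w)" if "dist z w < \<rho> z" for w
  proof -
    have "norm (rescale z w) < 1"
      using that R by (simp add: norm_rescale[OF z(1)])
    moreover have "W (rescale z w) = W (w - z)"
      using R by (simp add: W_def rescale_def sgn_scaleR)
    ultimately show ?thesis
      by (simp add: bump2_def bump_hess_eq t_def scaleR_diff_right)
  qed
  have eq: "sol_hess x - sol_hess y = H t (x - z) - H t (y - z) + E"
    by (simp add: sol_hess_def patch_in[OF z(1,2)] patch_in[OF z(1,3)] b z H_def E_def L_diff algebra_simps)
  have E: "\<bar>form E e\<bar> \<le> 1 / 64 * norm ((x - z) - (y - z)) * (e \<bullet> e)" for e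
  proof -
    have "\<bar>form E e\<bar> = \<rho> z * (\<delta> * \<bar>form (taylor_hess (rescale z x) - taylor_hess (rescale z y)) e\<bar>)"
      using R \<delta>(1) form_scaleR[of e "- t"] by (simp add: E_def t_def abs_mult)
    also have "\<dots> \<le> \<rho> z * (1 / 64 * norm (rescale z x - rescale z y) * (e \<bullet> e))"
      using R z by (intro mult_left_mono \<delta>(3)) (auto simp: norm_rescale[OF z(1)])
    finally show ?thesis
      using R by (simp add: rescale_diff[OF z(1)])
  qed
  have "0 \<le> t" using R \<delta>(1) by (simp add: t_def)
  from H_difference_perturbed[OF this E assms[unfolded eq]]
  show ?thesis
    unfolding eq[symmetric] trace_sub by simp
next
  case False
  define E where "E = patch bump2 x - patch bump2 y"
  have eq: "sol_hess x - sol_hess y = H 0 x - H 0 y + E"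
    by (simp add: sol_hess_def H_def E_def)
  have E: "\<bar>form E e\<bar> \<le> 1 / 64 * norm (x - y) * (e \<bullet> e)" for e
  proof -
    have "\<bar>form (patch bump2 x) e\<bar> \<le> 96 * \<delta> * norm (x - y) * (e \<bullet> e)"
      using False by (intro form_patch_bump2_le) force
    moreover have "\<bar>form (patch bump2 y) e\<bar> \<le> 96 * \<delta> * norm (y - x) * (e \<bullet> e)"
      using False by (intro form_patch_bump2_le) force
    ultimately have "\<bar>form E e\<bar> \<le> (\<delta> * 192) * (norm (x - y) * (e \<bullet> e))"
      unfolding E_def form_diff norm_minus_commute[of y x] by (simp add: algebra_simps)
    also have "\<dots> \<le> 1 / 64 * (norm (x - y) * (e \<bullet> e))"
      using \<delta>(2) by (intro mult_right_mono) auto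
    finally show ?thesis by (simp add: mult.assoc)
  qed
  from H_difference_perturbed[OF order_refl E assms[unfolded eq]]
  show ?thesis
    unfolding eq[symmetric] trace_sub by simp
qed

lemma cubic_second_difference: "cubic (x + d) + cubic (x - d) - 2 * cubic x = 6 * form (L x) d"
  using cubic_add[of x d] cubic_add[of x "- d"] mul_inner[of d x d]
  by (simp add: cubic_minus mul_algebra L_mult_vec mul_commute[of d x] inner_commute)

text \<open>Off the singular points this is the C^2 case. At a centre the odd bump cancels and only
  the cubic remains; on \<open>K\<close> the bumps contribute O(h^3), which vanishes after division
  by h^2.\<close>

lemma sol_second_difference:
  "((\<lambda>h. (sol (x + h *\<^sub>R e) + sol (x - h *\<^sub>R e) - 2 * sol x) / h\<^sup>2) \<longlongrightarrow> form (sol_hess x) e) (at_right 0)"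
proof -
  have cub: "cubic (x + h *\<^sub>R e) + cubic (x - h *\<^sub>R e) - 2 * cubic x = h\<^sup>2 * form (6 *\<^sub>R L x) e" for h
    by (simp only: cubic_second_difference form_scaleR) (simp add: matrix_vector_mult_scaleR power2_eq_square)
  consider "x \<notin> K" "x \<notin> X" | "x \<in> X" | "x \<in> K" by blast
  then show ?thesis
  proof cases
    case 1
    then obtain U where "open U" "x \<in> U" "U \<inter> (K \<union> X) = {}"
      using regular_neighbourhood by metis
    then show ?thesis
      using second_difference[of U x sol e] C2_on_sol[of U] hessian_sol[OF 1] by simp
  next
    case 2
    have hess: "sol_hess x = 6 *\<^sub>R L x"
      using patch_in[OF 2, of x bump2] \<rho>_pos[OF 2] by (simp add: sol_hess_def bump2_def rescale_def
        bump_hess_0)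
    have "((\<lambda>h. dist x (x + h *\<^sub>R e)) \<longlongrightarrow> dist x (x + 0 *\<^sub>R e)) (at_right 0)"
      by (intro tendsto_intros)
    then have "\<forall>\<^sub>F h in at_right 0. dist x (x + h *\<^sub>R e) < \<rho> x"
      using \<rho>_pos[OF 2] by (intro order_tendstoD(2)) auto
    then have "\<forall>\<^sub>F h in at_right 0. form (6 *\<^sub>R L x) e = (sol (x + h *\<^sub>R e)
      + sol (x - h *\<^sub>R e) - 2 * sol x) / h\<^sup>2"
      using eventually_at_right_less[of 0]
    proof eventually_elim
      case (elim h)
      then have "dist x (x - h *\<^sub>R e) < \<rho> x" by (simp add: dist_norm)
      moreover have "bump0 x (x + h *\<^sub>R e) + bump0 x (x - h *\<^sub>R e) = 0"
        using bump_minus[of "(h / \<rho> x) *\<^sub>R e"] by (simp add: bump0_def rescale_def)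
      moreover have "bump0 x x = 0" by (simp add: bump0_def rescale_def bump_0)
      ultimately have "sol (x + h *\<^sub>R e) + sol (x - h *\<^sub>R e) - 2 * sol x = h\<^sup>2 * form (6 *\<^sub>R L x) e"
        using elim cub[of h] patch_in[OF 2, of _ bump0] \<rho>_pos[OF 2] by (simp add: sol_def)
      then show ?case using elim by simp
    qed
    then show ?thesis
      unfolding hess by (rule Lim_transform_eventually[OF tendsto_const])
  next
    case 3
    have hess: "sol_hess x = 6 *\<^sub>R L x" and sol: "sol x = cubic x"
      by (simp_all add: sol_hess_def sol_def patch_K[OF 3])
    have small: "\<bar>patch bump0 (x + d)\<bar> \<le> 4 * \<delta> * norm d ^ 3" for d
    proof -
      obtain r where "0 \<le> r" "r \<le> norm (x + d - x)" "\<bar>patch bump0 (x + d)\<bar> \<le> 4 * \<delta> * r ^ 3"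
        using patch_bump0_small[OF 3, of "x + d"] by metis
      moreover from this have "4 * \<delta> * r ^ 3 \<le> 4 * \<delta> * norm d ^ 3"
        using \<delta>(1) by (intro mult_left_mono power_mono) auto
      ultimately show ?thesis by simp
    qed
    have "((\<lambda>h. (sol (x + h *\<^sub>R e) + sol (x - h *\<^sub>R e) - 2 * sol x) / h\<^sup>2 - form (6 *\<^sub>R L x) e)
      \<longlongrightarrow> 0) (at_right 0)"
    proof (rule Lim_null_comparison)
      show "((\<lambda>h. 8 * \<delta> * norm e ^ 3 * h) \<longlongrightarrow> 0) (at_right 0)"
        by (auto intro!: tendsto_eq_intros)
      show "\<forall>\<^sub>F h in at_right 0. norm ((sol (x + h *\<^sub>R e) + sol (x - h *\<^sub>R e) - 2 * sol x) / h\<^sup>2 - form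
        (6 *\<^sub>R L x) e) \<le> 8 * \<delta> * norm e ^ 3 * h"
        using eventually_at_right_less[of 0]
      proof eventually_elim
        case (elim h)
        define p where "p = patch bump0 (x + h *\<^sub>R e) + patch bump0 (x + (- h) *\<^sub>R e)"
        have "\<bar>p\<bar> \<le> 4 * \<delta> * norm (h *\<^sub>R e) ^ 3 + 4 * \<delta> * norm ((- h) *\<^sub>R e) ^ 3"
          unfolding p_def by (intro order_trans[OF abs_triangle_ineq] add_mono small)
        then have p: "\<bar>p\<bar> \<le> 8 * \<delta> * norm e ^ 3 * h * h\<^sup>2"
          using elim by (simp add: power_mult_distrib power2_eq_square power3_eq_cube mult_ac)
        have "sol (x + h *\<^sub>R e) + sol (x - h *\<^sub>R e) - 2 * sol x = h\<^sup>2 * form (6 *\<^sub>R L x) e + p"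
          using cub[of h] by (simp add: sol p_def) (simp add: sol_def)
        then have "(sol (x + h *\<^sub>R e) + sol (x - h *\<^sub>R e) - 2 * sol x) / h\<^sup>2 - form (6 *\<^sub>R L x) e = p / h\<^sup>2"
          using elim by (simp add: add_divide_distrib)
        moreover have "\<bar>p\<bar> / h\<^sup>2 \<le> 8 * \<delta> * norm e ^ 3 * h"
          using p elim by (simp add: divide_le_eq)
        ultimately show ?case by simp
      qed
    qed
    then show ?thesis
      unfolding hess by (rule LIM_zero_cancel)
  qed
qed

lemma countable_X: "countable X"
proof -
  have disj: "ball z (\<rho> z) \<inter> ball w (\<rho> w) = {}" if "z \<in> X" "w \<in> X" "z \<noteq> w" for z w
    using center_unique'[OF that(1,2)] that(3) by auto
  have "countable ((\<lambda>z. ball z (\<rho> z)) ` X)"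
    by (rule countable_disjoint_open_subsets) (use disj in \<open>auto simp: pairwise_def disjnt_def\<close>)
  moreover have "inj_on (\<lambda>z. ball z (\<rho> z)) X"
  proof (rule inj_onI)
    fix z w assume "z \<in> X" "w \<in> X" "ball z (\<rho> z) = ball w (\<rho> w)"
    then show "z = w"
      using disj[of z w] \<rho>_pos[of w] by (metis Int_absorb ball_eq_empty not_less)
  qed
  ultimately show ?thesis by (rule countable_image_inj_on)
qed

lemma elliptic_solution:
  obtains F where "uniformly_elliptic F" "viscosity_solution F (ball 0 1) sol"
proof -
  have ne: "ball (0 :: real ^ 5) 1 \<noteq> {}" by simp
  obtain F where F: "uniformly_elliptic F"
    "\<And>x M. x \<in> ball 0 1 \<Longrightarrow> (\<And>e. form (sol_hess x) e \<le> form M e) \<Longrightarrow> 0 \<le> F M"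
    "\<And>x M. x \<in> ball 0 1 \<Longrightarrow> (\<And>e. form M e \<le> form (sol_hess x) e) \<Longrightarrow> F M \<le> 0"
    using elliptic_operator_exists[OF ne, of "1 / 69" sol_hess] sol_hess_difference by auto
  have "continuous_on (ball 0 1) sol"
    using sol_has_derivative by (intro continuous_at_imp_continuous_on ballI) (blast intro:
      has_derivative_continuous)
  then have "viscosity_solution F (ball 0 1) sol"
    using sol_second_difference F(2,3)
    by (intro viscosity_solution_of_second_differences[where A = sol_hess, OF _ open_ball]) blast+
  with F(1) that show ?thesis by blast
qed

end

text \<open>A maximal separated set exists by Zorn's lemma. If a point of \<open>K\<close> were far
  from it, empty interior would provide a nearby point outside \<open>K\<close> that could be
  added.\<close>

lemma separated_set_exists:
  fixes K :: "'a :: metric_space set"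
  assumes "K \<noteq> {}" "interior K = {}"
  obtains X where "X \<noteq> {}" "X \<inter> K = {}"
    "\<And>z w. z \<in> X \<Longrightarrow> w \<in> X \<Longrightarrow> z \<noteq> w \<Longrightarrow> 4 * radius K z \<le> dist z w" "K \<subseteq> closure X"
proof -
  define \<A> where "\<A> = {X. X \<inter> K = {} \<and> (\<forall>z\<in>X. \<forall>w\<in>X. z \<noteq> w \<longrightarrow> 4 * radius K z \<le> dist z w)}"
  have "\<exists>X\<in>\<A>. \<forall>Y\<in>\<A>. X \<subseteq> Y \<longrightarrow> Y = X"
  proof (rule subset_Zorn')
    fix C assume C: "subset.chain \<A> C"
    have "4 * radius K z \<le> dist z w" if zw: "z \<in> \<Union>C" "w \<in> \<Union>C" "z \<noteq> w" for z w
    proof -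
      obtain Y Z where "Y \<in> C" "z \<in> Y" "Z \<in> C" "w \<in> Z" using zw by blast
      moreover have "Y \<subseteq> Z \<or> Z \<subseteq> Y" using C calculation by (auto simp: subset_chain_def)
      ultimately obtain V where "V \<in> C" "z \<in> V" "w \<in> V" by blast
      then show ?thesis using C zw(3) by (auto simp: subset_chain_def \<A>_def)
    qed
    moreover have "\<Union>C \<inter> K = {}" using C by (auto simp: subset_chain_def \<A>_def)
    ultimately show "\<Union>C \<in> \<A>" by (auto simp: \<A>_def)
  qed
  then obtain X where X: "X \<in> \<A>" and max: "\<And>Y. Y \<in> \<A> \<Longrightarrow> X \<subseteq> Y \<Longrightarrow> Y = X" by blast
  have "K \<subseteq> closure X"
  proof
    fix x assume x: "x \<in> K"
    show "x \<in> closure X"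
      unfolding closure_approachable
    proof (intro allI impI)
      fix e :: real assume "0 < e"
      then have "\<not> ball x (e / 3) \<subseteq> K"
        using assms(2) interior_maximal[of "ball x (e / 3)" K] by auto
      then obtain y where y: "dist x y < e / 3" "y \<notin> K"
        unfolding subset_iff mem_ball by blast
      show "\<exists>w\<in>X. dist w x < e"
      proof (cases "y \<in> X")
        case True
        then show ?thesis using y \<open>0 < e\<close> by (intro bexI[of _ y]) (auto simp: dist_commute)
      next
        case False
        then have "insert y X \<notin> \<A>" using max[of "insert y X"] by blast
        then obtain w where w: "w \<in> X" "\<not> 4 * radius K y \<le> dist y w \<or> \<not> 4 * radius K w \<le> dist y w"
          using X y by (auto simp: \<A>_def dist_commute)
        \<comment> \<open>Since 4/8 = 1/2, the separation failing in either order gives dist y w <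
          \<open>infdist y K\<close>: a bound by half of \<open>infdist w K\<close> costs at most
          half of dist y w, which is absorbed.\<close>
        have "min 1 (infdist w K) \<le> min 1 (infdist y K) + dist y w"
          using infdist_triangle[of w K y] zero_le_dist[of y w] unfolding dist_commute[of w y] by linarith
        moreover have "infdist y K \<le> dist x y"
          using infdist_le[OF x, of y] by (simp add: dist_commute)
        ultimately have "dist y w \<le> dist x y"
          using w(2) zero_le_dist[of x y] unfolding radius_def by linarith
        then show ?thesis
          using w(1) y dist_triangle[of w x y] \<open>0 < e\<close> by (intro bexI[of _ w]) (auto simp: dist_commute)
      qed
    qed
  qed
  moreover from this have "X \<noteq> {}" using assms(1) by auto
  ultimately show ?thesis using X that[of X] by (auto simp: \<A>_def)
qed

theorem singular_solution_exists:
  fixes K :: "(real ^ 5) set"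
  assumes "closed K" "K \<noteq> {}" "interior K = {}"
  obtains X u F where "countable X" "C11_on (ball 0 1) u" "uniformly_elliptic F"
    "viscosity_solution F (ball 0 1) u" "Sing (ball 0 1) u = (K \<union> X) \<inter> ball 0 1"
proof -
  obtain X where X: "X \<noteq> {}" "X \<inter> K = {}"
    "\<And>z w. z \<in> X \<Longrightarrow> w \<in> X \<Longrightarrow> z \<noteq> w \<Longrightarrow> 4 * radius K z \<le> dist z w" "K \<subseteq> closure X"
    using separated_set_exists[OF assms(2,3)] by metis
  obtain C where C: "0 \<le> C" "\<And>x y e. norm x \<le> 1 \<Longrightarrow> norm y \<le> 1 \<Longrightarrow>
    \<bar>form (taylor_hess x - taylor_hess y) e\<bar> \<le> C * norm (x - y) * (e \<bullet> e)"
    by (rule taylor_hess_lipschitz) blast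
  define \<delta> where "\<delta> = 1 / (64 * (C + 192))"
  have \<delta>: "0 < \<delta>" "\<delta> * 192 \<le> 1 / 64" "\<delta> * C \<le> 1 / 64"
    using C(1) by (simp_all add: \<delta>_def field_simps)
  interpret bubbles K X \<delta>
  proof
    fix x y e :: "real ^ 5" assume "norm x \<le> 1" "norm y \<le> 1"
    then have "\<delta> * \<bar>form (taylor_hess x - taylor_hess y) e\<bar> \<le> \<delta> * (C * norm (x - y) * (e \<bullet> e))"
      using \<delta>(1) by (intro mult_left_mono C(2)) auto
    also have "\<dots> = \<delta> * C * (norm (x - y) * (e \<bullet> e))" by simp
    also have "\<dots> \<le> 1 / 64 * (norm (x - y) * (e \<bullet> e))"
      using \<delta>(3) by (intro mult_right_mono) auto
    finally show "\<delta> * \<bar>form (taylor_hess x - taylor_hess y) e\<bar> \<le> 1 / 64 * norm (x - y) * (e \<bullet> e)"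
      by (simp add: mult.assoc)
  qed (use assms X \<delta> in auto)
  show ?thesis
    using elliptic_solution that[OF countable_X C11_on_sol _ _ Sing_sol] by metis
qed

subsection \<open>Hausdorff measure of countably perturbed sets\<close>

lemma diam_pow_singleton: "0 < s \<Longrightarrow> diam_pow s {x} = 0"
  by (simp add: diam_pow_def)

text \<open>The covering sequence lists the finite family and then the points of \<open>X\<close> as
  singletons, which cost nothing since s > 0.\<close>

lemma hausdorff_premeasure_le_cover:
  assumes "0 < s" "0 < \<delta>" "finite J" "countable X" and cover: "A \<subseteq> (\<Union>j\<in>J. V j) \<union> X"
    and small: "\<And>j. j \<in> J \<Longrightarrow> bounded (V j) \<and> diameter (V j) \<le> \<delta>"
  shows "hausdorff_premeasure s \<delta> A \<le> (\<Sum>j\<in>J. diam_pow s (V j))"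
proof -
  obtain f where f: "bij_betw f {..<card J} J"
    using ex_bij_betw_nat_finite[OF assms(3)] by (auto simp: atLeast0LessThan)
  define U where "U i = (if i < card J then V (f i) else {from_nat_into X (i - card J)})" for i
  have "A \<subseteq> (\<Union>i. U i)"
  proof
    fix a assume "a \<in> A"
    then consider j where "j \<in> J" "a \<in> V j" | "a \<in> X" using cover by blast
    then show "a \<in> (\<Union>i. U i)"
    proof cases
      case 1
      then obtain i where "i < card J" "f i = j"
        using f by (metis bij_betw_imp_surj_on imageE lessThan_iff)
      then show ?thesis using 1 by (auto simp: U_def intro!: exI[of _ i])
    next
      case 2
      then obtain n where "from_nat_into X n = a"
        using from_nat_into_surj[OF assms(4)] by blast
      then show ?thesis by (auto simp: U_def intro!: exI[of _ "card J + n"])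
    qed
  qed
  moreover have "bounded (U i) \<and> diameter (U i) \<le> \<delta>" for i
    using small[of "f i"] f assms(2) by (auto simp: U_def bij_betw_apply)
  ultimately have "hausdorff_premeasure s \<delta> A \<le> (\<Sum>i. diam_pow s (U i))"
    unfolding hausdorff_premeasure_def by (intro INF_lower) auto
  also have "\<dots> = (\<Sum>i<card J. diam_pow s (U i))"
    by (intro suminf_finite) (auto simp: U_def diam_pow_singleton assms(1))
  also have "\<dots> = (\<Sum>i<card J. diam_pow s (V (f i)))"
    by (intro sum.cong) (auto simp: U_def)
  also have "\<dots> = (\<Sum>j\<in>J. diam_pow s (V j))"
    using sum.reindex_bij_betw[OF f, of "\<lambda>j. diam_pow s (V j)"] by simp
  finally show ?thesis .
qed

lemma hausdorff_measure_countable: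
  assumes "0 < s" "countable A"
  shows "hausdorff_measure s A = 0"
proof -
  have "hausdorff_premeasure s \<delta> A \<le> 0" if "0 < \<delta>" for \<delta>
    using hausdorff_premeasure_le_cover[OF assms(1) that, of "{} :: nat set" A A] assms(2) by simp
  then show ?thesis
    by (simp add: hausdorff_measure_def SUP_eq_iff)
qed

lemma hausdorff_measure_ge:
  assumes "\<And>U :: nat \<Rightarrow> _ set. A \<subseteq> (\<Union>i. U i) \<Longrightarrow> (\<And>i. bounded (U i)) \<Longrightarrow> c \<le> (\<Sum>i. diam_pow s (U i))"
  shows "c \<le> hausdorff_measure s A"
proof -
  have "c \<le> hausdorff_premeasure s 1 A"
    unfolding hausdorff_premeasure_def by (rule INF_greatest) (use assms in auto)
  also have "\<dots> \<le> hausdorff_measure s A"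
    unfolding hausdorff_measure_def by (rule SUP_upper) simp
  finally show ?thesis .
qed

lemma hausdorff_measure_0_ge:
  assumes "A \<noteq> {}"
  shows "1 \<le> hausdorff_measure 0 A"
proof (rule hausdorff_measure_ge)
  fix U :: "nat \<Rightarrow> 'a set" assume "A \<subseteq> (\<Union>i. U i)"
  then obtain i where "U i \<noteq> {}" using assms by blast
  then have "1 = (\<Sum>j\<in>{i}. diam_pow 0 (U j))" by (simp add: diam_pow_def)
  also have "\<dots> \<le> (\<Sum>j. diam_pow 0 (U j))" by (rule sum_le_suminf) auto
  finally show "1 \<le> (\<Sum>j. diam_pow 0 (U j))" .
qed

text \<open>The value at t = s is left open, so that the same criterion serves null sets and sets of
  positive measure.\<close>

lemma hausdorff_dim_eq:
  assumes "0 \<le> s" "\<And>t. s < t \<Longrightarrow> hausdorff_measure t A = 0"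
    "\<And>t. 0 \<le> t \<Longrightarrow> t < s \<Longrightarrow> hausdorff_measure t A \<noteq> 0"
  shows "hausdorff_dim A = ennreal s"
proof (rule antisym)
  show "hausdorff_dim A \<le> ennreal s"
  proof (rule ennreal_le_epsilon)
    fix e :: real assume "0 < e"
    then have "hausdorff_dim A \<le> ennreal (s + e)"
      unfolding hausdorff_dim_def using assms(1) assms(2)[of "s + e"]
      by (intro Inf_lower CollectI exI[of _ "s + e"]) auto
    then show "hausdorff_dim A \<le> ennreal s + ennreal e"
      using assms(1) \<open>0 < e\<close> by simp
  qed
  show "ennreal s \<le> hausdorff_dim A"
    unfolding hausdorff_dim_def
  proof (rule Inf_greatest)
    fix x assume "x \<in> {ennreal t |t. 0 \<le> t \<and> hausdorff_measure t A = 0}"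
    then obtain t where "x = ennreal t" "0 \<le> t" "hausdorff_measure t A = 0" by blast
    then have "s \<le> t" using assms(3)[of t] by force
    with \<open>x = ennreal t\<close> show "ennreal s \<le> x" by (simp add: ennreal_leI)
  qed
qed

subsection \<open>Cantor sets\<close>

(* pre l k b is the left end point of the k-th stage interval (of length l k) containing the point
   with address b, and idx k b is the number of k-th stage intervals to its left. *)
primrec pre :: "(nat \<Rightarrow> real) \<Rightarrow> nat \<Rightarrow> (nat \<Rightarrow> bool) \<Rightarrow> real" where
  "pre l 0 b = 0"
| "pre l (Suc k) b = pre l k b + (if b k then l k - l (Suc k) else 0)"

primrec idx :: "nat \<Rightarrow> (nat \<Rightarrow> bool) \<Rightarrow> nat" where
  "idx 0 b = 0"
| "idx (Suc k) b = 2 * idx k b + (if b k then 1 else 0)"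

definition cantor :: "(nat \<Rightarrow> real) \<Rightarrow> (nat \<Rightarrow> bool) \<Rightarrow> real" where
  "cantor l b = (SUP k. pre l k b)"

lemma idx_less: "idx k b < 2 ^ k"
  by (induction k) auto

text \<open>Equality in \<open>half\<close> is allowed so that the dyadic intervals are an instance;
  genuine gaps appear under the strict inequality assumed in \<open>gap\<close> and
  \<open>interior_cube\<close>.\<close>

locale cantor_lengths =
  fixes l :: "nat \<Rightarrow> real"
  assumes pos: "0 < l k" and half: "2 * l (Suc k) \<le> l k"
begin

lemma l_antimono: "j \<le> k \<Longrightarrow> l k \<le> l j"
proof (induction k rule: dec_induct)
  case (step k)
  then show ?case using half[of k] pos[of "Suc k"] by simp
qed simp

lemma l_le: "l k \<le> l 0 * (1 / 2) ^ k"
proof (induction k)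
  case (Suc k)
  then show ?case using half[of k] by simp
qed simp

lemma l_tendsto_0: "l \<longlonglongrightarrow> 0"
proof (rule tendsto_sandwich)
  show "\<forall>\<^sub>F k in sequentially. 0 \<le> l k" "\<forall>\<^sub>F k in sequentially. l k \<le> l 0 * (1 / 2) ^ k"
    using pos l_le by (auto intro!: always_eventually less_imp_le)
  show "(\<lambda>k. l 0 * (1 / 2) ^ k) \<longlonglongrightarrow> 0"
    by (intro tendsto_mult_right_zero LIMSEQ_power_zero) simp
qed simp

lemma pre_mono: "j \<le> k \<Longrightarrow> pre l j b \<le> pre l k b"
proof (induction k rule: dec_induct)
  case (step k)
  then show ?case using l_antimono[of k "Suc k"] by auto
qed simp

lemma pre_upper_antimono: "j \<le> k \<Longrightarrow> pre l k b + l k \<le> pre l j b + l j"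
proof (induction k rule: dec_induct)
  case (step k)
  then show ?case using l_antimono[of k "Suc k"] by auto
qed simp

lemma pre_le_upper: "pre l j b \<le> pre l k b + l k"
proof -
  have "pre l j b \<le> pre l (max j k) b" by (rule pre_mono) simp
  also have "\<dots> \<le> pre l (max j k) b + l (max j k)" using pos[of "max j k"] by simp
  also have "\<dots> \<le> pre l k b + l k" by (rule pre_upper_antimono) simp
  finally show ?thesis .
qed

lemma cantor_ge: "pre l k b \<le> cantor l b"
  unfolding cantor_def by (rule cSUP_upper) (auto intro!: bdd_aboveI2[of _ _ "pre l 0 b + l 0"] pre_le_upper)

lemma cantor_le: "cantor l b \<le> pre l k b + l k"
  unfolding cantor_def by (rule cSUP_least) (auto intro: pre_le_upper)

text \<open>Intervals of a stage are ordered by index and do not overlap. In the induction a right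
  child is shifted by l k - l (k+1) \<ge> l (k+1); using this in the difference requires the new
  index difference n + \<beta> to be nonnegative.\<close>

lemma pre_diff_ge:
  "idx k c \<le> idx k b \<Longrightarrow> (real (idx k b) - real (idx k c)) * l k \<le> pre l k b - pre l k c"
proof (induction k)
  case (Suc k)
  define n where "n = real (idx k b) - real (idx k c)"
  define \<beta> where "\<beta> = (if b k then 1 else 0) - (if c k then 1 else 0 :: real)"
  have le: "idx k c \<le> idx k b" using Suc.prems by (auto split: if_splits)
  then have "0 \<le> n" by (simp add: n_def)
  have "0 \<le> n + \<beta>"
  proof (cases "idx k c = idx k b")
    case True
    then show ?thesis using Suc.prems by (auto simp: n_def \<beta>_def split: if_splits)
  next
    case False
    then have "1 \<le> n" using le by (simp add: n_def)
    then show ?thesis by (auto simp: \<beta>_def)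
  qed
  then have "(n + \<beta>) * l (Suc k) \<le> (n + \<beta>) * (l k - l (Suc k))"
    using half[of k] by (intro mult_left_mono) auto
  moreover have "n * l k \<le> pre l k b - pre l k c"
    using Suc.IH[OF le] by (simp add: n_def)
  moreover have "real (idx (Suc k) b) - real (idx (Suc k) c) = 2 * n + \<beta>"
    by (simp add: n_def \<beta>_def)
  moreover have "pre l (Suc k) b - pre l (Suc k) c = (pre l k b - pre l k c) + \<beta> * (l k - l (Suc k))"
    by (simp add: \<beta>_def)
  ultimately show ?case
    by (simp add: algebra_simps)
qed simp

lemma pre_eq_of_idx_eq: "idx k b = idx k c \<Longrightarrow> pre l k b = pre l k c"
  using pre_diff_ge[of k b c] pre_diff_ge[of k c b] by simp

lemma cantor_bounds: "0 \<le> cantor l b" "cantor l b \<le> l 0"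
  using cantor_ge[of 0 b] cantor_le[of b 0] by simp_all

end

text \<open>Addresses are now binary expansions. Matching the addresses of another Cantor set with
  these is the Cantor function of that set.\<close>

interpretation dyadic: cantor_lengths "\<lambda>k. (1 / 2) ^ k"
  by unfold_locales auto

lemma pre_dyadic: "pre (\<lambda>k. (1 / 2) ^ k) k b = real (idx k b) / 2 ^ k"
  by (induction k) (simp_all add: field_simps power_divide)

lemma dyadic_surj:
  assumes "0 \<le> x" "x < 1"
  obtains b where "cantor (\<lambda>k. (1 / 2) ^ k) b = x"
proof -
  \<comment> \<open>The digit j + 1 of the binary expansion of x, as the parity of a floor.\<close>
  define b where "b j = odd \<lfloor>2 ^ Suc j * x\<rfloor>" for j
  have idx: "int (idx k b) = \<lfloor>2 ^ k * x\<rfloor>" for k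
  proof (induction k)
    case 0
    then show ?case using assms by (simp add: floor_eq_iff)
  next
    case (Suc k)
    have "\<lfloor>2 ^ Suc k * x\<rfloor> = 2 * \<lfloor>2 ^ k * x\<rfloor> \<or> \<lfloor>2 ^ Suc k * x\<rfloor> = 2 * \<lfloor>2 ^ k * x\<rfloor> + 1"
      by (simp add: mult.assoc) linarith
    then show ?case using Suc by (auto simp: b_def)
  qed
  have "\<bar>cantor (\<lambda>k. (1 / 2) ^ k) b - x\<bar> \<le> (1 / 2) ^ k" for k
  proof -
    have "real (idx k b) = of_int \<lfloor>2 ^ k * x\<rfloor>" using idx[of k] by (metis of_int_of_nat_eq)
    then have "real (idx k b) \<le> 2 ^ k * x" "2 ^ k * x \<le> real (idx k b) + 1" by linarith+
    then have "real (idx k b) / 2 ^ k \<le> x" "x \<le> real (idx k b) / 2 ^ k + (1 / 2) ^ k"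
      by (simp_all add: field_simps power_divide)
    then show ?thesis
      using dyadic.cantor_ge[of k b] dyadic.cantor_le[of b k] unfolding pre_dyadic by linarith
  qed
  then have "\<bar>cantor (\<lambda>k. (1 / 2) ^ k) b - x\<bar> \<le> 0"
    by (intro LIMSEQ_le_const[OF dyadic.l_tendsto_0]) auto
  then show ?thesis using that[of b] by simp
qed

section \<open>Cantor functions and fifth powers of Cantor sets\<close>

context cantor_lengths
begin

text \<open>Points at distance at most l k have stage k indices differing by at most 2, so their
  images differ by at most 3 dyadic lengths. The index shift in the hypothesis arises because a
  distance d lies below the length of one stage and above that of the next.\<close>

lemma cantor_hoelder:
  assumes "0 < \<tau>" and C: "\<And>k. (1 / 2) ^ k \<le> C * l (Suc k) powr \<tau>"
  shows "\<bar>cantor (\<lambda>k. (1 / 2) ^ k) b - cantor (\<lambda>k. (1 / 2) ^ k) c\<bar> \<le> 3 * C * \<bar>cantor l b - cantor l c\<bar> powr \<tau>"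
proof -
  define g where "g = cantor (\<lambda>k. (1 / 2) ^ k)"
  have stage: "g b - g c \<le> 3 * (1 / 2) ^ k" if "\<bar>cantor l b - cantor l c\<bar> \<le> l k" for b c k
  proof -
    have g: "g b - g c \<le> (real (idx k b) - real (idx k c) + 1) * (1 / 2) ^ k"
      using dyadic.cantor_le[of b k] dyadic.cantor_ge[of k c] unfolding pre_dyadic g_def[symmetric]
      by (simp add: field_simps power_divide)
    have "real (idx k b) - real (idx k c) \<le> 2"
    proof (cases "idx k c \<le> idx k b")
      case True
      have "(real (idx k b) - real (idx k c)) * l k \<le> 2 * l k"
        using pre_diff_ge[OF True] that cantor_ge[of k b] cantor_le[of c k] by linarith
      then show ?thesis using pos[of k] by simp
    qed simp
    then have "(real (idx k b) - real (idx k c) + 1) * (1 / 2) ^ k \<le> 3 * (1 / 2) ^ k"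
      by (intro mult_right_mono) auto
    with g show ?thesis by linarith
  qed
  have one: "g b - g c \<le> 3 * C * \<bar>cantor l b - cantor l c\<bar> powr \<tau>" for b c
  proof (cases "cantor l b = cantor l c")
    case True
    have "g b - g c \<le> 3 * (1 / 2) ^ k" for k
      using pos[of k] True by (intro stage) simp
    moreover have lim: "(\<lambda>k. 3 * (1 / 2 :: real) ^ k) \<longlonglongrightarrow> 0"
      by (intro tendsto_mult_right_zero dyadic.l_tendsto_0)
    ultimately have "g b - g c \<le> 0"
      by (intro LIMSEQ_le_const[OF lim]) blast
    with True show ?thesis by simp
  next
    case False
    define d where "d = \<bar>cantor l b - cantor l c\<bar>"
    have "0 < d" using False by (simp add: d_def)
    have "d \<le> l 0"
      using cantor_bounds[of b] cantor_bounds[of c] by (simp add: d_def)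
    have "\<exists>k. l k < d"
      using order_tendstoD(2)[OF l_tendsto_0 \<open>0 < d\<close>] by (auto simp: eventually_sequentially)
    \<comment> \<open>The first stage with length below d; it is not stage 0 because d \<le> l 0, so
      its predecessor j satisfies d \<le> l j.\<close>
    then obtain k where k: "l k < d" "\<And>j. j < k \<Longrightarrow> \<not> l j < d"
      using exists_least_iff[of "\<lambda>k. l k < d"] by blast
    then obtain j where j: "k = Suc j" using \<open>d \<le> l 0\<close> by (cases k) auto
    have "g b - g c \<le> 3 * (1 / 2) ^ j"
      using k(2)[of j] by (intro stage) (simp add: j d_def)
    also have "\<dots> \<le> 3 * (C * l k powr \<tau>)"
      using C[of j] by (simp add: j)
    also have "\<dots> \<le> 3 * (C * d powr \<tau>)"
    proof -
      have "0 < C * l (Suc 0) powr \<tau>" using C[of 0] by simp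
      then have "0 < C" using pos[of "Suc 0"] by (simp add: zero_less_mult_iff)
      moreover have "l k powr \<tau> \<le> d powr \<tau>"
        using k(1) pos[of k] assms(1) by (intro powr_mono2) auto
      ultimately show ?thesis by simp
    qed
    finally show ?thesis by (simp add: d_def mult.assoc)
  qed
  show ?thesis
    using one[of b c] one[of c b] unfolding g_def[symmetric] by (simp add: abs_minus_commute abs_le_iff)
qed

text \<open>Lower measure bounds are proved for \<open>cube\<close> and upper bounds for its
  closure, which avoids any compactness argument for addresses.\<close>

definition cube :: "(real ^ 5) set" where
  "cube = {x. \<exists>b. \<forall>i. x $ i = cantor l (b i)}"

text \<open>The coordinatewise Cantor function has an image covering the open unit cube. Being
  Hoelder of exponent s / 5, it sends a covering set of diameter d into a box of side 6 C d^(s/5),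
  of volume (6 C)^5 d^s. Volume 1 of the unit cube thus bounds the sum of the d^s from
  below.\<close>

lemma cube_positive_measure:
  assumes "0 < s" and C: "\<And>k. (1 / 2) ^ k \<le> C * l (Suc k) powr (s / 5)" and "cube \<subseteq> A"
  shows "0 < hausdorff_measure s A"
proof -
  define g where "g = cantor (\<lambda>k. (1 / 2) ^ k)"
  have "0 < C * l (Suc 0) powr (s / 5)" using C[of 0] by simp
  then have "0 < C" using pos[of "Suc 0"] by (simp add: zero_less_mult_iff)
  define M where "M = (6 * C) ^ 5"
  have "0 < M" using \<open>0 < C\<close> by (simp add: M_def)
  have "ennreal (1 / M) \<le> hausdorff_measure s A"
  proof (rule hausdorff_measure_ge)
    fix U :: "nat \<Rightarrow> (real ^ 5) set"
    assume cover: "A \<subseteq> (\<Union>i. U i)" and bdd: "\<And>i. bounded (U i)"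
    define V where "V i = {y :: real ^ 5. \<exists>b. (\<chi> k. cantor l (b k)) \<in> U i \<and> (\<forall>k. y $ k = g (b k))}" for i
    have box: "\<exists>a. V i \<subseteq> cbox (a - vec (3 * C * diameter (U i) powr (s / 5))) (a
      + vec (3 * C * diameter (U i) powr (s / 5)))" for i
    proof (cases "V i = {}")
      case False
      then obtain a where "a \<in> V i" by blast
      then obtain b where b: "(\<chi> k. cantor l (b k)) \<in> U i" "\<And>k. a $ k = g (b k)" by (auto simp: V_def)
      have "\<bar>y $ k - a $ k\<bar> \<le> 3 * C * diameter (U i) powr (s / 5)" if y: "y \<in> V i" for y k
      proof -
        obtain c where c: "(\<chi> k. cantor l (c k)) \<in> U i" "\<And>k. y $ k = g (c k)"
          using y by (auto simp: V_def)
        have "\<bar>y $ k - a $ k\<bar> \<le> 3 * C * \<bar>cantor l (c k) - cantor l (b k)\<bar> powr (s / 5)"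
          unfolding b(2) c(2) g_def using assms(1) C by (intro cantor_hoelder) auto
        also have "\<bar>cantor l (c k) - cantor l (b k)\<bar> \<le> diameter (U i)"
        proof -
          have "\<bar>cantor l (c k) - cantor l (b k)\<bar> \<le> dist (\<chi> k. cantor l (c k)) (\<chi> k. cantor l (b k))"
            using component_le_norm_cart[of "(\<chi> k. cantor l (c k)) - (\<chi> k. cantor l (b k))" k]
            by (simp add: dist_norm)
          also have "\<dots> \<le> diameter (U i)"
            by (rule diameter_bounded_bound[OF bdd c(1) b(1)])
          finally show ?thesis .
        qed
        then have "\<bar>cantor l (c k) - cantor l (b k)\<bar> powr (s / 5) \<le> diameter (U i) powr (s / 5)"
          using assms(1) by (intro powr_mono2) auto
        finally show ?thesis using \<open>0 < C\<close> by simp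
      qed
      then show ?thesis
        by (intro exI[of _ a]) (force simp: mem_box_cart abs_le_iff algebra_simps)
    qed auto
    then obtain a where a: "\<And>i. V i \<subseteq> cbox (a i - vec (3 * C * diameter (U i) powr (s / 5))) (a i
      + vec (3 * C * diameter (U i) powr (s / 5)))"
      by metis
    define Q where "Q i = cbox (a i - vec (3 * C * diameter (U i) powr (s / 5))) (a i
      + vec (3 * C * diameter (U i) powr (s / 5)))" for i
    have sub: "box (vec 0) (vec 1 :: real ^ 5) \<subseteq> (\<Union>i. if U i = {} then {} else Q i)"
    proof
      fix y :: "real ^ 5" assume "y \<in> box (vec 0) (vec 1)"
      then have "\<forall>k. \<exists>b. g b = y $ k"
        using dyadic_surj unfolding g_def by (metis mem_box_cart(1) less_imp_le vec_component)
      then obtain b where b: "\<And>k. g (b k) = y $ k" by metis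
      have "(\<chi> k. cantor l (b k)) \<in> cube" by (auto simp: cube_def)
      then obtain i where i: "(\<chi> k. cantor l (b k)) \<in> U i" using assms(3) cover by blast
      then have "y \<in> V i" using b by (auto simp: V_def)
      then have "y \<in> Q i" using a by (auto simp: Q_def)
      with i have "y \<in> (if U i = {} then {} else Q i)" by auto
      then show "y \<in> (\<Union>i. if U i = {} then {} else Q i)" by blast
    qed
    have Q: "emeasure lborel (if U i = {} then {} else Q i) \<le> ennreal M * diam_pow s (U i)" for i
    proof (cases "U i = {}")
      case False
      define r where "r = 3 * C * diameter (U i) powr (s / 5)"
      have "0 \<le> r" using \<open>0 < C\<close> by (simp add: r_def)
      have "measure lborel (Q i) = (\<Prod>k\<in>(UNIV :: 5 set). 2 * r)"
        unfolding Q_def r_def[symmetric] using \<open>0 \<le> r\<close>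
        by (subst content_cbox_cart) (auto simp: interval_ne_empty_cart)
      also have "\<dots> = M * diameter (U i) powr s"
      proof -
        have "(diameter (U i) powr (s / 5)) ^ 5 = diameter (U i) powr s"
          by (cases "diameter (U i) = 0") (simp_all add: powr_power)
        then show ?thesis by (simp add: r_def M_def power_mult_distrib)
      qed
      finally have m: "measure lborel (Q i) = M * diameter (U i) powr s" .
      have "emeasure lborel (Q i) \<noteq> \<infinity>"
        unfolding Q_def by (rule less_imp_neq[OF emeasure_lborel_cbox_finite])
      then have "emeasure lborel (Q i) = ennreal (M * diameter (U i) powr s)"
        unfolding m[symmetric] by (intro emeasure_eq_ennreal_measure) simp
      then show ?thesis
        using False \<open>0 < M\<close> assms(1) by (simp add: diam_pow_def ennreal_mult)
    qed simp
    have "1 = emeasure lborel (box (vec 0) (vec 1 :: real ^ 5))"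
    proof -
      have "measure lborel (cbox (vec 0) (vec 1 :: real ^ 5)) = 1"
        by (subst content_cbox_cart) (auto simp: interval_ne_empty_cart)
      moreover have "emeasure lborel (cbox (vec 0) (vec 1 :: real ^ 5)) \<noteq> \<infinity>"
        by (rule less_imp_neq[OF emeasure_lborel_cbox_finite])
      ultimately have "emeasure lborel (cbox (vec 0) (vec 1 :: real ^ 5)) = 1"
        using emeasure_eq_ennreal_measure[of lborel "cbox (vec 0) (vec 1 :: real ^ 5)"] by simp
      then show ?thesis
        by (simp only: emeasure_lborel_box_eq emeasure_lborel_cbox_eq)
    qed
    also have "\<dots> \<le> emeasure lborel (\<Union>i. if U i = {} then {} else Q i)"
      by (rule emeasure_mono[OF sub]) (auto simp: Q_def)
    also have "\<dots> \<le> (\<Sum>i. emeasure lborel (if U i = {} then {} else Q i))"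
      by (rule emeasure_subadditive_countably) (auto simp: Q_def)
    also have "\<dots> \<le> (\<Sum>i. ennreal M * diam_pow s (U i))"
      by (rule suminf_le[OF Q]) auto
    also have "\<dots> = ennreal M * (\<Sum>i. diam_pow s (U i))"
      by simp
    finally have "ennreal (1 / M) * 1 \<le> ennreal (1 / M) * (ennreal M * (\<Sum>i. diam_pow s (U i)))"
      by (rule mult_left_mono) simp
    also have "\<dots> = (\<Sum>i. diam_pow s (U i))"
      using \<open>0 < M\<close> by (simp flip: mult.assoc ennreal_mult)
    finally show "ennreal (1 / M) \<le> (\<Sum>i. diam_pow s (U i))" by simp
  qed
  then show ?thesis
    using \<open>0 < M\<close> by (metis ennreal_eq_0_iff divide_le_0_1_iff le_zero_eq not_gr_zero not_less)
qed

text \<open>The 2^(5 k) boxes of stage k cover \<open>cube\<close>; their finite union is closed and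
  hence contains the closure as well. The factor 5 in the diameter comes from the l1 bound of the
  norm.\<close>

lemma cube_premeasure_le:
  assumes "0 < s" "0 < \<delta>" "countable X" "A \<subseteq> closure cube \<union> X" "5 * l k \<le> \<delta>"
  shows "hausdorff_premeasure s \<delta> A \<le> ennreal (2 ^ (5 * k) * (5 * l k) powr s)"
proof -
  \<comment> \<open>The left end point as a function of the index alone, well defined by
    \<open>pre_eq_of_idx_eq\<close>.\<close>
  define p where "p n = pre l k (SOME b. idx k b = n)" for n
  have p: "p (idx k b) = pre l k b" for b
    unfolding p_def by (rule pre_eq_of_idx_eq) (rule someI[of "\<lambda>c. idx k c = idx k b" b], simp)
  define J where "J = (UNIV :: 5 set) \<rightarrow>\<^sub>E {..<(2 :: nat) ^ k}"
  define V :: "(5 \<Rightarrow> nat) \<Rightarrow> (real ^ 5) set" where "V v = cbox (\<chi> i. p (v i)) (\<chi> i. p (v i) + l k)" for v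
  have J: "finite J" "card J = 2 ^ (5 * k)"
    by (simp_all add: J_def finite_PiE card_PiE power_mult mult.commute)
  have "cube \<subseteq> (\<Union>v\<in>J. V v)"
  proof
    fix x assume "x \<in> cube"
    then obtain b where b: "\<And>i. x $ i = cantor l (b i)" by (auto simp: cube_def)
    have "(\<lambda>i. idx k (b i)) \<in> J" by (auto simp: J_def PiE_iff extensional_def idx_less)
    moreover have "x \<in> V (\<lambda>i. idx k (b i))"
      using cantor_ge cantor_le by (simp add: V_def mem_box_cart p b)
    ultimately show "x \<in> (\<Union>v\<in>J. V v)" by blast
  qed
  moreover have "closed (\<Union>v\<in>J. V v)"
    by (intro closed_UN J) (auto simp: V_def)
  ultimately have "closure cube \<subseteq> (\<Union>v\<in>J. V v)" by (rule closure_minimal)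
  then have cover: "A \<subseteq> (\<Union>v\<in>J. V v) \<union> X" using assms(4) by blast
  have ne: "V v \<noteq> {}" for v
    using pos[of k] by (auto simp: V_def interval_ne_empty_cart intro: less_imp_le)
  have diam: "diameter (V v) \<le> 5 * l k" for v
  proof (rule diameter_le)
    show "V v \<noteq> {} \<or> 0 \<le> 5 * l k" using ne by blast
    fix x y assume "x \<in> V v" "y \<in> V v"
    then have *: "p (v i) \<le> x $ i" "x $ i \<le> p (v i) + l k" "p (v i) \<le> y $ i" "y $ i \<le> p (v i) + l k" for i
      by (simp_all add: V_def mem_box_cart)
    have "\<bar>(x - y) $ i\<bar> \<le> l k" for i
      using *[of i] by (simp add: abs_le_iff)
    then have "(\<Sum>i\<in>UNIV. \<bar>(x - y) $ i\<bar>) \<le> (\<Sum>i\<in>(UNIV :: 5 set). l k)" by (intro sum_mono)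
    then show "norm (x - y) \<le> 5 * l k"
      using norm_le_l1_cart[of "x - y"] by simp
  qed
  have "hausdorff_premeasure s \<delta> A \<le> (\<Sum>v\<in>J. diam_pow s (V v))"
    using diam assms(5) by (intro hausdorff_premeasure_le_cover[OF assms(1,2) J(1) assms(3) cover]) (auto
      simp: V_def intro: order_trans)
  also have "\<dots> \<le> (\<Sum>v\<in>J. ennreal ((5 * l k) powr s))"
    using diam ne assms(1) diameter_ge_0[of "V _"]
    by (intro sum_mono) (auto simp: diam_pow_def V_def intro!: ennreal_leI powr_mono2 diameter_ge_0
      bounded_cbox)
  also have "\<dots> = ennreal (2 ^ (5 * k) * (5 * l k) powr s)"
    by (simp add: J ennreal_mult ennreal_power[symmetric] flip: ennreal_numeral)
  finally show ?thesis .
qed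

lemma eventually_small: "0 < \<delta> \<Longrightarrow> \<forall>\<^sub>F k in sequentially. 5 * l k \<le> \<delta>"
  using order_tendstoD(2)[OF l_tendsto_0, of "\<delta> / 5"] by (auto elim!: eventually_mono)

lemma cube_measure_le:
  assumes "0 < s" "countable X" "A \<subseteq> closure cube \<union> X" "\<And>k. 2 ^ (5 * k) * (5 * l k) powr s \<le> M"
  shows "hausdorff_measure s A \<le> ennreal M"
  unfolding hausdorff_measure_def
proof (rule SUP_least)
  fix \<delta> :: real assume "\<delta> \<in> {0<..}"
  then have "0 < \<delta>" by simp
  then obtain k where "5 * l k \<le> \<delta>" using eventually_small by (auto simp: eventually_sequentially)
  then have "hausdorff_premeasure s \<delta> A \<le> ennreal (2 ^ (5 * k) * (5 * l k) powr s)"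
    by (rule cube_premeasure_le[OF assms(1) \<open>0 < \<delta>\<close> assms(2,3)])
  also have "\<dots> \<le> ennreal M" by (rule ennreal_leI) (rule assms(4))
  finally show "hausdorff_premeasure s \<delta> A \<le> ennreal M" .
qed

lemma cube_measure_zero:
  assumes "0 < s" "countable X" "A \<subseteq> closure cube \<union> X" "(\<lambda>k. 2 ^ (5 * k) * (5 * l k) powr s) \<longlonglongrightarrow> 0"
  shows "hausdorff_measure s A = 0"
proof -
  have "hausdorff_premeasure s \<delta> A \<le> 0" if "0 < \<delta>" for \<delta>
  proof (rule tendsto_lowerbound)
    show "(\<lambda>k. ennreal (2 ^ (5 * k) * (5 * l k) powr s)) \<longlonglongrightarrow> 0"
      using tendsto_ennrealI[OF assms(4)] by simp
    show "\<forall>\<^sub>F k in sequentially. hausdorff_premeasure s \<delta> A \<le> ennreal (2 ^ (5 * k) * (5 * l k) powr s)"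
      using eventually_small[OF that] by eventually_elim (rule cube_premeasure_le[OF assms(1) that
        assms(2,3)])
  qed simp
  then show ?thesis by (simp add: hausdorff_measure_def SUP_eq_iff)
qed

lemma cube_subset_ball:
  assumes "l 0 \<le> 1 / 8"
  shows "closure cube \<subseteq> ball 0 1"
proof -
  have "cube \<subseteq> cball 0 (5 / 8)"
  proof
    fix x assume "x \<in> cube"
    then obtain b where "\<And>i. x $ i = cantor l (b i)" by (auto simp: cube_def)
    then have "\<bar>x $ i\<bar> \<le> 1 / 8" for i
      using cantor_bounds[of "b i"] assms by simp
    then have "(\<Sum>i\<in>UNIV. \<bar>x $ i\<bar>) \<le> (\<Sum>i\<in>(UNIV :: 5 set). 1 / 8)" by (intro sum_mono)
    then show "x \<in> cball 0 (5 / 8)"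
      using norm_le_l1_cart[of x] by simp
  qed
  then have "closure cube \<subseteq> cball 0 (5 / 8)" by (rule closure_minimal) simp
  then show ?thesis by force
qed

text \<open>The midpoint of any stage k interval is the midpoint of a removed gap. Points of the
  same interval lie in one of its two children; all others lie outside the interval, even farther
  away.\<close>

lemma gap:
  assumes "2 * l (Suc k) < l k"
  shows "(l k - 2 * l (Suc k)) / 2 \<le> \<bar>pre l k b + l k / 2 - cantor l c\<bar>"
proof -
  have p: "0 < l (Suc k)" "0 < l k" using pos by auto
  consider "idx k c = idx k b" | "idx k b < idx k c" | "idx k c < idx k b" by linarith
  then show ?thesis
  proof cases
    case 1
    note eq = pre_eq_of_idx_eq[OF 1]
    show ?thesis
    proof (cases "c k")
      case True
      then have "pre l k b + (l k - l (Suc k)) \<le> cantor l c"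
        using cantor_ge[of "Suc k" c] eq by simp
      then show ?thesis using p by (simp add: abs_if field_simps)
    next
      case False
      then have "cantor l c \<le> pre l k b + l (Suc k)"
        using cantor_le[of c "Suc k"] eq by simp
      then show ?thesis using p assms by (simp add: abs_if field_simps)
    qed
  next
    case 2
    then have "1 * l k \<le> (real (idx k c) - real (idx k b)) * l k"
      using p by (intro mult_right_mono) auto
    then have "pre l k b + l k \<le> cantor l c"
      using pre_diff_ge[of k b c] 2 cantor_ge[of k c] by simp
    then show ?thesis using p by (simp add: abs_if field_simps)
  next
    case 3
    then have "1 * l k \<le> (real (idx k b) - real (idx k c)) * l k"
      using p by (intro mult_right_mono) auto
    then have "cantor l c \<le> pre l k b"
      using pre_diff_ge[of k c b] 3 cantor_le[of c k] by simp
    then show ?thesis using p by (simp add: abs_if field_simps)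
  qed
qed

text \<open>Moving the first coordinate of a point of \<open>cube\<close> to the midpoint of its
  stage k interval changes it by at most l k, yet leads to a positive distance from
  \<open>cube\<close>.\<close>

lemma interior_cube:
  assumes strict: "\<And>k. 2 * l (Suc k) < l k"
  shows "interior (closure cube) = {}"
proof (rule ccontr)
  assume "interior (closure cube) \<noteq> {}"
  then obtain x where "x \<in> interior (closure cube)" by blast
  then obtain e where e: "0 < e" "ball x e \<subseteq> closure cube"
    by (auto simp: mem_interior)
  then have "x \<in> closure cube" by (meson centre_in_ball subsetD)
  then obtain y where y: "y \<in> cube" "dist y x < e / 2"
    using e(1) by (meson closure_approachable half_gt_zero)
  then obtain b where b: "\<And>i. y $ i = cantor l (b i)" by (auto simp: cube_def)
  obtain k where k: "l k < e / 2"
    using order_tendstoD(2)[OF l_tendsto_0, of "e / 2"] e(1) by (auto simp: eventually_sequentially)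
  define w where "w = pre l k (b 1) + l k / 2"
  define z where "z = y + (w - y $ 1) *\<^sub>R axis 1 1"
  have "\<bar>w - y $ 1\<bar> \<le> l k"
    using cantor_ge[of k "b 1"] cantor_le[of "b 1" k] pos[of k] by (simp add: w_def b abs_le_iff)
  then have "dist z y \<le> l k" by (simp add: z_def dist_norm)
  then have "dist x z < e"
    using y(2) k dist_triangle[of x z y] by (simp add: dist_commute)
  then have "z \<in> closure cube" using e(2) by auto
  moreover have "0 < (l k - 2 * l (Suc k)) / 2" using strict[of k] by simp
  ultimately obtain v where v: "v \<in> cube" "dist v z < (l k - 2 * l (Suc k)) / 2"
    by (meson closure_approachable)
  then obtain c where c: "\<And>i. v $ i = cantor l (c i)" by (auto simp: cube_def)
  have "\<bar>w - cantor l (c 1)\<bar> \<le> dist v z"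
    using component_le_norm_cart[of "v - z" 1] by (simp add: dist_norm c z_def axis_def abs_minus_commute)
  then show False
    using gap[OF strict, of k "b 1" "c 1"] v(2) by (simp add: w_def)
qed

end

subsection \<open>Prescribed dimension and measure\<close>

definition solves :: "(real ^ 5 \<Rightarrow> real) \<Rightarrow> (real ^ 5 ^ 5 \<Rightarrow> real) \<Rightarrow> bool" where
  "solves u F \<longleftrightarrow> C11_on (ball 0 1) u \<and> uniformly_elliptic F \<and> viscosity_solution F (ball 0 1) u"

lemma (in cantor_lengths) solution_on_cube:
  assumes "\<And>k. 2 * l (Suc k) < l k" "l 0 \<le> 1 / 8"
  obtains X u F where "solves u F" "countable X" "cube \<subseteq> Sing (ball 0 1) u"
    "Sing (ball 0 1) u \<subseteq> closure cube \<union> X" "Sing (ball 0 1) u \<noteq> {}"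
proof -
  have "(\<chi> i. cantor l (\<lambda>_. False)) \<in> cube"
    by (auto simp: cube_def intro!: exI[of _ "\<lambda>_ _. False"])
  then have ne: "cube \<noteq> {}" by blast
  then have "closure cube \<noteq> {}" by simp
  then obtain X u F where "countable X" "C11_on (ball 0 1) u" "uniformly_elliptic F"
    "viscosity_solution F (ball 0 1) u" and S: "Sing (ball 0 1) u = (closure cube \<union> X) \<inter> ball 0 1"
    by (rule singular_solution_exists[OF closed_closure _ interior_cube[OF assms(1)]]) blast
  moreover have "cube \<subseteq> Sing (ball 0 1) u"
    using S closure_subset[of cube] cube_subset_ball[OF assms(2)] by blast
  ultimately show ?thesis
    using that[of u F X] ne by (auto simp: solves_def)
qed

text \<open>The ratio q of a self-similar set with 32 copies solves 32 q^s = 1, and s \<le> 5 means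
  q \<le> 1/2.\<close>

context
  fixes s q :: real
  assumes s: "0 < s" "s \<le> 5" and q_def: "q = 2 powr (- 5 / s)"
begin

lemma q_bounds: "0 < q" "q \<le> 1 / 2"
proof -
  have "- 5 / s \<le> - 1" using s by (simp add: field_simps)
  then have "q \<le> 2 powr (- 1)" unfolding q_def by (intro powr_mono) auto
  then show "q \<le> 1 / 2" by (simp add: powr_minus)
qed (simp add: q_def)

lemma q_powr: "(q ^ k) powr s = (1 / 32) ^ k" "(q ^ k) powr (s / 5) = (1 / 2) ^ k"
proof -
  have pow: "(q ^ k) powr a = (q powr a) ^ k" for a
    using q_bounds by (simp add: powr_realpow[symmetric] powr_powr mult.commute)
  have "q powr s = 2 powr (- 5)" "q powr (s / 5) = 2 powr (- 1)"
    using s by (simp_all add: q_def powr_powr)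
  then have "q powr s = 1 / 32" "q powr (s / 5) = 1 / 2"
    by (simp_all add: powr_minus)
  then show "(q ^ k) powr s = (1 / 32) ^ k" "(q ^ k) powr (s / 5) = (1 / 2) ^ k"
    by (simp_all only: pow)
qed

lemma q_powr_power: "(q ^ k) powr a = (q powr a) ^ k"
  using q_bounds by (simp add: powr_realpow[symmetric] powr_powr mult.commute)

lemma two_power: "(2 :: real) ^ (5 * k) = 32 ^ k"
  by (simp add: power_mult)

lemma positive_finite_solution:
  obtains u F where "solves u F" "hausdorff_dim (Sing (ball 0 1) u) = ennreal s"
    "0 < hausdorff_measure s (Sing (ball 0 1) u)" "hausdorff_measure s (Sing (ball 0 1) u) < \<infinity>"
proof -
  \<comment> \<open>The factor 1 + 2^(-k) keeps \<open>strict\<close> true even for q = 1/2, that is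
    s = 5, where the set has positive volume. It lies between 1 and 2, so l k stays comparable to
    q^k, and l 0 = 1/8.\<close>
  define l where "l k = 1 / 16 * q ^ k * (1 + (1 / 2) ^ k)" for k
  have strict: "2 * l (Suc k) < l k" for k
  proof -
    have "2 * l (Suc k) = (2 * q) * (1 / 16 * q ^ k * (1 + (1 / 2) ^ Suc k))"
      by (simp add: l_def)
    also have "\<dots> \<le> 1 * (1 / 16 * q ^ k * (1 + (1 / 2) ^ Suc k))"
      using q_bounds by (intro mult_right_mono) auto
    also have "\<dots> < l k"
      using q_bounds by (simp add: l_def)
    finally show ?thesis .
  qed
  interpret cantor_lengths l
  proof
    show "0 < l k" for k
      using q_bounds by (simp add: l_def add_pos_pos)
    show "2 * l (Suc k) \<le> l k" for k
      using strict by (rule less_imp_le)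
  qed
  have "l 0 \<le> 1 / 8" by (simp add: l_def)
  then obtain X u F where u: "solves u F" "countable X" and sub: "cube \<subseteq> Sing (ball 0 1) u"
    "Sing (ball 0 1) u \<subseteq> closure cube \<union> X" and ne: "Sing (ball 0 1) u \<noteq> {}"
    by (rule solution_on_cube[OF strict])
  have le: "5 * l k \<le> q ^ k" for k
  proof -
    have "(1 / 2 :: real) ^ k \<le> 1" by (simp add: power_le_one)
    then have "q ^ k * (5 / 16 * (1 + (1 / 2) ^ k)) \<le> q ^ k * 1"
      using q_bounds by (intro mult_left_mono) auto
    then show ?thesis by (simp add: l_def algebra_simps)
  qed
  have upper: "2 ^ (5 * k) * (5 * l k) powr t \<le> (32 * q powr t) ^ k" if "0 < t" for t k
  proof -
    have "(5 * l k) powr t \<le> (q ^ k) powr t"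
      using le pos[of k] that by (intro powr_mono2) auto
    then show ?thesis by (simp add: two_power power_mult_distrib q_powr_power)
  qed
  have "hausdorff_measure s (Sing (ball 0 1) u) \<le> ennreal 1"
  proof (rule cube_measure_le[OF s(1) u(2) sub(2)])
    fix k
    have "q powr s = 1 / 32" using q_powr(1)[of 1] by (simp only: power_one_right)
    then have "32 * q powr s = 1" by simp
    then have "(32 * q powr s) ^ k = 1" by (simp only: power_one)
    then show "2 ^ (5 * k) * (5 * l k) powr s \<le> 1"
      using upper[OF s(1), of k] by linarith
  qed
  then have fin: "hausdorff_measure s (Sing (ball 0 1) u) < \<infinity>"
    by (rule le_less_trans) simp
  have pos: "0 < hausdorff_measure t (Sing (ball 0 1) u)" if t: "0 < t" "t \<le> s" for t
  proof (rule cube_positive_measure[OF t(1) _ sub(1), of "2 / (1 / 16) powr (s / 5)"])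
    fix k
    \<comment> \<open>The base is at most 1, so lowering the exponent from s to t only increases the
      power; one constant thus serves all t \<le> s.\<close>
    have "(1 / 16 * q ^ Suc k) powr (s / 5) \<le> (1 / 16 * q ^ Suc k) powr (t / 5)"
      using q_bounds t power_le_one[of q "Suc k"] by (intro powr_mono') auto
    also have "\<dots> \<le> l (Suc k) powr (t / 5)"
      using q_bounds t by (intro powr_mono2) (auto simp: l_def)
    also have "(1 / 16 * q ^ Suc k) powr (s / 5) = (1 / 16) powr (s / 5) * (1 / 2) ^ Suc k"
      unfolding q_powr(2)[symmetric] by (rule powr_mult)
    finally show "(1 / 2) ^ k \<le> 2 / (1 / 16) powr (s / 5) * l (Suc k) powr (t / 5)"
      by (simp add: field_simps)
  qed
  have "hausdorff_dim (Sing (ball 0 1) u) = ennreal s"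
  proof (rule hausdorff_dim_eq)
    show "0 \<le> s" using s by simp
    fix t
    show "hausdorff_measure t (Sing (ball 0 1) u) = 0" if "s < t"
    proof (rule cube_measure_zero[OF _ u(2) sub(2)])
      show "0 < t" using s that by simp
      have "q powr t < q powr s"
        using q_bounds that by (intro powr_less_mono') auto
      then have "\<bar>32 * q powr t\<bar> < 1"
        using q_powr(1)[of 1] by simp
      then have lim: "(\<lambda>k. (32 * q powr t) ^ k) \<longlonglongrightarrow> 0"
        by (intro LIMSEQ_power_zero) simp
      show "(\<lambda>k. 2 ^ (5 * k) * (5 * l k) powr t) \<longlonglongrightarrow> 0"
        using upper[OF \<open>0 < t\<close>] by (intro tendsto_sandwich[OF _ _ tendsto_const lim]) (auto intro!:
          always_eventually)
    qed
    show "hausdorff_measure t (Sing (ball 0 1) u) \<noteq> 0" if "0 \<le> t" "t < s"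
      using pos[of t] hausdorff_measure_0_ge[OF ne] that by (cases "t = 0") auto
  qed
  then show ?thesis
    using that u(1) pos[of s] fin s by simp
qed

lemma null_solution:
  obtains u F where "solves u F" "hausdorff_dim (Sing (ball 0 1) u) = ennreal s"
    "hausdorff_measure s (Sing (ball 0 1) u) = 0"
proof -
  \<comment> \<open>Dividing by k + 1 sends 2^(5 k) (l k)^s to 0, while a polynomial factor does not
    change the dimension. It also makes \<open>strict\<close> hold for q = 1/2.\<close>
  define l where "l k = 1 / 8 * q ^ k / (real k + 1)" for k
  have strict: "2 * l (Suc k) < l k" for k
  proof -
    have "2 * l (Suc k) = (2 * q) * (1 / 8 * q ^ k / (real k + 2))"
      by (simp add: l_def add.commute)
    also have "\<dots> \<le> 1 * (1 / 8 * q ^ k / (real k + 2))"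
      using q_bounds by (intro mult_right_mono) auto
    also have "\<dots> < l k"
      using q_bounds by (simp add: l_def frac_less2)
    finally show ?thesis .
  qed
  interpret cantor_lengths l
  proof
    show "0 < l k" for k
      using q_bounds by (simp add: l_def)
    show "2 * l (Suc k) \<le> l k" for k
      using strict by (rule less_imp_le)
  qed
  have "l 0 \<le> 1 / 8" by (simp add: l_def)
  then obtain X u F where u: "solves u F" "countable X" and sub: "cube \<subseteq> Sing (ball 0 1) u"
    "Sing (ball 0 1) u \<subseteq> closure cube \<union> X" and ne: "Sing (ball 0 1) u \<noteq> {}"
    by (rule solution_on_cube[OF strict])
  have le1: "5 * l k \<le> 1" for k
  proof -
    have "l k \<le> l 0" by (rule l_antimono) simp
    then show ?thesis by (simp add: l_def[of 0])
  qed
  have lim: "(\<lambda>k. 2 ^ (5 * k) * (5 * l k) powr s) \<longlonglongrightarrow> 0"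
  proof -
    have "2 ^ (5 * k) * (5 * l k) powr s = (5 / 8 / (real k + 1)) powr s" for k
    proof -
      have "5 * l k = q ^ k * (5 / 8 / (real k + 1))" by (simp add: l_def)
      then have "(5 * l k) powr s = (q ^ k) powr s * (5 / 8 / (real k + 1)) powr s"
        using q_bounds by (simp only:) (rule powr_mult; simp)
      then show ?thesis by (simp add: q_powr two_power power_divide)
    qed
    moreover have "(\<lambda>k. (5 / 8 / (real k + 1)) powr s) \<longlonglongrightarrow> 0 powr s"
    proof (rule tendsto_powr')
      show "(\<lambda>k. 5 / 8 / (real k + 1)) \<longlonglongrightarrow> 0"
      proof -
        have "5 / 8 / (real k + 1) = 5 / 8 * inverse (real (Suc k))" for k
          by (simp add: field_simps)
        then show ?thesis
          by (simp only:) (rule tendsto_mult_right_zero[OF LIMSEQ_inverse_real_of_nat])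
      qed
    qed (use s in auto)
    ultimately show ?thesis using s by simp
  qed
  have zero: "hausdorff_measure t (Sing (ball 0 1) u) = 0" if "s \<le> t" for t
  proof (rule cube_measure_zero[OF _ u(2) sub(2)])
    show "0 < t" using s that by simp
    have "2 ^ (5 * k) * (5 * l k) powr t \<le> 2 ^ (5 * k) * (5 * l k) powr s" for k
      using le1[of k] pos[of k] that by (intro mult_left_mono powr_mono') auto
    then show "(\<lambda>k. 2 ^ (5 * k) * (5 * l k) powr t) \<longlonglongrightarrow> 0"
      by (intro tendsto_sandwich[OF _ _ tendsto_const lim]) (auto intro!: always_eventually)
  qed
  have pos: "0 < hausdorff_measure t (Sing (ball 0 1) u)" if t: "0 < t" "t < s" for t
  proof -
    define r where "r = q powr (t / 5)"
    have "q powr (s / 5) < r"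
      unfolding r_def using q_bounds t by (intro powr_less_mono') auto
    then have r: "1 / 2 < r" using q_powr(2)[of 1] by simp
    \<comment> \<open>For t < s the ratio a of the dyadic factor 1/2 to r = q^(t/5) is below 1, so
      a^k outweighs the polynomial loss k + 2; B bounds the product.\<close>
    define a where "a = 1 / (2 * r)"
    have a: "0 < a" "a < 1" using r by (simp_all add: a_def)
    have "(\<lambda>k. real k * a ^ k + 2 * a ^ k) \<longlonglongrightarrow> 0 + 2 * 0"
      using a by (intro tendsto_intros powser_times_n_limit_0 LIMSEQ_power_zero) auto
    then have "Bseq (\<lambda>k. real k * a ^ k + 2 * a ^ k)"
      by (intro convergent_imp_Bseq) (auto simp: convergent_def)
    then obtain B where "0 < B" "\<And>k. norm (real k * a ^ k + 2 * a ^ k) \<le> B"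
      by (auto simp: Bseq_def)
    then have B: "(real k + 2) * a ^ k \<le> B" for k
      using abs_le_D1[of "real k * a ^ k + 2 * a ^ k" B] by (simp add: algebra_simps)
    define d where "d = (1 / 8 :: real) powr (t / 5)"
    have "0 < d" by (simp add: d_def)
    show ?thesis
    proof (rule cube_positive_measure[OF t(1) _ sub(1), of "B / (r * d)"])
      fix k
      have "l (Suc k) powr (t / 5) = d * r ^ Suc k / (real k + 2) powr (t / 5)"
      proof -
        have "l (Suc k) = 1 / 8 * q ^ Suc k / (real k + 2)" by (simp add: l_def add.commute)
        then show ?thesis
          using q_bounds by (simp only: d_def r_def q_powr_power[symmetric]) (subst powr_divide
            powr_mult; simp)+
      qed
      moreover have "(real k + 2) powr (t / 5) \<le> (real k + 2) powr 1"
        using t s by (intro powr_mono) auto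
      ultimately have "d * r ^ Suc k / (real k + 2) \<le> l (Suc k) powr (t / 5)"
        using \<open>0 < d\<close> r by (simp add: frac_le)
      then have "B / (r * d) * (d * r ^ Suc k / (real k + 2)) \<le> B / (r * d) * l (Suc k) powr (t / 5)"
        using \<open>0 < B\<close> \<open>0 < d\<close> r by (intro mult_left_mono) auto
      moreover have "B / (r * d) * (d * r ^ Suc k / (real k + 2)) = B * r ^ k / (real k + 2)"
        using \<open>0 < d\<close> r by (simp add: field_simps)
      moreover have "(1 / 2) ^ k \<le> B * r ^ k / (real k + 2)"
      proof -
        have "(1 / 2) ^ k * (real k + 2) = ((real k + 2) * a ^ k) * r ^ k"
          using r by (simp add: a_def power_divide power_mult_distrib)
        also have "\<dots> \<le> B * r ^ k"
          using B[of k] r by (intro mult_right_mono) auto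
        finally show ?thesis by (simp add: pos_le_divide_eq)
      qed
      ultimately show "(1 / 2) ^ k \<le> B / (r * d) * l (Suc k) powr (t / 5)" by linarith
    qed
  qed
  have "hausdorff_dim (Sing (ball 0 1) u) = ennreal s"
  proof (rule hausdorff_dim_eq)
    show "0 \<le> s" using s by simp
    show "hausdorff_measure t (Sing (ball 0 1) u) = 0" if "s < t" for t
      using zero that by simp
    show "hausdorff_measure t (Sing (ball 0 1) u) \<noteq> 0" if "0 \<le> t" "t < s" for t
      using pos[of t] hausdorff_measure_0_ge[OF ne] that by (cases "t = 0") auto
  qed
  then show ?thesis
    using that u(1) zero[of s] by simp
qed

end

text \<open>With \<open>K\<close> a single point the singular set is countable, hence null for every
  positive order.\<close>

lemma zero_dimensional_solution:
  obtains u F where "solves u F" "hausdorff_dim (Sing (ball 0 1) u) = ennreal 0"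
proof -
  obtain X u F where X: "countable X" and u: "C11_on (ball 0 1) u" "uniformly_elliptic F"
    "viscosity_solution F (ball 0 1) u" and S: "Sing (ball 0 1) u = ({0 :: real ^ 5} \<union> X) \<inter> ball 0 1"
    by (rule singular_solution_exists[OF closed_singleton[of 0] insert_not_empty interior_singleton]) blast
  have "hausdorff_dim (Sing (ball 0 1) u) = ennreal 0"
  proof (rule hausdorff_dim_eq)
    have "countable (Sing (ball 0 1) u)"
      unfolding S using X by (intro countable_Int1) simp
    then show "hausdorff_measure t (Sing (ball 0 1) u) = 0" if "0 < t" for t
      using that by (intro hausdorff_measure_countable)
  qed auto
  with u that show ?thesis by (auto simp: solves_def)
qed

theorem corollary1p5:
  fixes s :: real
  assumes "0 \<le> s" and "s \<le> 5"
  shows "(\<exists>(u :: real ^ 5 \<Rightarrow> real) F.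
            C11_on (ball 0 1) u \<and> uniformly_elliptic F \<and> viscosity_solution F (ball 0 1) u \<and>
            hausdorff_dim (Sing (ball 0 1) u) = ennreal s) \<and>
         (0 < s \<longrightarrow>
            (\<exists>(u :: real ^ 5 \<Rightarrow> real) F.
               C11_on (ball 0 1) u \<and> uniformly_elliptic F \<and> viscosity_solution F (ball 0 1) u \<and>
               hausdorff_dim (Sing (ball 0 1) u) = ennreal s \<and>
               hausdorff_measure s (Sing (ball 0 1) u) = 0) \<and>
            (\<exists>(u :: real ^ 5 \<Rightarrow> real) F.
               C11_on (ball 0 1) u \<and> uniformly_elliptic F \<and> viscosity_solution F (ball 0 1) u \<and>
               hausdorff_dim (Sing (ball 0 1) u) = ennreal s \<and>
               0 < hausdorff_measure s (Sing (ball 0 1) u) \<and>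
               hausdorff_measure s (Sing (ball 0 1) u) < \<infinity>))"
proof (cases "s = 0")
  case True
  then show ?thesis
    using zero_dimensional_solution unfolding solves_def by (metis less_irrefl)
next
  case False
  then have "0 < s" using assms(1) by simp
  then show ?thesis
    using null_solution[OF _ assms(2) refl] positive_finite_solution[OF _ assms(2) refl]
    unfolding solves_def by metis
qed

end
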